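(* Let $F\in\mathbb{D}^{1,2}$ be such that $E[F]=0$, and assume that $F=\delta(u)$ for some $u\in\mathbb{D}^{1,2}(\mathfrak{H})$. Let $S\geq 0$ be a random variable such that $S^2\in\mathbb{D}^{1,2}$, and let $\eta\sim\mathcal{N}(0,1)$ be a standard Gaussian random variable independent of the underlying isonormal Gaussian process $X$. Let $h\in\mathfrak{H}$. Assume that $\varphi:\mathbb{R}\to\mathbb{R}$ is of class $C^3$ with $\|\varphi''\|_\infty<\infty$ and $\|\varphi'''\|_\infty<\infty$. Then $$\bigl|E[\varphi(F+I_1(h))]-E[\varphi(S\eta+I_1(h))]\bigr|\leq \frac12\|\varphi''\|_\infty\, E\bigl[2|\langle u,h\rangle_{\mathfrak{H}}|+|\langle u,DF\rangle_{\mathfrak{H}}-S^2|\bigr]+\frac13\|\varphi'''\|_\infty\, E\bigl[|\langle u,DS^2\rangle_{\mathfrak{H}}|\bigr].$$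
   Context: $\mathfrak{H}$ is a real separable infinite-dimensional Hilbert space and $X=\{X(h):h\in\mathfrak{H}\}$ is an isonormal Gaussian process over $\mathfrak{H}$ on a probability space $(\Omega,\mathcal{F},P)$: a centered Gaussian family with $E[X(h)X(g)]=\langle h,g\rangle_{\mathfrak{H}}$; $\mathcal{F}$ is the $P$-completion of $\sigma(X)$. $I_1(h)=X(h)$. $D$ is the Malliavin derivative with respect to $X$; for an integer $k\ge1$, real $p\ge1$ and a Hilbert space $V$, $\mathbb{D}^{k,p}(V)$ is the usual Malliavin--Sobolev space of $V$-valued random variables ($\mathbb{D}^{k,p}=\mathbb{D}^{k,p}(\mathbb{R})$). $\delta$ is the adjoint of $D$ (divergence operator, or Skorohod integral), characterized by $E[G\delta(u)]=E[\langle DG,u\rangle_{\mathfrak{H}}]$ for all $G\in\mathbb{D}^{1,2}$. The random variable $\eta$ is defined on an extension of the probability space, and $S$ is $\mathcal{F}$-measurable. *)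

theory Defs
  imports "HOL-Probability.Probability"
begin

text \<open>The degenerate law \<open>\<N>(0, 0)\<close> is included: a Gaussian family contains the variable \<open>X 0\<close>.\<close>

definition centered_gaussian :: "'w measure \<Rightarrow> ('w \<Rightarrow> real) \<Rightarrow> bool" where
  "centered_gaussian M Z \<longleftrightarrow>
     Z \<in> borel_measurable M \<and>
     ((AE \<omega> in M. Z \<omega> = 0) \<or> (\<exists>\<sigma>>0. distributed M lborel Z (normal_density 0 \<sigma>)))"

definition centered_gaussian_family :: "'w measure \<Rightarrow> ('i \<Rightarrow> 'w \<Rightarrow> real) \<Rightarrow> bool" where
  "centered_gaussian_family M X \<longleftrightarrow>
     (\<forall>J c. finite J \<longrightarrow> centered_gaussian M (\<lambda>\<omega>. \<Sum>i\<in>J. c i * X i \<omega>))"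

definition isonormal_process :: "'w measure \<Rightarrow> ('h::real_inner \<Rightarrow> 'w \<Rightarrow> real) \<Rightarrow> bool" where
  "isonormal_process M X \<longleftrightarrow>
     prob_space M \<and> centered_gaussian_family M X \<and>
     (\<forall>g h. (\<integral>\<omega>. X g \<omega> * X h \<omega> \<partial>M) = g \<bullet> h)"

text \<open>The process as one random element of the product measurable space of real functions on
  the index type; its generated \<open>\<sigma>\<close>-algebra is \<open>\<sigma>(X)\<close>.\<close>

definition process_map :: "('i \<Rightarrow> 'w \<Rightarrow> real) \<Rightarrow> 'w \<Rightarrow> 'i \<Rightarrow> real" where
  "process_map X \<omega> = (\<lambda>i. X i \<omega>)"

definition generated_algebra :: "'w measure \<Rightarrow> ('i \<Rightarrow> 'w \<Rightarrow> real) \<Rightarrow> 'w measure" where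
  "generated_algebra M X =
     vimage_algebra (space M) (process_map X) (\<Pi>\<^sub>M i\<in>UNIV. borel)"

definition completion_of_generated :: "'w measure \<Rightarrow> ('i \<Rightarrow> 'w \<Rightarrow> real) \<Rightarrow> bool" where
  "completion_of_generated M X \<longleftrightarrow>
     sets M = sets (completion (restr_to_subalg M (generated_algebra M X)))"

text \<open>A function on \<open>\<real>\<^sup>n\<close>, for a number \<open>n\<close> that is not fixed by a type, is encoded as a function
  of a real sequence which depends on the coordinates below \<open>n\<close> only. For such functions,
  continuity for the product topology is continuity on \<open>\<real>\<^sup>n\<close>.\<close>

definition partial_deriv :: "nat \<Rightarrow> ((nat \<Rightarrow> real) \<Rightarrow> real) \<Rightarrow> (nat \<Rightarrow> real) \<Rightarrow> real" where
  "partial_deriv i f x = deriv (\<lambda>t. f (x(i := t))) (x i)"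

definition smooth_compact_support :: "nat \<Rightarrow> ((nat \<Rightarrow> real) \<Rightarrow> real) \<Rightarrow> bool" where
  "smooth_compact_support n f \<longleftrightarrow>
     (\<forall>x y. (\<forall>i<n. x i = y i) \<longrightarrow> f x = f y) \<and>
     (\<forall>is. set is \<subseteq> {..<n} \<longrightarrow>
        continuous_on UNIV (fold partial_deriv is f) \<and>
        (\<forall>i<n. \<forall>x. (\<lambda>t. fold partial_deriv is f (x(i := t))) field_differentiable (at (x i)))) \<and>
     (\<exists>R. \<forall>x. (\<exists>i<n. R < \<bar>x i\<bar>) \<longrightarrow> f x = 0)"

text \<open>\<open>smooth_cylindrical X F G\<close>: \<open>F = f(X(h\<^sub>0), \<dots>, X(h\<^sub>n\<^sub>-\<^sub>1))\<close> is smooth and cylindrical, and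
  \<open>G = \<Sum>i<n. \<partial>\<^sub>i f(X(h\<^sub>0), \<dots>, X(h\<^sub>n\<^sub>-\<^sub>1)) h\<^sub>i\<close> is its Malliavin derivative, computed from this
  representation of \<open>F\<close>.\<close>

definition smooth_cylindrical ::
  "('h::real_inner \<Rightarrow> 'w \<Rightarrow> real) \<Rightarrow> ('w \<Rightarrow> real) \<Rightarrow> ('w \<Rightarrow> 'h) \<Rightarrow> bool" where
  "smooth_cylindrical X F G \<longleftrightarrow>
     (\<exists>n\<ge>1. \<exists>f h. smooth_compact_support n f \<and>
        F = (\<lambda>\<omega>. f (\<lambda>i. X (h i) \<omega>)) \<and>
        G = (\<lambda>\<omega>. \<Sum>i<n. partial_deriv i f (\<lambda>i. X (h i) \<omega>) *\<^sub>R h i))"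

definition L2_tendsto ::
  "'w measure \<Rightarrow> (nat \<Rightarrow> 'w \<Rightarrow> 'v::real_normed_vector) \<Rightarrow> ('w \<Rightarrow> 'v) \<Rightarrow> bool" where
  "L2_tendsto M Fs F \<longleftrightarrow> (\<lambda>n. \<integral>\<^sup>+\<omega>. ennreal ((norm (Fs n \<omega> - F \<omega>))\<^sup>2) \<partial>M) \<longlonglongrightarrow> 0"

text \<open>The graph of \<open>D\<close>: the closure in \<open>L\<^sup>2(\<Omega>) \<times> L\<^sup>2(\<Omega>; \<HH>)\<close> of the graph of the derivative on
  smooth cylindrical variables. The derivative is determined up to almost sure equality.\<close>

definition has_malliavin_derivative ::
  "'w measure \<Rightarrow> ('h::{real_inner,banach,second_countable_topology} \<Rightarrow> 'w \<Rightarrow> real)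
    \<Rightarrow> ('w \<Rightarrow> real) \<Rightarrow> ('w \<Rightarrow> 'h) \<Rightarrow> bool" where
  "has_malliavin_derivative M X F G \<longleftrightarrow>
     F \<in> borel_measurable M \<and> G \<in> borel_measurable M \<and>
     (\<exists>Fs Gs. (\<forall>n. smooth_cylindrical X (Fs n) (Gs n)) \<and>
        L2_tendsto M Fs F \<and> L2_tendsto M Gs G)"

definition D12 ::
  "'w measure \<Rightarrow> ('h::{real_inner,banach,second_countable_topology} \<Rightarrow> 'w \<Rightarrow> real)
    \<Rightarrow> ('w \<Rightarrow> real) set" where
  "D12 M X = {F. \<exists>G. has_malliavin_derivative M X F G}"

definition malliavin_deriv ::
  "'w measure \<Rightarrow> ('h::{real_inner,banach,second_countable_topology} \<Rightarrow> 'w \<Rightarrow> real)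
    \<Rightarrow> ('w \<Rightarrow> real) \<Rightarrow> 'w \<Rightarrow> 'h" where
  "malliavin_deriv M X F = (SOME G. has_malliavin_derivative M X F G)"

text \<open>The Hilbert tensor product \<open>\<HH> \<otimes> V\<close> is identified with the Hilbert-Schmidt operators from
  \<open>\<HH>\<close> to \<open>V\<close>, where \<open>g \<otimes> v\<close> is the operator \<open>k \<mapsto> \<langle>g, k\<rangle> v\<close>. The supremum over finite
  orthonormal sets of \<open>\<Sum>e\<in>E. \<parallel>A e\<parallel>\<^sup>2\<close> is the squared Hilbert-Schmidt norm of a bounded
  operator \<open>A\<close>.\<close>

definition hs_norm_sq :: "('h::real_inner \<Rightarrow> 'v::real_normed_vector) \<Rightarrow> ennreal" where
  "hs_norm_sq A =
     (SUP E\<in>{E. finite E \<and> pairwise orthogonal E \<and> (\<forall>e\<in>E. norm e = 1)}.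
        ennreal (\<Sum>e\<in>E. (norm (A e))\<^sup>2))"

text \<open>\<open>U = \<Sum>j<m. F\<^sub>j v\<^sub>j\<close> with smooth cylindrical \<open>F\<^sub>j\<close>, and \<open>A = DU = \<Sum>j<m. DF\<^sub>j \<otimes> v\<^sub>j\<close>.\<close>

definition smooth_cylindrical_vec ::
  "('h::real_inner \<Rightarrow> 'w \<Rightarrow> real) \<Rightarrow> ('w \<Rightarrow> 'v::real_inner) \<Rightarrow> ('w \<Rightarrow> 'h \<Rightarrow> 'v) \<Rightarrow> bool" where
  "smooth_cylindrical_vec X U A \<longleftrightarrow>
     (\<exists>(m::nat) F G v. (\<forall>j<m. smooth_cylindrical X (F j) (G j)) \<and>
        U = (\<lambda>\<omega>. \<Sum>j<m. F j \<omega> *\<^sub>R v j) \<and>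
        A = (\<lambda>\<omega> k. \<Sum>j<m. (G j \<omega> \<bullet> k) *\<^sub>R v j))"

text \<open>The completion of the smooth \<open>V\<close>-valued variables under the norm
  \<open>\<parallel>U\<parallel>\<^sup>2 = E[\<parallel>U\<parallel>\<^sub>V\<^sup>2] + E[\<parallel>DU\<parallel>\<^sup>2]\<close>, as a subspace of \<open>L\<^sup>2(\<Omega>; V)\<close>: the limits in
  \<open>L\<^sup>2(\<Omega>; V)\<close> of sequences of smooth variables whose derivatives form a Cauchy sequence in
  \<open>L\<^sup>2(\<Omega>; \<HH> \<otimes> V)\<close>.\<close>

definition D12_vec ::
  "'w measure \<Rightarrow> ('h::real_inner \<Rightarrow> 'w \<Rightarrow> real)
    \<Rightarrow> ('w \<Rightarrow> 'v::{real_inner,banach,second_countable_topology}) set" where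
  "D12_vec M X = {U \<in> borel_measurable M.
     \<exists>Us As. (\<forall>n. smooth_cylindrical_vec X (Us n) (As n)) \<and> L2_tendsto M Us U \<and>
       (\<forall>\<epsilon>>0. \<exists>n\<^sub>0. \<forall>m\<ge>n\<^sub>0. \<forall>n\<ge>n\<^sub>0.
          (\<integral>\<^sup>+\<omega>. hs_norm_sq (\<lambda>k. As m \<omega> k - As n \<omega> k) \<partial>M) < \<epsilon>)}"

text \<open>The graph of \<open>\<delta>\<close>, the adjoint of the densely defined operator \<open>D\<close>: \<open>u\<close> belongs to the
  domain of \<open>\<delta>\<close> and \<open>Z\<close> is a version of \<open>\<delta>(u)\<close>.\<close>

definition has_divergence ::
  "'w measure \<Rightarrow> ('h::{real_inner,banach,second_countable_topology} \<Rightarrow> 'w \<Rightarrow> real)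
    \<Rightarrow> ('w \<Rightarrow> 'h) \<Rightarrow> ('w \<Rightarrow> real) \<Rightarrow> bool" where
  "has_divergence M X u Z \<longleftrightarrow>
     u \<in> borel_measurable M \<and> integrable M (\<lambda>\<omega>. (norm (u \<omega>))\<^sup>2) \<and>
     Z \<in> borel_measurable M \<and> integrable M (\<lambda>\<omega>. (Z \<omega>)\<^sup>2) \<and>
     (\<forall>G\<in>D12 M X. (\<integral>\<omega>. G \<omega> * Z \<omega> \<partial>M) = (\<integral>\<omega>. malliavin_deriv M X G \<omega> \<bullet> u \<omega> \<partial>M))"

definition class_C :: "nat \<Rightarrow> (real \<Rightarrow> real) \<Rightarrow> bool" where
  "class_C k f \<longleftrightarrow>
     (\<forall>j<k. \<forall>x. (deriv ^^ j) f field_differentiable (at x)) \<and>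
     continuous_on UNIV ((deriv ^^ k) f)"

end

(*
  Interpolate between Y(0) = X(h) + S eta and Y(pi/2) = X(h) + F by
  Y(s) = X(h) + sin s F + cos s S eta and differentiate E[phi(Y(s))] in s.  The two terms
  E[phi'(Y(s)) F] and E[phi'(Y(s)) S eta] are rewritten by duality with the divergence and by
  Gaussian integration by parts in eta; integrating cos s, sin s cos s and cos^3 s / 2 over
  [0, pi/2] gives the constants 1, 1/2 and 1/3.

  Only S^2, and not S, is Malliavin differentiable.  For trigonometric phi' this is harmless:
  averaging cos(l Y(s)) over eta produces the smooth function exp(-l^2 cos^2 s S^2 / 2) of S^2.
  Identities tested against all characters exp(i l Y) extend to C^2 test functions by Fourier
  inversion with a Gaussian weight.  The same device, used one coordinate at a time, reduces
  Gaussian integration by parts for cylindrical functions to the characteristic function of X(g),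
  so that no joint density of (X(h_0), ..., X(h_n)) is needed.
*)
theory Submission
  imports Defs
begin

text \<open>For every frequency l the argument reaches a relation: p + i l q - l^2 r integrates to 0
  against cis(l Y). This is the weak form of E[p \<theta>(Y) + q \<theta>'(Y) + r \<theta>''(Y)] =
  0, used with \<theta> the first derivative of the test function. The factor 1/2 at its third
  derivative comes from the Gaussian average: differentiating exp(-l^2 t^2 B / 2) in B = S^2 yields
  -l^2 t^2 / 2, and -l^2 stands for two derivatives.

  Three obstacles shape the rest. Compact support of the representing functions is lost when X(h) is
  added, so the duality is extended by cutoffs to bounded variables with bounded derivatives. The
  operator D is a choice among possible derivatives, so its pairing with u must be independent of
  that choice before the adjoint relation applies to an explicit derivative. On the extension,
  independence is known for the uncompleted sigma-algebra of X, whereas S is measurable for the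
  completion; S is therefore changed on a null set.\<close>

section \<open>Smooth functions of finitely many coordinates\<close>

text \<open>All exponents \<open>k\<close> are needed: only the whole family is closed under differentiation.\<close>

definition flat_exp :: "nat \<Rightarrow> real \<Rightarrow> real" where
  "flat_exp k x = (if x > 0 then exp (- 1 / x) / x ^ k else 0)"

text \<open>Under x -> 1/x the right limit becomes y^(k+1) / exp y -> 0 at infinity. The quotient is
  the difference quotient at the junction 0, the only point where differentiability is in
  doubt.\<close>

lemma flat_exp_at_0: "((\<lambda>x. flat_exp k x / x) \<longlongrightarrow> 0) (at 0)"
proof -
  have "((\<lambda>x::real. x ^ Suc k / exp x) \<longlongrightarrow> 0) at_top"
    by (rule tendsto_power_div_exp_0)
  hence "((\<lambda>x::real. inverse x ^ Suc k / exp (inverse x)) \<longlongrightarrow> 0) (at_right 0)"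
    by (rule filterlim_compose[OF _ filterlim_inverse_at_top_right])
  moreover have "\<forall>\<^sub>F x in at_right (0::real). inverse x ^ Suc k / exp (inverse x) = flat_exp k x / x"
    by (auto simp: eventually_at_filter flat_exp_def exp_minus divide_inverse power_inverse)
  ultimately have "((\<lambda>x. flat_exp k x / x) \<longlongrightarrow> 0) (at_right 0)"
    by (rule Lim_transform_eventually)
  moreover have "((\<lambda>x. flat_exp k x / x) \<longlongrightarrow> 0) (at_left 0)"
    by (rule tendsto_eventually) (auto simp: eventually_at_filter flat_exp_def)
  ultimately show ?thesis
    by (simp add: filterlim_split_at)
qed

text \<open>The exponential contributes a factor x^(-2) and the power a factor -k x^(-1), so
  differentiation leads to a combination of two other members of the family; all members vanish at
  0, in agreement with the limit above.\<close>

lemma DERIV_flat_exp: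
  "(flat_exp k has_field_derivative (flat_exp (k + 2) x - real k * flat_exp (Suc k) x)) (at x)"
proof (cases x "0::real" rule: linorder_cases)
  case less
  have "((\<lambda>_. 0) has_field_derivative 0) (at x)" by simp
  hence "(flat_exp k has_field_derivative 0) (at x)"
    by (rule has_field_derivative_transform_within_open[where S="{..<0}"])
      (use less in \<open>auto simp: flat_exp_def\<close>)
  thus ?thesis using less by (simp add: flat_exp_def)
next
  case equal
  have "(flat_exp k has_field_derivative 0) (at 0)"
    using flat_exp_at_0[of k] by (simp add: has_field_derivative_iff flat_exp_def)
  thus ?thesis using equal by (simp add: flat_exp_def)
next
  case greater
  have "((\<lambda>x. exp (- 1 / x) / x ^ k) has_field_derivative
      (exp (- 1 / x) * (1 / x\<^sup>2) * x ^ k - exp (- 1 / x) * (real k * x ^ (k - 1))) / (x ^ k * x ^ k)) (at x)"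
  proof -
    have "((\<lambda>x. - 1 / x) has_field_derivative (1 / x\<^sup>2)) (at x)"
      using greater by (auto intro!: derivative_eq_intros simp: power2_eq_square)
    from DERIV_divide[OF DERIV_chain2[OF DERIV_exp this] DERIV_pow[of k x UNIV]]
    show ?thesis using greater by simp
  qed
  hence "(flat_exp k has_field_derivative
      (exp (- 1 / x) * (1 / x\<^sup>2) * x ^ k - exp (- 1 / x) * (real k * x ^ (k - 1))) / (x ^ k * x ^ k)) (at x)"
    by (rule has_field_derivative_transform_within_open[where S="{0<..}"])
      (use greater in \<open>auto simp: flat_exp_def\<close>)
  moreover have "(exp (- 1 / x) * (1 / x\<^sup>2) * x ^ k - exp (- 1 / x) * (real k * x ^ (k - 1))) / (x ^ k * x ^ k)
     = flat_exp (k + 2) x - real k * flat_exp (Suc k) x"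
  \<comment> \<open>The power rule produces the truncated exponent \<open>k - 1\<close>; at
    \<open>k = 0\<close>, where truncation matters, the factor \<open>real k\<close>
    vanishes.\<close>
  proof (cases k)
    case 0 thus ?thesis using greater by (simp add: flat_exp_def power2_eq_square)
  next
    case (Suc j)
    have "(exp (- 1 / x) * (1 / x\<^sup>2) * x ^ k - exp (- 1 / x) * (real k * x ^ (k - 1))) / (x ^ k * x ^ k)
      = exp (- 1 / x) * x ^ k / (x\<^sup>2 * (x ^ k * x ^ k)) - real k * (exp (- 1 / x) * x ^ j / (x ^ k * x ^ k))"
      by (simp add: diff_divide_distrib Suc)
    also have "exp (- 1 / x) * x ^ k / (x\<^sup>2 * (x ^ k * x ^ k)) = exp (- 1 / x) / x ^ (k + 2)"
      using greater by (simp add: power_add power2_eq_square)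
    also have "exp (- 1 / x) * x ^ j / (x ^ k * x ^ k) = exp (- 1 / x) / x ^ Suc k"
      using greater by (simp add: Suc)
    finally show ?thesis using greater by (simp add: flat_exp_def)
  qed
  ultimately show ?thesis by simp
qed

lemma continuous_on_flat_exp: "continuous_on UNIV (flat_exp k)"
  by (intro continuous_at_imp_continuous_on ballI DERIV_isCont[OF DERIV_flat_exp])

lemma flat_exp_nonneg: "0 \<le> flat_exp k x"
  by (simp add: flat_exp_def)

lemma flat_exp_0_le_1: "flat_exp 0 x \<le> 1"
  by (simp add: flat_exp_def)

lemma flat_exp_1_le_1: "flat_exp 1 x \<le> 1"
proof (cases "x > 0")
  case True
  have "1 / x \<le> exp (1 / x)" using exp_ge_add_one_self[of "1/x"] by linarith
  thus ?thesis using True by (simp add: flat_exp_def exp_minus field_simps)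
qed (simp add: flat_exp_def)

text \<open>Apply y <= exp y with y = 1/(2x) and square: the halved argument is restored to exp
  (1/x), and the 4 is the square of the 2.\<close>

lemma flat_exp_2_le: "flat_exp 2 x \<le> 4"
proof (cases "x > 0")
  case True
  have "(1 / (2 * x)) \<le> exp (1 / (2 * x))" using exp_ge_add_one_self[of "1/(2*x)"] by linarith
  hence "(1 / (2 * x))\<^sup>2 \<le> (exp (1 / (2 * x)))\<^sup>2" using True by (intro power_mono) auto
  also have "\<dots> = exp (1 / x)" by (simp add: power2_eq_square flip: exp_add)
  finally have "1 / (4 * x\<^sup>2) \<le> exp (1 / x)" by (simp add: power2_eq_square)
  thus ?thesis using True by (simp add: flat_exp_def exp_minus field_simps)
qed (simp add: flat_exp_def)

definition depends_below :: "nat \<Rightarrow> ((nat \<Rightarrow> real) \<Rightarrow> real) \<Rightarrow> bool" where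
  "depends_below n f \<longleftrightarrow> (\<forall>x y. (\<forall>i<n. x i = y i) \<longrightarrow> f x = f y)"

definition smooth_upto :: "nat \<Rightarrow> ((nat \<Rightarrow> real) \<Rightarrow> real) \<Rightarrow> bool" where
  "smooth_upto n f \<longleftrightarrow> (\<forall>is. set is \<subseteq> {..<n} \<longrightarrow>
        continuous_on UNIV (fold partial_deriv is f) \<and>
        (\<forall>i<n. \<forall>x. (\<lambda>t. fold partial_deriv is f (x(i := t))) field_differentiable (at (x i))))"

lemma smooth_compact_support_iff:
  "smooth_compact_support n f \<longleftrightarrow> depends_below n f \<and> smooth_upto n f \<and>
     (\<exists>R. \<forall>x. (\<exists>i<n. R < \<bar>x i\<bar>) \<longrightarrow> f x = 0)"
  unfolding smooth_compact_support_def depends_below_def smooth_upto_def ..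

lemma smooth_upto_partial_deriv: "smooth_upto n f \<Longrightarrow> i < n \<Longrightarrow> smooth_upto n (partial_deriv i f)"
  unfolding smooth_upto_def
proof (intro allI impI)
  fix js assume *: "\<forall>is. set is \<subseteq> {..<n} \<longrightarrow> continuous_on UNIV (fold partial_deriv is f) \<and>
        (\<forall>i<n. \<forall>x. (\<lambda>t. fold partial_deriv is f (x(i := t))) field_differentiable (at (x i)))"
    and "i < n" "set js \<subseteq> {..<n}"
  thus "continuous_on UNIV (fold partial_deriv js (partial_deriv i f)) \<and>
        (\<forall>k<n. \<forall>x. (\<lambda>t. fold partial_deriv js (partial_deriv i f) (x(k := t))) field_differentiable (at (x k)))"
    using *[rule_format, of "i # js"] by simp
qed

lemma smooth_upto_continuous: "smooth_upto n f \<Longrightarrow> continuous_on UNIV f"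
  unfolding smooth_upto_def by (metis empty_set empty_subsetI fold_simps(1))

lemma smooth_upto_DERIV:
  assumes "smooth_upto n f" "i < n"
  shows "((\<lambda>t. f (x(i := t))) has_field_derivative partial_deriv i f x) (at (x i))"
proof -
  have "(\<lambda>t. f (x(i := t))) field_differentiable (at (x i))"
    using assms(1)[unfolded smooth_upto_def, rule_format, of "[]"] assms(2) by simp
  thus ?thesis unfolding partial_deriv_def by (simp add: DERIV_deriv_iff_field_differentiable)
qed

lemma depends_below_partial_deriv:
  assumes "depends_below n f" shows "depends_below n (partial_deriv i f)"
  unfolding depends_below_def
proof (intro allI impI)
  fix x y :: "nat \<Rightarrow> real" assume *: "\<forall>i<n. x i = y i"
  have eq: "f (x(i := t)) = f (y(i := t))" for t
    using assms[unfolded depends_below_def, rule_format, of "x(i := t)" "y(i := t)"] * by simp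
  show "partial_deriv i f x = partial_deriv i f y"
  proof (cases "i < n")
    case True thus ?thesis using * by (simp add: partial_deriv_def eq)
  next
    case False
    have c: "f (z(i := t)) = f z" for z t
      using assms[unfolded depends_below_def, rule_format, of "z(i := t)" z] False by auto
    show ?thesis by (simp add: partial_deriv_def c)
  qed
qed

text \<open>Every member is differentiable in each coordinate with a partial derivative in the class again,
  so membership implies smoothness.\<close>

inductive smooth_gen :: "nat \<Rightarrow> ((nat \<Rightarrow> real) \<Rightarrow> real) \<Rightarrow> bool" for n where
  shift: "smooth_upto m f \<Longrightarrow> depends_below m f \<Longrightarrow> a + m \<le> n \<Longrightarrow> smooth_gen n (\<lambda>x. f (\<lambda>i. x (i + a)))"
| coord: "smooth_gen n (\<lambda>x. x i)"
| const: "smooth_gen n (\<lambda>x. c)"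
| add: "smooth_gen n f \<Longrightarrow> smooth_gen n g \<Longrightarrow> smooth_gen n (\<lambda>x. f x + g x)"
| mult: "smooth_gen n f \<Longrightarrow> smooth_gen n g \<Longrightarrow> smooth_gen n (\<lambda>x. f x * g x)"
| cos: "smooth_gen n f \<Longrightarrow> smooth_gen n (\<lambda>x. cos (f x))"
| sin: "smooth_gen n f \<Longrightarrow> smooth_gen n (\<lambda>x. sin (f x))"
| exp: "smooth_gen n f \<Longrightarrow> smooth_gen n (\<lambda>x. exp (f x))"
| flat: "smooth_gen n f \<Longrightarrow> smooth_gen n (\<lambda>x. flat_exp k (f x))"

lemma smooth_gen_continuous: "smooth_gen n f \<Longrightarrow> continuous_on UNIV f"
proof (induction rule: smooth_gen.induct)
  case (shift m f a)
  show ?case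
    by (rule continuous_on_compose2[OF smooth_upto_continuous[OF shift(1)]])
      (simp_all add: continuous_on_coordinatewise_then_product)
next
  case (flat f k)
  show ?case by (rule continuous_on_compose2[OF continuous_on_flat_exp flat.IH]) auto
next
  case (coord i)
  show ?case by (rule continuous_on_product_coordinates)
qed (simp_all add: continuous_on_add continuous_on_mult continuous_on_cos continuous_on_sin continuous_on_exp)

text \<open>Each rule brings its own derivative, and the point is that this derivative is built by
  the same rules. The existential form lets the induction hypothesis supply both the function and
  its membership, which is what iteration to all orders requires.\<close>

lemma smooth_gen_DERIV:
  "smooth_gen n f \<Longrightarrow> i < n \<Longrightarrow> \<exists>g. smooth_gen n g \<and>
     (\<forall>x. ((\<lambda>t. f (x(i := t))) has_field_derivative g x) (at (x i)))"
proof (induction rule: smooth_gen.induct)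
  case (shift m f a)
  show ?case
  proof (cases "a \<le> i \<and> i < a + m")
    case True
    have eq: "(\<lambda>j. (x(i := t)) (j + a)) = (\<lambda>j. x (j + a))(i - a := t)" for x :: "nat \<Rightarrow> real" and t
      using True by (auto simp: fun_eq_iff)
    have "((\<lambda>t. f ((\<lambda>j. x (j + a))(i - a := t))) has_field_derivative
        partial_deriv (i - a) f (\<lambda>j. x (j + a))) (at (x i))" for x
      using smooth_upto_DERIV[OF shift(1), of "i - a" "\<lambda>j. x (j + a)"] True by auto
    moreover have "smooth_gen n (\<lambda>x. partial_deriv (i - a) f (\<lambda>j. x (j + a)))"
      using shift True by (intro smooth_gen.shift[of m] smooth_upto_partial_deriv
        depends_below_partial_deriv) auto
    ultimately show ?thesis unfolding eq by blast
  next
    case False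
    have "f (\<lambda>j. (x(i := t)) (j + a)) = f (\<lambda>j. x (j + a))" for x t
      using shift(2)[unfolded depends_below_def, rule_format,
          of "\<lambda>j. (x(i := t)) (j + a)" "\<lambda>j. x (j + a)"] False by auto
    thus ?thesis by (intro exI[of _ "\<lambda>x. 0"]) (simp add: smooth_gen.const)
  qed
next
  case (coord j)
  show ?case
    by (rule exI[of _ "\<lambda>x. if i = j then 1 else 0"], cases "i = j")
      (auto intro: smooth_gen.const)
next
  case (const c)
  show ?case by (rule exI[of _ "\<lambda>x. 0"]) (auto intro: smooth_gen.const)
next
  case (add f g)
  then obtain f' g' where *: "smooth_gen n f'" "smooth_gen n g'"
    "\<And>x. ((\<lambda>t. f (x(i := t))) has_field_derivative f' x) (at (x i))"
    "\<And>x. ((\<lambda>t. g (x(i := t))) has_field_derivative g' x) (at (x i))" by metis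
  show ?case
    by (intro exI[of _ "\<lambda>x. f' x + g' x"] conjI allI smooth_gen.add DERIV_add *)
next
  case (mult f g)
  then obtain f' g' where *: "smooth_gen n f'" "smooth_gen n g'"
    "\<And>x. ((\<lambda>t. f (x(i := t))) has_field_derivative f' x) (at (x i))"
    "\<And>x. ((\<lambda>t. g (x(i := t))) has_field_derivative g' x) (at (x i))" by metis
  have "((\<lambda>t. f (x(i := t)) * g (x(i := t))) has_field_derivative f' x * g x + g' x * f x) (at (x i))" for x
    using DERIV_mult[OF *(3)[of x] *(4)[of x]] by simp
  thus ?case
    by (intro exI[of _ "\<lambda>x. f' x * g x + g' x * f x"] conjI allI smooth_gen.add smooth_gen.mult
        * mult.hyps)
next
  case (cos f)
  then obtain f' where *: "smooth_gen n f'"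
    "\<And>x. ((\<lambda>t. f (x(i := t))) has_field_derivative f' x) (at (x i))" by metis
  have "((\<lambda>t. cos (f (x(i := t)))) has_field_derivative (-1) * (sin (f x) * f' x)) (at (x i))" for x
    using DERIV_chain2[OF DERIV_cos *(2)[of x]] by simp
  thus ?case
    by (intro exI[of _ "\<lambda>x. (-1) * (sin (f x) * f' x)"] conjI allI smooth_gen.const smooth_gen.mult smooth_gen.sin * cos.hyps)
next
  case (sin f)
  then obtain f' where *: "smooth_gen n f'"
    "\<And>x. ((\<lambda>t. f (x(i := t))) has_field_derivative f' x) (at (x i))" by metis
  have "((\<lambda>t. sin (f (x(i := t)))) has_field_derivative (cos (f x) * f' x)) (at (x i))" for x
    using DERIV_chain2[OF DERIV_sin *(2)[of x]] by simp
  thus ?case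
    by (intro exI[of _ "\<lambda>x. (cos (f x) * f' x)"] conjI allI smooth_gen.mult smooth_gen.cos * sin.hyps)
next
  case (exp f)
  then obtain f' where *: "smooth_gen n f'"
    "\<And>x. ((\<lambda>t. f (x(i := t))) has_field_derivative f' x) (at (x i))" by metis
  have "((\<lambda>t. exp (f (x(i := t)))) has_field_derivative (exp (f x) * f' x)) (at (x i))" for x
    using DERIV_chain2[OF DERIV_exp *(2)[of x]] by simp
  thus ?case
    by (intro exI[of _ "\<lambda>x. (exp (f x) * f' x)"] conjI allI smooth_gen.mult smooth_gen.exp * exp.hyps)
next
  case (flat f k)
  then obtain f' where *: "smooth_gen n f'"
    "\<And>x. ((\<lambda>t. f (x(i := t))) has_field_derivative f' x) (at (x i))" by metis
  have "((\<lambda>t. flat_exp k (f (x(i := t)))) has_field_derivative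
     ((flat_exp (k + 2) (f x) + (- real k) * flat_exp (Suc k) (f x)) * f' x)) (at (x i))" for x
    using DERIV_chain2[OF DERIV_flat_exp *(2)[of x]] by simp
  thus ?case
    by (intro exI[of _ "\<lambda>x. ((flat_exp (k + 2) (f x) + (- real k) * flat_exp (Suc k) (f x)) * f' x)"]
        conjI allI smooth_gen.const smooth_gen.mult smooth_gen.add smooth_gen.flat * flat.hyps)
qed

lemma smooth_gen_fold:
  "smooth_gen n f \<Longrightarrow> set is \<subseteq> {..<n} \<Longrightarrow> smooth_gen n (fold partial_deriv is f)"
proof (induction "is" arbitrary: f)
  case (Cons i js)
  then obtain g where g: "smooth_gen n g"
    "\<And>x. ((\<lambda>t. f (x(i := t))) has_field_derivative g x) (at (x i))"
    using smooth_gen_DERIV[of n f i] by auto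
  have "partial_deriv i f = g"
    by (rule ext) (use g(2) in \<open>auto simp: partial_deriv_def intro!: DERIV_imp_deriv\<close>)
  thus ?case using Cons g by simp
qed simp

lemma smooth_gen_imp_smooth_upto:
  assumes "smooth_gen n f" shows "smooth_upto n f"
  unfolding smooth_upto_def
proof (intro allI impI conjI)
  fix js :: "nat list" assume "set js \<subseteq> {..<n}"
  from smooth_gen_fold[OF assms this] have g: "smooth_gen n (fold partial_deriv js f)" .
  show "continuous_on UNIV (fold partial_deriv js f)" by (rule smooth_gen_continuous[OF g])
  fix i x assume "i < n"
  from smooth_gen_DERIV[OF g this]
  show "(\<lambda>t. fold partial_deriv js f (x(i := t))) field_differentiable at (x i)"
    unfolding field_differentiable_def by blast
qed

section \<open>From characters to test functions\<close>

lemma integral_cis_std_normal: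
  "(\<integral>l. cis (t * l) \<partial>std_normal_distribution) = complex_of_real (exp (- t\<^sup>2 / 2))"
  using fun_cong[OF char_std_normal_distribution, of t] by (simp add: char_def cis_conv_exp)

text \<open>The weight exp (-(d Z)^2 / 2) is the average of the characters cis (d l Z) over a
  standard normal l, so by Fubini it inherits the vanishing. The measure is only sigma-finite
  because Lebesgue measure in an auxiliary variable is one of its factors later.\<close>

lemma integral_gaussian_weight_eq_0:
  fixes T :: "'a \<Rightarrow> complex" and Z :: "'a \<Rightarrow> real"
  assumes L: "sigma_finite_measure L" and T[measurable]: "integrable L T"
    and Z[measurable]: "Z \<in> borel_measurable L"
    and zero: "\<And>l. (\<integral>p. T p * cis (l * Z p) \<partial>L) = 0"
  shows "(\<integral>p. T p * complex_of_real (exp (- (d * Z p)\<^sup>2 / 2)) \<partial>L) = 0"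
proof -
  let ?G = std_normal_distribution
  interpret G: prob_space ?G by (rule prob_space_normal_density) simp
  interpret L: sigma_finite_measure L by fact
  interpret pair_sigma_finite ?G L ..
  have meas: "(\<lambda>(l, p). T p * cis (d * l * Z p)) \<in> borel_measurable (?G \<Otimes>\<^sub>M L)"
    unfolding cis_conv_exp by measurable
  have int: "integrable (?G \<Otimes>\<^sub>M L) (\<lambda>(l, p). T p * cis (d * l * Z p))"
  proof (rule Fubini_integrable[OF meas])
    show "integrable ?G (\<lambda>x. \<integral>y. norm (case (x, y) of (l, p) \<Rightarrow> T p * cis (d * l * Z p)) \<partial>L)"
      by (simp add: norm_mult)
    have "integrable L (\<lambda>p. T p * cis (d * x * Z p))" for x
      by (rule Bochner_Integration.integrable_bound[OF T]) (auto simp: norm_mult cis_conv_exp)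
    thus "AE x in ?G. integrable L (\<lambda>y. case (x, y) of (l, p) \<Rightarrow> T p * cis (d * l * Z p))"
      by simp
  qed
  have "(\<integral>p. T p * complex_of_real (exp (- (d * Z p)\<^sup>2 / 2)) \<partial>L)
      = (\<integral>p. (\<integral>l. T p * cis (d * l * Z p) \<partial>?G) \<partial>L)"
  proof (intro Bochner_Integration.integral_cong refl)
    fix p
    show "T p * complex_of_real (exp (- (d * Z p)\<^sup>2 / 2)) = (\<integral>l. T p * cis (d * l * Z p) \<partial>?G)"
      using integral_cis_std_normal[of "d * Z p"] by (simp add: mult_ac)
  qed
  also have "\<dots> = (\<integral>l. (\<integral>p. T p * cis (d * l * Z p) \<partial>L) \<partial>?G)"
    by (rule Fubini_integral[OF int])
  also have "\<dots> = 0" using zero[of "d * _"] by simp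
  finally show ?thesis .
qed

lemma (in pair_sigma_finite) integrable_product_mult:
  fixes f g :: "_ \<Rightarrow> real"
  assumes f: "integrable M1 f" and g: "integrable M2 g"
  shows "integrable (M1 \<Otimes>\<^sub>M M2) (\<lambda>w. f (fst w) * g (snd w))"
proof -
  note [measurable] = borel_measurable_integrable[OF f] borel_measurable_integrable[OF g]
  have "integrable (M1 \<Otimes>\<^sub>M M2) (\<lambda>(x, y). f x * g y)"
  proof (rule Fubini_integrable)
    show "(\<lambda>(x, y). f x * g y) \<in> borel_measurable (M1 \<Otimes>\<^sub>M M2)" by measurable
    show "integrable M1 (\<lambda>x. \<integral>y. norm (case (x, y) of (x, y) \<Rightarrow> f x * g y) \<partial>M2)"
      using f by (simp add: abs_mult)
    show "AE x in M1. integrable M2 (\<lambda>y. case (x, y) of (x, y) \<Rightarrow> f x * g y)" using g by simp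
  qed
  thus ?thesis by (simp add: case_prod_beta')
qed

text \<open>Fourier inversion regularised by Gaussians. The weights exp (-(d (Y w - z))^2 / 2) are
  averages of characters, and after rescaling they form an approximate identity in z as d grows,
  which evaluates \<open>T z w\<close> at \<open>z = Y w\<close>. Compact support in z makes the
  integrals over the line finite.\<close>

lemma integral_at_eq_0_of_fourier:
  fixes T :: "real \<Rightarrow> 'a \<Rightarrow> complex" and Y D :: "'a \<Rightarrow> real"
  assumes M: "prob_space M" and Y[measurable]: "Y \<in> borel_measurable M"
    and D: "integrable M D"
    and T[measurable]: "(\<lambda>(z, w). T z w) \<in> borel_measurable (borel \<Otimes>\<^sub>M M)"
    and bound: "\<And>z w. norm (T z w) \<le> D w"
    and supp: "\<And>z w. K < \<bar>z\<bar> \<Longrightarrow> T z w = 0"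
    and cont: "\<And>w. continuous_on UNIV (\<lambda>z. T z w)"
    and zero: "\<And>l. (\<integral>w. (\<integral>z. T z w * cis (l * (Y w - z)) \<partial>lborel) \<partial>M) = 0"
  shows "(\<integral>w. T (Y w) w \<partial>M) = 0"
proof -
  interpret prob_space M by fact
  interpret pair_sigma_finite lborel M ..
  let ?L = "lborel \<Otimes>\<^sub>M M"
  have D0: "0 \<le> D w" for w using bound[of 0 w] norm_ge_zero order_trans by blast
  \<comment> \<open>A bounded extra factor is allowed so that the same estimate serves the
    characters and the Gaussian weights.\<close>
  have intT: "integrable ?L (\<lambda>(z, w). T z w * f z w)"
    if f[measurable]: "(\<lambda>(z, w). f z w) \<in> borel_measurable (lborel \<Otimes>\<^sub>M M)"
      and nf: "\<And>z w. norm (f z w) \<le> 1" for f :: "real \<Rightarrow> 'a \<Rightarrow> complex"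
  proof (rule Bochner_Integration.integrable_bound)
    have "integrable ?L (\<lambda>(z, w). indicator {-K..K} z * D w)"
      using integrable_product_mult[OF integrable_real_indicator D, of "{-K..K}"] emeasure_lborel_Icc_eq[of "-K" K]
      by (simp add: case_prod_beta')
    thus "integrable ?L (\<lambda>(z, w). indicator {-K..K} z * D w)" .
    show "(\<lambda>(z, w). T z w * f z w) \<in> borel_measurable ?L" by measurable
    have "norm (T z w * f z w) \<le> indicator {-K..K} z * D w" for z w
    proof (cases "\<bar>z\<bar> \<le> K")
      case True
      have "norm (T z w) * norm (f z w) \<le> D w * 1"
        by (intro mult_mono bound nf D0) auto
      thus ?thesis using True by (auto simp: norm_mult abs_le_iff indicator_def)
    qed (use supp[of z w] D0[of w] in \<open>auto simp: indicator_def\<close>)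
    thus "AE x in ?L. norm (case x of (z, w) \<Rightarrow> T z w * f z w) \<le> norm (case x of (z, w) \<Rightarrow> indicator {-K..K} z * D w)"
      by (auto simp: abs_mult D0)
  qed
  have wt: "(\<integral>w. (\<integral>z. T z w * complex_of_real (exp (- (d * (Y w - z))\<^sup>2 / 2)) \<partial>lborel) \<partial>M) = 0" for d :: real
  proof -
    have "(\<integral>p. (\<lambda>(z, w). T z w) p * complex_of_real (exp (- (d * (Y (snd p) - fst p))\<^sup>2 / 2)) \<partial>?L) = 0"
    proof (rule integral_gaussian_weight_eq_0)
      show "integrable ?L (\<lambda>(z, w). T z w)" using intT[of "\<lambda>_ _. 1"] by simp
      fix l :: real
      have meas: "(\<lambda>(z, w). cis (l * (Y w - z))) \<in> borel_measurable ?L"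
        unfolding cis_conv_exp by measurable
      have "(\<integral>p. (\<lambda>(z, w). T z w) p * cis (l * (Y (snd p) - fst p)) \<partial>?L)
          = (\<integral>p. (\<lambda>(z, w). T z w * cis (l * (Y w - z))) p \<partial>?L)"
        by (rule Bochner_Integration.integral_cong) auto
      also have "\<dots> = (\<integral>w. (\<integral>z. T z w * cis (l * (Y w - z)) \<partial>lborel) \<partial>M)"
        using integral_snd[OF intT[OF meas]] by simp
      finally show "(\<integral>p. (\<lambda>(z, w). T z w) p * cis (l * (Y (snd p) - fst p)) \<partial>?L) = 0"
        by (simp add: zero)
    qed (auto intro: sigma_finite_measure_axioms)
    moreover have "(\<integral>p. (\<lambda>(z, w). T z w) p * complex_of_real (exp (- (d * (Y (snd p) - fst p))\<^sup>2 / 2)) \<partial>?L)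
          = (\<integral>p. (\<lambda>(z, w). T z w * complex_of_real (exp (- (d * (Y w - z))\<^sup>2 / 2))) p \<partial>?L)"
      by (rule Bochner_Integration.integral_cong) auto
    moreover have "\<dots> = (\<integral>w. (\<integral>z. T z w * complex_of_real (exp (- (d * (Y w - z))\<^sup>2 / 2)) \<partial>lborel) \<partial>M)"
      by (subst integral_snd[OF intT, symmetric]) auto
    ultimately show ?thesis by simp
  qed
  \<comment> \<open>Total mass of the unnormalised weight exp (-x^2 / 2).\<close>
  define c where "c = sqrt (2 * pi)"
  have c: "c > 0" by (simp add: c_def)
  have T1[measurable]: "(\<lambda>z. T z w) \<in> borel_measurable borel" for w
    by (rule borel_measurable_continuous_onI[OF cont])
  \<comment> \<open>The substitution z = Y w + x / (n+1) fixes the weight and moves the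
    concentration into the argument of \<open>T\<close>. Its Jacobian is a nonzero constant, hence
    irrelevant for the vanishing.\<close>
  define I where "I = (\<lambda>n w. \<integral>x. T (Y w + x / real (Suc n)) w * complex_of_real (c * std_normal_density x) \<partial>lborel)"
  have I0: "(\<integral>w. I n w \<partial>M) = 0" for n
  proof -
    have "(\<integral>z. T z w * complex_of_real (exp (- (real (Suc n) * (Y w - z))\<^sup>2 / 2)) \<partial>lborel)
       = \<bar>1 / real (Suc n)\<bar> *\<^sub>R I n w" for w
      unfolding I_def
      by (subst lborel_integral_real_affine[where t="Y w" and c="1 / real (Suc n)"])
        (auto intro!: Bochner_Integration.integral_cong simp: std_normal_density_def c_def)
    with wt[of "real (Suc n)"] show ?thesis by simp
  qed
  have sd: "integrable lborel (\<lambda>x. complex_of_real (c * std_normal_density x))"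
    by (intro integrable_of_real) simp
  have isd: "(\<integral>x. complex_of_real (c * std_normal_density x) \<partial>lborel) = complex_of_real c"
    using c by simp
  have lim: "(\<lambda>n. I n w) \<longlonglongrightarrow> T (Y w) w * complex_of_real c" for w
  proof -
    have "(\<lambda>n. I n w) \<longlonglongrightarrow> (\<integral>x. T (Y w) w * complex_of_real (c * std_normal_density x) \<partial>lborel)"
      unfolding I_def
    proof (rule integral_dominated_convergence[where w="\<lambda>x. D w * (c * std_normal_density x)"])
      show "AE x in lborel. (\<lambda>n. T (Y w + x / real (Suc n)) w * complex_of_real (c * std_normal_density x))
          \<longlonglongrightarrow> T (Y w) w * complex_of_real (c * std_normal_density x)"
      proof (intro AE_I2 tendsto_mult tendsto_const)
        fix x
        have "(\<lambda>n. Y w + x / real (Suc n)) \<longlonglongrightarrow> Y w + 0"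
          by (intro tendsto_add tendsto_const LIMSEQ_Suc lim_const_over_n)
        hence "(\<lambda>n. Y w + x / real (Suc n)) \<longlonglongrightarrow> Y w" by simp
        thus "(\<lambda>n. T (Y w + x / real (Suc n)) w) \<longlonglongrightarrow> T (Y w) w"
          by (rule continuous_on_tendsto_compose[OF cont]) auto
      qed
      show "AE x in lborel. norm (T (Y w + x / real (Suc n)) w * complex_of_real (c * std_normal_density x))
          \<le> D w * (c * std_normal_density x)" for n
        using c by (auto simp: norm_mult abs_mult intro!: mult_right_mono bound)
    qed (use sd c in auto)
    thus ?thesis using isd by simp
  qed
  have Imeas[measurable]: "I n \<in> borel_measurable M" for n
    unfolding I_def by measurable
  have normI: "norm (I n w) \<le> D w * c" for n w
  proof -
    have "norm (I n w) \<le> (\<integral>x. D w * (c * std_normal_density x) \<partial>lborel)"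
      unfolding I_def
    proof (rule Bochner_Integration.integral_norm_bound_integral)
      show g: "integrable lborel (\<lambda>x. D w * (c * std_normal_density x))" by simp
      show le: "norm (T (Y w + x / real (Suc n)) w * complex_of_real (c * std_normal_density x))
          \<le> D w * (c * std_normal_density x)" for x
        using mult_right_mono[OF bound, of "c * std_normal_density x"] c by (simp add: norm_mult abs_mult)
      show "integrable lborel (\<lambda>x. T (Y w + x / real (Suc n)) w * complex_of_real (c * std_normal_density x))"
        by (rule Bochner_Integration.integrable_bound[OF g])
          (measurable, rule AE_I2, rule order_trans[OF le], simp)
    qed
    also have "\<dots> = D w * c" by simp
    finally show ?thesis .
  qed
  have "(\<lambda>n. \<integral>w. I n w \<partial>M) \<longlonglongrightarrow> (\<integral>w. T (Y w) w * complex_of_real c \<partial>M)"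
  proof (rule integral_dominated_convergence[where w="\<lambda>w. D w * c"])
    show "(\<lambda>w. T (Y w) w * complex_of_real c) \<in> borel_measurable M" by measurable
    show "I n \<in> borel_measurable M" for n by (rule Imeas)
    show "integrable M (\<lambda>w. D w * c)" using D by simp
    show "AE x in M. (\<lambda>n. I n x) \<longlonglongrightarrow> T (Y x) x * complex_of_real c" using lim by simp
    show "AE x in M. norm (I n x) \<le> D x * c" for n using normI by simp
  qed
  hence "(\<integral>w. T (Y w) w * complex_of_real c \<partial>M) = 0"
    unfolding I0 by (rule LIMSEQ_unique[OF _ tendsto_const])
  thus ?thesis using c by simp
qed

text \<open>The hypothesis is a relation between Fourier transforms in the frequency \<open>l\<close>. Multiplied by
  \<open>cis (- l * z)\<close> and integrated over \<open>z\<close>, each factor \<open>\<i> l\<close> becomes a derivative in \<open>z\<close>.\<close>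

theorem fourier_transfer:
  fixes P Q Q' R R' R'' :: "real \<Rightarrow> 'a \<Rightarrow> complex" and Y D :: "'a \<Rightarrow> real"
  assumes M: "prob_space M" and Y[measurable]: "Y \<in> borel_measurable M"
    and D: "integrable M D"
    and meas[measurable]: "(\<lambda>(z, w). P z w) \<in> borel_measurable (borel \<Otimes>\<^sub>M M)"
      "(\<lambda>(z, w). Q z w) \<in> borel_measurable (borel \<Otimes>\<^sub>M M)"
      "(\<lambda>(z, w). R z w) \<in> borel_measurable (borel \<Otimes>\<^sub>M M)"
      "(\<lambda>(z, w). Q' z w) \<in> borel_measurable (borel \<Otimes>\<^sub>M M)"
      "(\<lambda>(z, w). R'' z w) \<in> borel_measurable (borel \<Otimes>\<^sub>M M)"
    and bound: "\<And>z w. norm (P z w) \<le> D w" "\<And>z w. norm (Q z w) \<le> D w" "\<And>z w. norm (R z w) \<le> D w"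
      "\<And>z w. norm (Q' z w) \<le> D w" "\<And>z w. norm (R'' z w) \<le> D w"
    and supp: "\<And>z w. K \<le> \<bar>z\<bar> \<Longrightarrow> P z w = 0 \<and> Q z w = 0 \<and> R z w = 0 \<and> Q' z w = 0 \<and> R' z w = 0 \<and> R'' z w = 0"
    and deriv: "\<And>z w. ((\<lambda>z. Q z w) has_vector_derivative Q' z w) (at z)"
      "\<And>z w. ((\<lambda>z. R z w) has_vector_derivative R' z w) (at z)"
      "\<And>z w. ((\<lambda>z. R' z w) has_vector_derivative R'' z w) (at z)"
    and cont: "\<And>w. continuous_on UNIV (\<lambda>z. P z w)" "\<And>w. continuous_on UNIV (\<lambda>z. Q' z w)"
      "\<And>w. continuous_on UNIV (\<lambda>z. R'' z w)"
    and zero: "\<And>z l. (\<integral>w. (P z w + \<i> * l * Q z w - (complex_of_real l)\<^sup>2 * R z w) * cis (l * Y w) \<partial>M) = 0"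
  shows "(\<integral>w. P (Y w) w + Q' (Y w) w + R'' (Y w) w \<partial>M) = 0"
proof (rule integral_at_eq_0_of_fourier[where D="\<lambda>w. 3 * D w" and K=K, OF M Y])
  interpret prob_space M by fact
  interpret pair_sigma_finite lborel M ..
  let ?L = "lborel \<Otimes>\<^sub>M M"
  show "integrable M (\<lambda>w. 3 * D w)" using D by simp
  show "(\<lambda>(z, w). P z w + Q' z w + R'' z w) \<in> borel_measurable (borel \<Otimes>\<^sub>M M)" by measurable
  show "norm (P z w + Q' z w + R'' z w) \<le> 3 * D w" for z w
    using norm_triangle_ineq[of "P z w + Q' z w" "R'' z w"] norm_triangle_ineq[of "P z w" "Q' z w"]
      bound(1,4,5)[of z w] by linarith
  show "P z w + Q' z w + R'' z w = 0" if "K < \<bar>z\<bar>" for z w using supp[of z w] that by simp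
  show "continuous_on UNIV (\<lambda>z. P z w + Q' z w + R'' z w)" for w
    by (intro continuous_intros cont)
  have D0: "0 \<le> D w" for w using bound(1)[of 0 w] norm_ge_zero order_trans by blast
  fix l :: real
  \<comment> \<open>The integrand of \<open>zero\<close> times \<open>cis (- l * z)\<close>: its
    integral over w vanishes for each fixed z, while its integral over z can be rearranged by
    parts.\<close>
  define H where "H = (\<lambda>z w. (P z w + \<i> * l * Q z w - (complex_of_real l)\<^sup>2 * R z w) * cis (l * (Y w - z)))"
  have contQR: "continuous_on UNIV (\<lambda>z. Q z w)" "continuous_on UNIV (\<lambda>z. R z w)" for w
    using deriv(1,2) by (meson continuous_at_imp_continuous_on has_vector_derivative_continuous)+
  have contH: "continuous_on A (\<lambda>z. H z w)" for w A
    unfolding H_def cis_conv_exp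
    by (intro continuous_intros continuous_on_subset[OF cont(1)] continuous_on_subset[OF contQR(1)]
        continuous_on_subset[OF contQR(2)]) auto
  define B where "B = (\<lambda>w. (1 + \<bar>l\<bar> + l\<^sup>2) * D w)"
  have normH: "norm (H z w) \<le> indicator {-K..K} z * B w" for z w
  proof (cases "\<bar>z\<bar> \<le> K")
    case True
    have "norm (H z w) \<le> norm (P z w) + norm (\<i> * l * Q z w) + norm ((complex_of_real l)\<^sup>2 * R z w)"
      unfolding H_def norm_mult norm_cis mult_1_right
      using norm_triangle_ineq4[of "P z w + \<i> * l * Q z w" "(complex_of_real l)\<^sup>2 * R z w"]
        norm_triangle_ineq[of "P z w" "\<i> * l * Q z w"] by (simp add: norm_mult)
    also have "\<dots> \<le> D w + \<bar>l\<bar> * D w + l\<^sup>2 * D w"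
      using bound[of z w] by (intro add_mono) (auto simp: norm_mult norm_power intro!: mult_left_mono)
    also have "\<dots> = B w" by (simp add: B_def algebra_simps)
    finally show ?thesis using True by (auto simp: abs_le_iff indicator_def)
  qed (use supp[of z w] D0[of w] in \<open>auto simp: H_def B_def indicator_def\<close>)
  have Hmeas[measurable]: "(\<lambda>(z, w). H z w) \<in> borel_measurable ?L"
    unfolding H_def cis_conv_exp by measurable
  have B: "integrable M B" using D by (simp add: B_def)
  have B0: "0 \<le> B w" for w using D0[of w] by (simp add: B_def)
  have intH: "integrable ?L (\<lambda>(z, w). H z w)"
  proof (rule Bochner_Integration.integrable_bound)
    show "integrable ?L (\<lambda>(z, w). indicator {-K..K} z * B w)"
      using integrable_product_mult[OF integrable_real_indicator B, of "{-K..K}"] emeasure_lborel_Icc_eq[of "-K" K]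
      by (simp add: case_prod_beta')
    show "AE x in ?L. norm (case x of (z, w) \<Rightarrow> H z w) \<le> norm (case x of (z, w) \<Rightarrow> indicator {-K..K} z * B w)"
      using normH by (auto simp: abs_mult B0)
  qed measurable
  have inner: "(\<integral>z. (P z w + Q' z w + R'' z w) * cis (l * (Y w - z)) \<partial>lborel) = (\<integral>z. H z w \<partial>lborel)" for w
  proof -
    let ?g = "\<lambda>z. cis (l * (Y w - z))"
    \<comment> \<open>\<open>?F\<close> collects the boundary terms of one integration by parts for
      \<open>Q\<close> and two for \<open>R\<close>, and \<open>?f\<close> is the difference of the
      two integrands. The interval of integration is taken with \<bar>K\<bar> since \<open>K\<close>
      may be negative; at its endpoints \<open>supp\<close> makes \<open>?F\<close> vanish.\<close>
    let ?F = "\<lambda>z. (Q z w + R' z w + \<i> * l * R z w) * ?g z"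
    let ?f = "\<lambda>z. (P z w + Q' z w + R'' z w) * ?g z - H z w"
    have dg: "(?g has_vector_derivative (- \<i> * l * ?g z)) (at z)" for z
    proof -
      have "((\<lambda>z. l * (Y w - z)) has_real_derivative - l) (at z)"
        by (auto intro!: derivative_eq_intros)
      hence "((\<lambda>z. \<i> * complex_of_real (l * (Y w - z))) has_vector_derivative \<i> * complex_of_real (- l)) (at z)"
        by (intro has_vector_derivative_mult_right has_vector_derivative_of_real)
      from field_vector_diff_chain_at[OF this DERIV_exp]
      show ?thesis by (simp add: o_def cis_conv_exp)
    qed
    have dF: "(?F has_vector_derivative ?f z) (at z)" for z
    proof -
      have "((\<lambda>z. Q z w + R' z w + \<i> * l * R z w) has_vector_derivative (Q' z w + R'' z w + \<i> * l * R' z w)) (at z)"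
        by (intro has_vector_derivative_add has_vector_derivative_mult_right deriv)
      from has_vector_derivative_mult[OF this dg[of z]] show ?thesis
        by (simp add: H_def algebra_simps power2_eq_square)
    qed
    have contT: "continuous_on A (\<lambda>z. (P z w + Q' z w + R'' z w) * ?g z)" for A
      unfolding cis_conv_exp by (intro continuous_intros continuous_on_subset[OF cont(1)]
        continuous_on_subset[OF cont(2)] continuous_on_subset[OF cont(3)]) auto
    have contf: "continuous_on A ?f" for A
      by (intro continuous_intros contT contH)
    have "(\<integral>z. indicator {-\<bar>K\<bar>..\<bar>K\<bar>} z *\<^sub>R ?f z \<partial>lborel) = ?F \<bar>K\<bar> - ?F (-\<bar>K\<bar>)"
      by (rule integral_FTC_Icc)
        (auto intro!: has_vector_derivative_at_within[OF dF] contf)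
    hence e: "(\<integral>z. indicator {-\<bar>K\<bar>..\<bar>K\<bar>} z *\<^sub>R ?f z \<partial>lborel) = 0"
      using supp[of "\<bar>K\<bar>" w] supp[of "-\<bar>K\<bar>" w] by simp
    have ind: "indicator {-\<bar>K\<bar>..\<bar>K\<bar>} z *\<^sub>R ((P z w + Q' z w + R'' z w) * ?g z) = (P z w + Q' z w + R'' z w) * ?g z"
       "indicator {-\<bar>K\<bar>..\<bar>K\<bar>} z *\<^sub>R H z w = H z w" for z
      using supp[of z w] by (auto simp: indicator_def H_def abs_le_iff)
    have i1: "integrable lborel (\<lambda>z. (P z w + Q' z w + R'' z w) * ?g z)"
      using borel_integrable_compact[OF compact_Icc contT, of "-\<bar>K\<bar>" "\<bar>K\<bar>"] unfolding ind by simp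
    have i2: "integrable lborel (\<lambda>z. H z w)"
      using borel_integrable_compact[OF compact_Icc contH[of "{-\<bar>K\<bar>..\<bar>K\<bar>}" w]] unfolding ind by simp
    show ?thesis
      using e unfolding scaleR_diff_right ind using i1 i2 by simp
  qed
  have "(\<integral>w. (\<integral>z. H z w \<partial>lborel) \<partial>M) = (\<integral>z. (\<integral>w. H z w \<partial>M) \<partial>lborel)"
    by (rule Fubini_integral[OF intH])
  also have "\<dots> = 0"
  proof -
    have "(\<integral>w. H z w \<partial>M) = cis (- l * z) * (\<integral>w. (P z w + \<i> * l * Q z w - (complex_of_real l)\<^sup>2 * R z w) * cis (l * Y w) \<partial>M)" for z
    proof -
      have c: "cis (l * (Y w - z)) = cis (- l * z) * cis (l * Y w)" for w
        by (simp add: cis_mult algebra_simps)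
      show ?thesis unfolding H_def c
        by (subst integral_mult_right_zero[symmetric], rule Bochner_Integration.integral_cong)
          (simp_all only: mult_ac)
    qed
    thus ?thesis by (simp add: zero)
  qed
  finally show "(\<integral>w. (\<integral>z. (P z w + Q' z w + R'' z w) * cis (l * (Y w - z)) \<partial>lborel) \<partial>M) = 0"
    unfolding inner .
qed

section \<open>Gaussian integration by parts\<close>

text \<open>Setting all coordinates from \<open>m\<close> on to 0 does not change the value, and the
  points left to consider lie in a product of compact sets, compact by Tychonoff's theorem.\<close>

lemma C1_bounded:
  assumes dep: "depends_below m f" and cont: "continuous_on UNIV f"
    and supp: "\<And>x. \<exists>i<m. R < \<bar>x i\<bar> \<Longrightarrow> f x = 0"
  shows "\<exists>B\<ge>0. \<forall>x. \<bar>f x\<bar> \<le> B"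
proof -
  define S where "S = (\<Pi>\<^sub>E i\<in>(UNIV::nat set). if i < m then {-R..R} else {0::real})"
  have "compactin (product_topology (\<lambda>i. euclidean) UNIV) S"
    unfolding S_def by (subst compactin_PiE) auto
  hence "compact S" by (simp add: euclidean_product_topology)
  hence "compact (f ` S)" by (intro compact_continuous_image continuous_on_subset[OF cont]) auto
  hence "bounded (f ` S)" by (rule compact_imp_bounded)
  then obtain B where B: "\<And>x. x \<in> S \<Longrightarrow> \<bar>f x\<bar> \<le> B" unfolding bounded_iff by auto
  have "\<bar>f x\<bar> \<le> max B 0" for x
  proof (cases "\<exists>i<m. R < \<bar>x i\<bar>")
    case True thus ?thesis using supp by simp
  next
    case False
    define y where "y = (\<lambda>i. if i < m then x i else 0)"
    have "f x = f y" using dep[unfolded depends_below_def, rule_format, of x y] by (simp add: y_def)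
    moreover have "- R \<le> x i" "x i \<le> R" if "i < m" for i
      using False that by (meson abs_le_iff not_less minus_le_iff)+
    hence "y \<in> S" by (auto simp: S_def y_def PiE_iff)
    ultimately show ?thesis using B[of y] by simp
  qed
  thus ?thesis by (intro exI[of _ "max B 0"]) auto
qed

text \<open>Only first derivatives are recorded: this is all that integration by parts uses, and it
  is preserved when the last coordinate is frozen, as the induction on the number of coordinates
  demands.\<close>

definition C1_compact_support :: "nat \<Rightarrow> ((nat \<Rightarrow> real) \<Rightarrow> real) \<Rightarrow> bool" where
  "C1_compact_support m f \<longleftrightarrow> depends_below m f \<and> continuous_on UNIV f \<and>
     (\<forall>i<m. continuous_on UNIV (partial_deriv i f) \<and>
        (\<forall>x. ((\<lambda>t. f (x(i := t))) has_field_derivative partial_deriv i f x) (at (x i)))) \<and>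
     (\<exists>R. \<forall>x. (\<exists>i<m. R < \<bar>x i\<bar>) \<longrightarrow> f x = 0)"

lemma smooth_compact_support_imp_C1:
  "smooth_compact_support m f \<Longrightarrow> C1_compact_support m f"
  unfolding smooth_compact_support_iff C1_compact_support_def
  using smooth_upto_continuous smooth_upto_partial_deriv smooth_upto_DERIV by blast

text \<open>The strict inequality is an open condition, so \<open>f\<close> vanishes near the point
  along every coordinate line: along direction \<open>i\<close> by openness, along the others
  because coordinate \<open>i\<close> stays large.\<close>

lemma partial_deriv_supp:
  assumes supp: "\<And>x. \<exists>i<m. R < \<bar>x i\<bar> \<Longrightarrow> f x = 0" and x: "\<exists>i<m. R < \<bar>x i\<bar>"
  shows "partial_deriv j f x = 0"
proof -
  obtain i where i: "i < m" "R < \<bar>x i\<bar>" using x by auto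
  have "((\<lambda>t. f (x(j := t))) has_field_derivative 0) (at (x j))"
  proof (cases "i = j")
    case True
    show ?thesis
    proof (rule has_field_derivative_transform_within_open[OF DERIV_const[of 0]])
      show "open {t. R < \<bar>t\<bar>}" by (intro open_Collect_less continuous_intros)
      show "x j \<in> {t. R < \<bar>t\<bar>}" using i True by simp
      show "0 = f (x(j := t))" if "t \<in> {t. R < \<bar>t\<bar>}" for t
        using that i True by (intro supp[symmetric] exI[of _ i]) auto
    qed
  next
    case False
    hence "f (x(j := t)) = 0" for t using i by (intro supp exI[of _ i]) auto
    thus ?thesis by simp
  qed
  thus ?thesis unfolding partial_deriv_def by (rule DERIV_imp_deriv)
qed

lemma C1_compact_support_bounds:
  assumes "C1_compact_support m f"
  obtains B where "B \<ge> 0" "\<And>x. \<bar>f x\<bar> \<le> B" "\<And>i x. i < m \<Longrightarrow> \<bar>partial_deriv i f x\<bar> \<le> B"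
proof -
  obtain R where R: "\<And>x. \<exists>i<m. R < \<bar>x i\<bar> \<Longrightarrow> f x = 0"
    using assms unfolding C1_compact_support_def by blast
  have "\<exists>B\<ge>0. \<forall>x. \<bar>f x\<bar> \<le> B"
    using assms R unfolding C1_compact_support_def by (intro C1_bounded[where R=R and m=m]) auto
  then obtain B where B: "B \<ge> 0" "\<And>x. \<bar>f x\<bar> \<le> B" by auto
  have "\<forall>i<m. \<exists>B\<ge>0. \<forall>x. \<bar>partial_deriv i f x\<bar> \<le> B"
    using assms partial_deriv_supp[where R=R and m=m and f=f, OF R]
    unfolding C1_compact_support_def
    by (intro allI impI C1_bounded[where R=R and m=m]) (auto intro: depends_below_partial_deriv)
  then obtain b where b: "\<And>i. i < m \<Longrightarrow> b i \<ge> 0" "\<And>i x. i < m \<Longrightarrow> \<bar>partial_deriv i f x\<bar> \<le> b i"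
    by metis
  show thesis
  proof (rule that[of "B + (\<Sum>i<m. b i)"])
    have s: "0 \<le> (\<Sum>i<m. b i)" using b(1) by (intro sum_nonneg) auto
    show "0 \<le> B + (\<Sum>i<m. b i)" using s B by simp
    show "\<bar>f x\<bar> \<le> B + (\<Sum>i<m. b i)" for x using B(2)[of x] s by simp
    show "\<bar>partial_deriv i f x\<bar> \<le> B + (\<Sum>i<m. b i)" if "i < m" for i x
    proof -
      have "b i \<le> (\<Sum>i<m. b i)" using that b(1) by (intro member_le_sum) auto
      thus ?thesis using b(2)[OF that, of x] B(1) by simp
    qed
  qed
qed

text \<open>Freezing coordinate \<open>m\<close> at a parameter z produces the function to which the
  induction hypothesis of \<open>gaussian_ibp_cis\<close> is applied; z later becomes the variable
  of the Fourier argument.\<close>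

lemma C1_compact_support_fun_upd:
  assumes f: "C1_compact_support (Suc m) f"
  shows "C1_compact_support m (\<lambda>x. f (x(m := z)))"
    and "i < m \<Longrightarrow> partial_deriv i (\<lambda>x. f (x(m := z))) x = partial_deriv i f (x(m := z))"
proof -
  have upd: "continuous_on UNIV (\<lambda>x::nat \<Rightarrow> real. x(m := z))"
  proof (rule continuous_on_coordinatewise_then_product)
    show "continuous_on UNIV (\<lambda>x::nat \<Rightarrow> real. (x(m := z)) i)" for i
      by (cases "i = m") (simp_all add: continuous_on_product_coordinates)
  qed
  have pd: "partial_deriv i (\<lambda>x. f (x(m := z))) x = partial_deriv i f (x(m := z))" if "i < m" for i x
    using that by (simp add: partial_deriv_def fun_upd_twist)
  show "partial_deriv i (\<lambda>x. f (x(m := z))) x = partial_deriv i f (x(m := z))" if "i < m"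
    using pd that .
  obtain R where R: "\<And>x. \<exists>i<Suc m. R < \<bar>x i\<bar> \<Longrightarrow> f x = 0"
    using f unfolding C1_compact_support_def by blast
  show "C1_compact_support m (\<lambda>x. f (x(m := z)))"
    unfolding C1_compact_support_def
  proof (intro conjI allI impI)
    show "depends_below m (\<lambda>x. f (x(m := z)))"
      using f unfolding C1_compact_support_def depends_below_def by (simp add: less_Suc_eq)
    show "continuous_on UNIV (\<lambda>x. f (x(m := z)))"
      using f unfolding C1_compact_support_def
      by (intro continuous_on_compose2[OF _ upd]) auto
    fix i assume i: "i < m"
    have "continuous_on UNIV (\<lambda>x. partial_deriv i f (x(m := z)))"
      using f i unfolding C1_compact_support_def
      by (intro continuous_on_compose2[OF _ upd]) auto
    thus "continuous_on UNIV (partial_deriv i (\<lambda>x. f (x(m := z))))"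
      using pd[OF i] by (simp cong: continuous_on_cong)
    fix x :: "nat \<Rightarrow> real"
    have "((\<lambda>t. f ((x(m := z))(i := t))) has_field_derivative partial_deriv i f (x(m := z))) (at ((x(m := z)) i))"
      using f i unfolding C1_compact_support_def by (meson less_SucI)
    thus "((\<lambda>t. f ((x(i := t))(m := z))) has_field_derivative
        partial_deriv i (\<lambda>x. f (x(m := z))) x) (at (x i))"
      using i by (simp add: pd fun_upd_twist)
  next
    show "\<exists>R. \<forall>x. (\<exists>i<m. R < \<bar>x i\<bar>) \<longrightarrow> f (x(m := z)) = 0"
    proof (intro exI[of _ R] allI impI)
      fix x assume "\<exists>i<m. R < \<bar>x i\<bar>"
      then obtain i where "i < m" "R < \<bar>x i\<bar>" by auto
      thus "f (x(m := z)) = 0" by (intro R exI[of _ i]) auto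
    qed
  qed
qed

section \<open>Isonormal processes: almost sure linearity and integration by parts\<close>

locale isonormal =
  fixes M :: "'w measure" and X :: "'h::{real_inner,banach,second_countable_topology} \<Rightarrow> 'w \<Rightarrow> real"
  assumes isonormal: "isonormal_process M X"
begin

sublocale prob_space M using isonormal by (simp add: isonormal_process_def)

lemma X_gaussian: "centered_gaussian M (X h)"
proof -
  have "\<forall>J c. finite J \<longrightarrow> centered_gaussian M (\<lambda>\<omega>. \<Sum>i\<in>J. c i * X i \<omega>)"
    using isonormal by (simp add: isonormal_process_def centered_gaussian_family_def)
  from this[rule_format, of "{h}" "\<lambda>_. 1"] show ?thesis by simp
qed

lemma X_measurable[measurable]: "X h \<in> borel_measurable M"
  using X_gaussian[of h] by (simp add: centered_gaussian_def)

lemma X_inner: "(\<integral>\<omega>. X g \<omega> * X h \<omega> \<partial>M) = g \<bullet> h"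
  using isonormal by (simp add: isonormal_process_def)

text \<open>The definition provides a Gaussian law of unspecified variance. The covariance
  identifies that variance with the squared norm of \<open>h\<close>, and in the degenerate case it
  forces the norm to be 0.\<close>

lemma X_sq_integrable: "integrable M (\<lambda>\<omega>. (X h \<omega>)\<^sup>2)"
  and char_X: "(\<integral>\<omega>. cis (X h \<omega>) \<partial>M) = exp (- (norm h)\<^sup>2 / 2)"
proof -
  have "integrable M (\<lambda>\<omega>. (X h \<omega>)\<^sup>2) \<and> (\<integral>\<omega>. cis (X h \<omega>) \<partial>M) = exp (- (norm h)\<^sup>2 / 2)"
  proof (cases "AE \<omega> in M. X h \<omega> = 0")
    case True
    have "integrable M (\<lambda>\<omega>. (X h \<omega>)\<^sup>2) = integrable M (\<lambda>\<omega>. 0::real)"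
      using True by (intro integrable_cong_AE) auto
    moreover have "(\<integral>\<omega>. cis (X h \<omega>) \<partial>M) = (\<integral>\<omega>. 1 \<partial>M)"
      using True by (intro integral_cong_AE) (auto simp: cis_conv_exp)
    moreover have "(\<integral>\<omega>. X h \<omega> * X h \<omega> \<partial>M) = (\<integral>\<omega>. 0 \<partial>M)"
      using True by (intro integral_cong_AE) auto
    hence "norm h = 0" by (simp add: X_inner)
    ultimately show ?thesis by (simp add: prob_space)
  next
    case False
    then obtain \<sigma> where \<sigma>: "\<sigma> > 0" "distributed M lborel (X h) (normal_density 0 \<sigma>)"
      using X_gaussian[of h] by (auto simp: centered_gaussian_def)
    let ?G = std_normal_distribution
    define Z where "Z = (\<lambda>\<omega>. X h \<omega> / \<sigma>)"
    have Zm[measurable]: "Z \<in> borel_measurable M" unfolding Z_def by measurable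
    have "distributed M lborel Z std_normal_density"
      using \<sigma> by (simp add: Z_def normal_standard_normal_convert[OF \<sigma>(1), of "X h" 0])
    hence G: "distr M lborel Z = ?G" by (simp add: distributed_distr_eq_density)
    have XZ: "X h \<omega> = \<sigma> * Z \<omega>" for \<omega> using \<sigma>(1) by (simp add: Z_def)
    have "integrable (distr M lborel Z) (\<lambda>x. x\<^sup>2)"
      unfolding G by (rule integrable_std_normal_distribution_moment)
    hence iZ: "integrable M (\<lambda>\<omega>. (Z \<omega>)\<^sup>2)" by (subst (asm) integrable_distr_eq) auto
    have "(\<integral>\<omega>. (Z \<omega>)\<^sup>2 \<partial>M) = (\<integral>x. x\<^sup>2 \<partial>distr M lborel Z)" by (subst integral_distr) auto
    also have "\<dots> = 1" unfolding G using std_normal_distribution_even_moments(1)[of 1] by simp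
    finally have Z2: "(\<integral>\<omega>. (Z \<omega>)\<^sup>2 \<partial>M) = 1" .
    have "(\<lambda>\<omega>. X h \<omega> * X h \<omega>) = (\<lambda>\<omega>. \<sigma>\<^sup>2 * (Z \<omega>)\<^sup>2)"
      unfolding XZ power2_eq_square by (simp only: mult_ac)
    hence "(\<integral>\<omega>. X h \<omega> * X h \<omega> \<partial>M) = \<sigma>\<^sup>2" using Z2 by simp
    hence s: "\<sigma>\<^sup>2 = (norm h)\<^sup>2" by (simp add: X_inner power2_norm_eq_inner)
    have "(\<integral>\<omega>. cis (X h \<omega>) \<partial>M) = (\<integral>x. cis (\<sigma> * x) \<partial>distr M lborel Z)"
      unfolding XZ by (subst integral_distr) (auto simp: cis_conv_exp)
    also have "\<dots> = exp (- \<sigma>\<^sup>2 / 2)" unfolding G by (rule integral_cis_std_normal)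
    finally show ?thesis using iZ by (simp add: XZ power_mult_distrib s)
  qed
  thus "integrable M (\<lambda>\<omega>. (X h \<omega>)\<^sup>2)" "(\<integral>\<omega>. cis (X h \<omega>) \<partial>M) = exp (- (norm h)\<^sup>2 / 2)" by auto
qed

lemma X_integrable: "integrable M (X h)"
  by (rule square_integrable_imp_integrable[OF X_measurable X_sq_integrable])

lemma X_mult_integrable: "integrable M (\<lambda>\<omega>. X g \<omega> * X h \<omega>)"
proof (rule Bochner_Integration.integrable_bound)
  show "integrable M (\<lambda>\<omega>. (X g \<omega>)\<^sup>2 + (X h \<omega>)\<^sup>2)" by (intro Bochner_Integration.integrable_add X_sq_integrable)
  have "\<bar>a * b\<bar> \<le> a\<^sup>2 + b\<^sup>2" for a b :: real
  proof -
    have "2 * (\<bar>a\<bar> * \<bar>b\<bar>) \<le> a\<^sup>2 + b\<^sup>2"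
      using sum_squares_bound[of "\<bar>a\<bar>" "\<bar>b\<bar>"] by (simp add: mult.assoc)
    moreover have "0 \<le> \<bar>a\<bar> * \<bar>b\<bar>" by simp
    ultimately show ?thesis unfolding abs_mult by linarith
  qed
  thus "AE \<omega> in M. norm (X g \<omega> * X h \<omega>) \<le> norm ((X g \<omega>)\<^sup>2 + (X h \<omega>)\<^sup>2)" by simp
qed measurable

text \<open>Expanding the second moment of the difference by the covariance gives the squared norm
  of the corresponding combination of vectors, which is 0.\<close>

lemma X_linear: "AE \<omega> in M. X (g + s *\<^sub>R k) \<omega> = X g \<omega> + s * X k \<omega>"
proof -
  note [simp] = X_mult_integrable
  let ?d = "\<lambda>\<omega>. (X (g + s *\<^sub>R k) \<omega> - X g \<omega> - s * X k \<omega>)\<^sup>2"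
  have e: "?d = (\<lambda>\<omega>. X (g + s *\<^sub>R k) \<omega> * X (g + s *\<^sub>R k) \<omega> + X g \<omega> * X g \<omega> + s * s * (X k \<omega> * X k \<omega>)
     - 2 * (X (g + s *\<^sub>R k) \<omega> * X g \<omega>) - 2 * s * (X (g + s *\<^sub>R k) \<omega> * X k \<omega>) + 2 * s * (X g \<omega> * X k \<omega>))"
    by (rule ext) (simp add: power2_eq_square algebra_simps)
  have "(\<integral>\<omega>. ?d \<omega> \<partial>M) = 0"
    unfolding e by (simp add: X_inner inner_add_left inner_add_right inner_commute algebra_simps)
  moreover have "integrable M ?d" unfolding e by simp
  ultimately have "AE \<omega> in M. ?d \<omega> = 0"
    by (subst (asm) integral_nonneg_eq_0_iff_AE) auto
  thus ?thesis by eventually_elim auto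
qed

lemma X_zero: "AE \<omega> in M. X 0 \<omega> = 0"
  using X_linear[of 0 1 0] by eventually_elim auto

text \<open>This is the derivative at t = 0 of E[cis (X (g + t k))] = exp (-|g + t k|^2 / 2), taken
  along a sequence so that dominated convergence applies; the difference quotients are dominated by
  the integrable variable |X k|.\<close>

lemma integral_X_cis:
  "(\<integral>\<omega>. cis (X g \<omega>) * X k \<omega> \<partial>M) = \<i> * (g \<bullet> k) * (\<integral>\<omega>. cis (X g \<omega>) \<partial>M)"
proof -
  define s where "s = (\<lambda>n. inverse (real (Suc n)))"
  have s0: "s n > 0" for n by (simp add: s_def)
  have s: "s \<longlonglongrightarrow> 0" unfolding s_def by (rule LIMSEQ_inverse_real_of_nat)
  define q where "q = (\<lambda>t. exp (- (norm (g + t *\<^sub>R k))\<^sup>2 / 2))"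
  have q: "q t = exp (- (g \<bullet> g + 2 * t * (g \<bullet> k) + t\<^sup>2 * (k \<bullet> k)) / 2)" for t
    unfolding q_def power2_norm_eq_inner
    by (simp add: inner_add_left inner_add_right inner_commute power2_eq_square algebra_simps)
  have "(q has_real_derivative - (g \<bullet> k) * q 0) (at 0)"
    unfolding q by (auto intro!: derivative_eq_intros)
  hence "(\<lambda>t. (q t - q 0) / t) \<midarrow>0\<rightarrow> - (g \<bullet> k) * q 0"
    by (simp add: has_field_derivative_iff)
  moreover have "s n \<noteq> 0" for n using s0[of n] by simp
  hence "filterlim s (at 0) sequentially" by (simp add: filterlim_at s)
  ultimately have 1: "(\<lambda>n. (q (s n) - q 0) / s n) \<longlonglongrightarrow> - (g \<bullet> k) * q 0"
    by (rule filterlim_compose)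
  have diff: "(\<integral>\<omega>. cis (X g \<omega>) * ((cis (s n * X k \<omega>) - 1) / s n) \<partial>M) = (q (s n) - q 0) / s n" for n
  proof -
    have ic: "integrable M (\<lambda>\<omega>. cis (X h \<omega>))" for h
      by (rule integrable_const_bound[of _ 1]) (auto simp: cis_conv_exp)
    have "(\<integral>\<omega>. cis (X g \<omega>) * ((cis (s n * X k \<omega>) - 1) / s n) \<partial>M)
        = (\<integral>\<omega>. (cis (X (g + s n *\<^sub>R k) \<omega>) - cis (X g \<omega>)) / s n \<partial>M)"
    proof (rule integral_cong_AE)
      show "AE \<omega> in M. cis (X g \<omega>) * ((cis (s n * X k \<omega>) - 1) / s n) = (cis (X (g + s n *\<^sub>R k) \<omega>) - cis (X g \<omega>)) / s n"
        using X_linear[of g "s n" k]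
        by eventually_elim (simp add: right_diff_distrib diff_divide_distrib flip: cis_mult)
    qed (simp_all add: cis_conv_exp)
    also have "\<dots> = (q (s n) - q 0) / s n"
      using ic by (simp add: char_X q_def)
    finally show ?thesis .
  qed
  have "(\<lambda>n. \<integral>\<omega>. cis (X g \<omega>) * ((cis (s n * X k \<omega>) - 1) / s n) \<partial>M) \<longlonglongrightarrow> (\<integral>\<omega>. cis (X g \<omega>) * (\<i> * X k \<omega>) \<partial>M)"
  proof (rule integral_dominated_convergence[where w="\<lambda>\<omega>. \<bar>X k \<omega>\<bar>"])
    show "AE \<omega> in M. (\<lambda>n. cis (X g \<omega>) * ((cis (s n * X k \<omega>) - 1) / s n)) \<longlonglongrightarrow> cis (X g \<omega>) * (\<i> * X k \<omega>)"
    proof (intro AE_I2 tendsto_mult tendsto_const)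
      fix \<omega>
      show "(\<lambda>n. (cis (s n * X k \<omega>) - 1) / s n) \<longlonglongrightarrow> \<i> * X k \<omega>"
      \<comment> \<open>The second-order Taylor remainder of the exponential, divided by
        \<open>s n\<close>, is at most \<open>s n * (X k \<omega>)\<^sup>2 / 2\<close>.\<close>
      proof (rule Lim_transform2[OF tendsto_const], rule Lim_null_comparison)
        show "(\<lambda>n. s n * (X k \<omega>)\<^sup>2 / 2) \<longlonglongrightarrow> 0"
          using tendsto_mult[OF s tendsto_const[of "(X k \<omega>)\<^sup>2 / 2"]] by simp
        show "\<forall>\<^sub>F n in sequentially. norm (\<i> * X k \<omega> - (cis (s n * X k \<omega>) - 1) / s n) \<le> s n * (X k \<omega>)\<^sup>2 / 2"
        proof (rule always_eventually, rule allI)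
          fix n
          have "norm (\<i> * X k \<omega> - (cis (s n * X k \<omega>) - 1) / s n) = norm (cis (s n * X k \<omega>) - (1 + \<i> * (s n * X k \<omega>))) / s n"
          proof -
            have "\<i> * X k \<omega> - (cis (s n * X k \<omega>) - 1) / s n = - ((cis (s n * X k \<omega>) - (1 + \<i> * (s n * X k \<omega>))) / s n)"
              using s0[of n] by (simp add: field_simps)
            thus ?thesis using s0[of n] by (simp add: norm_divide)
          qed
          also have "\<dots> \<le> (\<bar>s n * X k \<omega>\<bar>\<^sup>2 / 2) / s n"
            using iexp_approx1[of "s n * X k \<omega>" 1] s0[of n]
            by (intro divide_right_mono) (simp_all add: cis_conv_exp numeral_2_eq_2)
          also have "\<dots> = s n * (X k \<omega>)\<^sup>2 / 2"
            using s0[of n] by (simp add: power_mult_distrib power2_eq_square)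
          finally show "norm (\<i> * X k \<omega> - (cis (s n * X k \<omega>) - 1) / s n) \<le> s n * (X k \<omega>)\<^sup>2 / 2" .
        qed
      qed
    qed
    show "AE \<omega> in M. norm (cis (X g \<omega>) * ((cis (s n * X k \<omega>) - 1) / s n)) \<le> \<bar>X k \<omega>\<bar>" for n
    proof (rule AE_I2)
      fix \<omega>
      have "norm (cis (s n * X k \<omega>) - 1) \<le> s n * \<bar>X k \<omega>\<bar>"
        using iexp_approx1[of "s n * X k \<omega>" 0] s0[of n] by (simp add: cis_conv_exp abs_mult)
      thus "norm (cis (X g \<omega>) * ((cis (s n * X k \<omega>) - 1) / s n)) \<le> \<bar>X k \<omega>\<bar>"
        using s0[of n] by (simp add: norm_mult norm_divide divide_le_eq mult.commute)
    qed
  qed (simp_all add: cis_conv_exp X_integrable)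
  hence 2: "(\<lambda>n. complex_of_real ((q (s n) - q 0) / s n)) \<longlonglongrightarrow> (\<integral>\<omega>. cis (X g \<omega>) * (\<i> * X k \<omega>) \<partial>M)"
    unfolding diff .
  have "(\<integral>\<omega>. cis (X g \<omega>) * (\<i> * X k \<omega>) \<partial>M) = complex_of_real (- (g \<bullet> k) * q 0)"
    by (rule LIMSEQ_unique[OF 2 tendsto_of_real[OF 1]])
  moreover have "(\<integral>\<omega>. cis (X g \<omega>) * (\<i> * X k \<omega>) \<partial>M) = \<i> * (\<integral>\<omega>. cis (X g \<omega>) * X k \<omega> \<partial>M)"
    by (subst integral_mult_right_zero[symmetric]) (simp add: mult_ac)
  ultimately have "\<i> * (\<integral>\<omega>. cis (X g \<omega>) * X k \<omega> \<partial>M) = \<i> * (\<i> * (g \<bullet> k) * (\<integral>\<omega>. cis (X g \<omega>) \<partial>M))"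
    by (simp add: char_X q_def mult.assoc[symmetric])
  thus ?thesis by simp
qed

lemma measurable_cylinder:
  assumes "continuous_on UNIV (f :: (nat \<Rightarrow> real) \<Rightarrow> real)"
  shows "(\<lambda>\<omega>. f (\<lambda>i. X (h i) \<omega>)) \<in> borel_measurable M"
  by (rule measurable_compose[OF measurable_coordinatewise_then_product
      borel_measurable_continuous_onI[OF assms]]) measurable

lemma measurable_cylinder_fun_upd:
  assumes "continuous_on UNIV (f :: (nat \<Rightarrow> real) \<Rightarrow> real)"
  shows "(\<lambda>(z, \<omega>). f ((\<lambda>i. X (h i) \<omega>)(m := z))) \<in> borel_measurable (borel \<Otimes>\<^sub>M M)"
proof -
  have "(\<lambda>p. (\<lambda>i. X (h i) (snd p))(m := fst p)) \<in> borel_measurable (borel \<Otimes>\<^sub>M M)"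
  proof (rule measurable_coordinatewise_then_product)
    show "(\<lambda>p. ((\<lambda>i. X (h i) (snd p))(m := fst p)) i) \<in> borel_measurable (borel \<Otimes>\<^sub>M M)" for i
      by (cases "i = m") simp_all
  qed
  from measurable_compose[OF this borel_measurable_continuous_onI[OF assms]]
  show ?thesis by (simp add: case_prod_beta')
qed

lemma continuous_fun_upd:
  assumes "continuous_on UNIV (f :: (nat \<Rightarrow> real) \<Rightarrow> real)"
  shows "continuous_on A (\<lambda>z. f (x(m := z)))"
proof -
  have "continuous_on UNIV (\<lambda>z::real. x(m := z))"
  proof (rule continuous_on_coordinatewise_then_product)
    show "continuous_on UNIV (\<lambda>z::real. (x(m := z)) i)" for i by (cases "i = m") simp_all
  qed
  from continuous_on_compose2[OF assms this] show ?thesis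
    by (rule continuous_on_subset) auto
qed

text \<open>The factor \<open>cis (X g \<omega>)\<close> makes the induction on the number of coordinates work: the last
  coordinate is replaced by a character, which is absorbed into \<open>g\<close>.\<close>

lemma gaussian_ibp_cis:
  assumes "C1_compact_support m f"
  shows "(\<integral>\<omega>. f (\<lambda>i. X (h i) \<omega>) * X k \<omega> * cis (X g \<omega>) \<partial>M) =
    (\<integral>\<omega>. (\<Sum>i<m. partial_deriv i f (\<lambda>i. X (h i) \<omega>) * (h i \<bullet> k)) * cis (X g \<omega>) \<partial>M)
    + \<i> * (g \<bullet> k) * (\<integral>\<omega>. f (\<lambda>i. X (h i) \<omega>) * cis (X g \<omega>) \<partial>M)"
  using assms
proof (induction m arbitrary: f g)
  \<comment> \<open>Without coordinates \<open>f\<close> is constant, and the claim is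
    \<open>integral_X_cis\<close> times that constant.\<close>
  case 0
  have "f x = f (\<lambda>_. 0)" for x using 0 by (auto simp: C1_compact_support_def depends_below_def)
  hence "f = (\<lambda>_. f (\<lambda>_. 0))" by (intro ext)
  then obtain c where f: "f = (\<lambda>_. c)" by blast
  show ?case unfolding f using integral_X_cis[of g k]
    by (simp add: mult.assoc mult.commute[of "complex_of_real (X k _)"])
next
  case (Suc m)
  note f = Suc.prems
  obtain B where B: "B \<ge> 0" "\<And>x. \<bar>f x\<bar> \<le> B" "\<And>i x. i < Suc m \<Longrightarrow> \<bar>partial_deriv i f x\<bar> \<le> B"
    using C1_compact_support_bounds[OF f] by blast
  obtain R where R: "\<And>x. \<exists>i<Suc m. R < \<bar>x i\<bar> \<Longrightarrow> f x = 0"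
    using f unfolding C1_compact_support_def by blast
  have contf: "continuous_on UNIV f" and contd: "\<And>i. i < Suc m \<Longrightarrow> continuous_on UNIV (partial_deriv i f)"
    and der: "\<And>i x. i < Suc m \<Longrightarrow> ((\<lambda>t. f (x(i := t))) has_field_derivative partial_deriv i f x) (at (x i))"
    using f unfolding C1_compact_support_def by blast+
  define V where "V = (\<lambda>\<omega> i. X (h i) \<omega>)"
  define S where "S = (\<lambda>x. \<Sum>i<m. partial_deriv i f x * (h i \<bullet> k))"
  define c where "c = g \<bullet> k"
  define b where "b = h m \<bullet> k"
  \<comment> \<open>With the last coordinate frozen at z and \<open>g\<close> replaced by g + l h_m,
    the induction hypothesis has coefficient c + l b in place of c. The part with c goes into
    \<open>P\<close>, the part linear in l into \<open>Q\<close>; \<open>fourier_transfer\<close>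
    turns the latter into \<open>Q'\<close>, the missing derivative in the last coordinate, and
    restores z = X (h_m).\<close>
  define P where "P = (\<lambda>z \<omega>. (complex_of_real (f ((V \<omega>)(m := z)) * X k \<omega> - S ((V \<omega>)(m := z))) - \<i> * c * f ((V \<omega>)(m := z))) * cis (X g \<omega>))"
  define Q where "Q = (\<lambda>z \<omega>. complex_of_real (f ((V \<omega>)(m := z))) * (- b * cis (X g \<omega>)))"
  define Q' where "Q' = (\<lambda>z \<omega>. complex_of_real (partial_deriv m f ((V \<omega>)(m := z))) * (- b * cis (X g \<omega>)))"
  define a where "a = (\<Sum>i<m. \<bar>h i \<bullet> k\<bar>)"
  define D where "D = (\<lambda>\<omega>. B * (\<bar>X k \<omega>\<bar> + (a + \<bar>c\<bar> + \<bar>b\<bar>)))"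
  have a0: "0 \<le> a" unfolding a_def by (intro sum_nonneg) auto
  have contS: "continuous_on UNIV S" unfolding S_def by (intro continuous_intros contd) auto
  have Sb: "\<bar>S x\<bar> \<le> B * a" for x
  proof -
    have "\<bar>S x\<bar> \<le> (\<Sum>i<m. \<bar>partial_deriv i f x * (h i \<bullet> k)\<bar>)" unfolding S_def by (rule sum_abs)
    also have "\<dots> \<le> (\<Sum>i<m. B * \<bar>h i \<bullet> k\<bar>)"
      unfolding abs_mult by (intro sum_mono mult_right_mono B(3)) auto
    finally show ?thesis by (simp add: a_def sum_distrib_left)
  qed
  have mV[measurable]: "(\<lambda>\<omega>. f (V \<omega>)) \<in> borel_measurable M" "(\<lambda>\<omega>. S (V \<omega>)) \<in> borel_measurable M"
    "(\<lambda>\<omega>. partial_deriv m f (V \<omega>)) \<in> borel_measurable M"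
    unfolding V_def using contf contS contd[of m] by (simp_all add: measurable_cylinder)
  have mz[measurable]: "(\<lambda>(z, \<omega>). f ((V \<omega>)(m := z))) \<in> borel_measurable (borel \<Otimes>\<^sub>M M)"
    "(\<lambda>(z, \<omega>). S ((V \<omega>)(m := z))) \<in> borel_measurable (borel \<Otimes>\<^sub>M M)"
    "(\<lambda>(z, \<omega>). partial_deriv m f ((V \<omega>)(m := z))) \<in> borel_measurable (borel \<Otimes>\<^sub>M M)"
    unfolding V_def using contf contS contd[of m] by (simp_all add: measurable_cylinder_fun_upd)
  have mz1[measurable]: "(\<lambda>\<omega>. f ((V \<omega>)(m := z))) \<in> borel_measurable M"
    "(\<lambda>\<omega>. S ((V \<omega>)(m := z))) \<in> borel_measurable M" for z
    using measurable_compose[OF measurable_Pair1' mz(1), of z] measurable_compose[OF measurable_Pair1' mz(2), of z] by simp_all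
  have bounds: "norm (P z \<omega>) \<le> D \<omega>" "norm (Q z \<omega>) \<le> D \<omega>" "norm (Q' z \<omega>) \<le> D \<omega>" for z \<omega>
  proof -
    let ?x = "(V \<omega>)(m := z)"
    have "norm (P z \<omega>) \<le> \<bar>f ?x * X k \<omega> - S ?x\<bar> + norm (\<i> * c * f ?x)"
      unfolding P_def norm_mult norm_cis mult_1_right
      by (rule order_trans[OF norm_triangle_ineq4]) (simp add: norm_mult del: of_real_diff of_real_mult)
    also have "\<dots> \<le> B * \<bar>X k \<omega>\<bar> + B * a + B * \<bar>c\<bar>"
    proof (intro add_mono)
      have "\<bar>f ?x * X k \<omega>\<bar> \<le> B * \<bar>X k \<omega>\<bar>" unfolding abs_mult by (intro mult_right_mono B(2)) auto
      thus "\<bar>f ?x * X k \<omega> - S ?x\<bar> \<le> B * \<bar>X k \<omega>\<bar> + B * a"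
        using Sb[of ?x] by (intro order_trans[OF abs_triangle_ineq4] add_mono)
      show "norm (\<i> * c * f ?x) \<le> B * \<bar>c\<bar>"
        using mult_left_mono[OF B(2)[of ?x], of "\<bar>c\<bar>"] by (simp add: norm_mult mult.commute)
    qed
    also have "\<dots> \<le> D \<omega>" unfolding D_def using B(1) mult_nonneg_nonneg[OF B(1), of "\<bar>b\<bar>"]
      by (simp add: algebra_simps)
    finally show "norm (P z \<omega>) \<le> D \<omega>" .
    have "t * \<bar>b\<bar> \<le> D \<omega>" if "t \<le> B" for t
    proof -
      have "t * \<bar>b\<bar> \<le> B * \<bar>b\<bar>" using that by (intro mult_right_mono) auto
      also have "\<dots> \<le> D \<omega>" unfolding D_def using a0 by (intro mult_left_mono B(1)) auto
      finally show ?thesis .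
    qed
    thus "norm (Q z \<omega>) \<le> D \<omega>" "norm (Q' z \<omega>) \<le> D \<omega>"
      using B(2) B(3)[of m] by (simp_all add: Q_def Q'_def norm_mult)
  qed
  have D: "integrable M D" unfolding D_def
    by (intro Bochner_Integration.integrable_mult_right Bochner_Integration.integrable_add
        integrable_abs X_integrable) auto
  \<comment> \<open>The radius is enlarged by 1 because \<open>f\<close> is known to vanish under a
    strict inequality, while \<open>fourier_transfer\<close> asks for a non-strict one.\<close>
  have supp: "f (x(m := z)) = 0" "S (x(m := z)) = 0" "partial_deriv m f (x(m := z)) = 0"
    if "\<bar>R\<bar> + 1 \<le> \<bar>z\<bar>" for x z
  proof -
    have e: "\<exists>i<Suc m. R < \<bar>(x(m := z)) i\<bar>" using that by (intro exI[of _ m]) auto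
    show "f (x(m := z)) = 0" by (rule R[OF e])
    show "partial_deriv m f (x(m := z)) = 0" by (rule partial_deriv_supp[where m="Suc m", OF R e])
    show "S (x(m := z)) = 0" unfolding S_def
      by (intro sum.neutral ballI) (simp add: partial_deriv_supp[where m="Suc m", OF R e])
  qed
  have main: "(\<integral>\<omega>. P (X (h m) \<omega>) \<omega> + Q' (X (h m) \<omega>) \<omega> + 0 \<partial>M) = 0"
  proof (rule fourier_transfer[where Q=Q and R="\<lambda>_ _. 0" and R'="\<lambda>_ _. 0" and D=D and K="\<bar>R\<bar> + 1"])
    show "prob_space M" by (rule prob_space_axioms)
    show "(\<lambda>(z, \<omega>). P z \<omega>) \<in> borel_measurable (borel \<Otimes>\<^sub>M M)"
      "(\<lambda>(z, \<omega>). Q z \<omega>) \<in> borel_measurable (borel \<Otimes>\<^sub>M M)"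
      "(\<lambda>(z, \<omega>). Q' z \<omega>) \<in> borel_measurable (borel \<Otimes>\<^sub>M M)"
      unfolding P_def Q_def Q'_def cis_conv_exp by measurable
    show "norm (0::complex) \<le> D \<omega>" for \<omega> using order_trans[OF norm_ge_zero bounds(1)[of 0 \<omega>]] by simp
    show "norm (0::complex) \<le> D \<omega>" for \<omega> using order_trans[OF norm_ge_zero bounds(1)[of 0 \<omega>]] by simp
    show "P z \<omega> = 0 \<and> Q z \<omega> = 0 \<and> (0::complex) = 0 \<and> Q' z \<omega> = 0 \<and> (0::complex) = 0 \<and> (0::complex) = 0"
      if "\<bar>R\<bar> + 1 \<le> \<bar>z\<bar>" for z \<omega>
      using supp[OF that, of "V \<omega>"] by (simp add: P_def Q_def Q'_def)
    show "((\<lambda>z. Q z \<omega>) has_vector_derivative Q' z \<omega>) (at z)" for z \<omega>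
    proof -
      have "((\<lambda>t. f (((V \<omega>)(m := z))(m := t))) has_field_derivative partial_deriv m f ((V \<omega>)(m := z))) (at (((V \<omega>)(m := z)) m))"
        by (rule der) simp
      hence "((\<lambda>t. f ((V \<omega>)(m := t))) has_field_derivative partial_deriv m f ((V \<omega>)(m := z))) (at z)" by simp
      from has_vector_derivative_mult_left[OF has_vector_derivative_of_real[OF this]]
      show ?thesis unfolding Q_def Q'_def .
    qed
    show "continuous_on UNIV (\<lambda>z. P z \<omega>)" "continuous_on UNIV (\<lambda>z. Q' z \<omega>)" for \<omega>
      unfolding P_def Q'_def by (intro continuous_intros continuous_fun_upd contf contS contd lessI)+
    show "(\<integral>\<omega>. (P z \<omega> + \<i> * l * Q z \<omega> - (complex_of_real l)\<^sup>2 * 0) * cis (l * X (h m) \<omega>) \<partial>M) = 0" for z l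
    proof -
      define f' where "f' = (\<lambda>x. f (x(m := z)))"
      define g' where "g' = g + l *\<^sub>R h m"
      have f': "C1_compact_support m f'" unfolding f'_def by (rule C1_compact_support_fun_upd(1)[OF f])
      have S': "(\<Sum>i<m. partial_deriv i f' x * (h i \<bullet> k)) = S (x(m := z))" for x
        unfolding S_def f'_def by (intro sum.cong refl) (simp add: C1_compact_support_fun_upd(2)[OF f])
      have IH: "(\<integral>\<omega>. f ((V \<omega>)(m := z)) * X k \<omega> * cis (X g' \<omega>) \<partial>M) =
        (\<integral>\<omega>. S ((V \<omega>)(m := z)) * cis (X g' \<omega>) \<partial>M) + \<i> * (g' \<bullet> k) * (\<integral>\<omega>. f ((V \<omega>)(m := z)) * cis (X g' \<omega>) \<partial>M)"
        using Suc.IH[OF f', of g'] unfolding S' by (simp add: V_def f'_def)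
      have i1: "integrable M (\<lambda>\<omega>. f ((V \<omega>)(m := z)) * X k \<omega> * cis (X g' \<omega>))"
        by (rule Bochner_Integration.integrable_bound[where f="\<lambda>\<omega>. B * X k \<omega>"])
          (auto simp: norm_mult abs_mult X_integrable B intro!: mult_right_mono, simp add: cis_conv_exp)
      have i2: "integrable M (\<lambda>\<omega>. S ((V \<omega>)(m := z)) * cis (X g' \<omega>))"
        by (rule integrable_const_bound[where B="B * a"]) (use Sb in \<open>auto simp: norm_mult cis_conv_exp\<close>)
      have i3: "integrable M (\<lambda>\<omega>. f ((V \<omega>)(m := z)) * cis (X g' \<omega>))"
        by (rule integrable_const_bound[where B="B"]) (use B in \<open>auto simp: norm_mult cis_conv_exp\<close>)
      have "(\<integral>\<omega>. (P z \<omega> + \<i> * l * Q z \<omega> - (complex_of_real l)\<^sup>2 * 0) * cis (l * X (h m) \<omega>) \<partial>M)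
         = (\<integral>\<omega>. f ((V \<omega>)(m := z)) * X k \<omega> * cis (X g' \<omega>) - S ((V \<omega>)(m := z)) * cis (X g' \<omega>)
             - \<i> * (g' \<bullet> k) * (f ((V \<omega>)(m := z)) * cis (X g' \<omega>)) \<partial>M)"
      proof (rule integral_cong_AE)
        show "AE \<omega> in M. (P z \<omega> + \<i> * l * Q z \<omega> - (complex_of_real l)\<^sup>2 * 0) * cis (l * X (h m) \<omega>)
          = f ((V \<omega>)(m := z)) * X k \<omega> * cis (X g' \<omega>) - S ((V \<omega>)(m := z)) * cis (X g' \<omega>)
             - \<i> * (g' \<bullet> k) * (f ((V \<omega>)(m := z)) * cis (X g' \<omega>))"
          using X_linear[of g l "h m"]
        proof eventually_elim
          case (elim \<omega>)
          have "cis (X g' \<omega>) = cis (X g \<omega>) * cis (l * X (h m) \<omega>)"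
            unfolding g'_def elim cis_mult ..
          moreover have "g' \<bullet> k = c + l * b" by (simp add: g'_def c_def b_def inner_add_left)
          ultimately show ?case unfolding P_def Q_def by (simp add: algebra_simps)
        qed
      qed (simp_all add: P_def Q_def cis_conv_exp)
      also have "\<dots> = 0"
        using i1 i2 i3 IH by (simp add: mult.assoc)
      finally show ?thesis .
    qed
  qed (use bounds D in \<open>simp_all\<close>)
  have Vm: "(V \<omega>)(m := X (h m) \<omega>) = V \<omega>" for \<omega> by (simp add: V_def fun_eq_iff)
  have i1: "integrable M (\<lambda>\<omega>. f (V \<omega>) * X k \<omega> * cis (X g \<omega>))"
    by (rule Bochner_Integration.integrable_bound[where f="\<lambda>\<omega>. B * X k \<omega>"])
      (auto simp: norm_mult abs_mult X_integrable B intro!: mult_right_mono, simp add: cis_conv_exp)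
  have i2: "integrable M (\<lambda>\<omega>. (S (V \<omega>) + partial_deriv m f (V \<omega>) * b) * cis (X g \<omega>))"
  proof (rule integrable_const_bound[where B="B * a + B * \<bar>b\<bar>"])
    have "\<bar>S (V \<omega>) + partial_deriv m f (V \<omega>) * b\<bar> \<le> B * a + B * \<bar>b\<bar>" for \<omega>
      using B(3)[of m "V \<omega>"]
      by (intro order_trans[OF abs_triangle_ineq] add_mono Sb) (simp add: abs_mult mult_right_mono)
    thus "AE \<omega> in M. norm ((S (V \<omega>) + partial_deriv m f (V \<omega>) * b) * cis (X g \<omega>)) \<le> B * a + B * \<bar>b\<bar>"
      by (simp only: norm_mult norm_cis norm_of_real of_real_mult[symmetric] of_real_add[symmetric]) simp
  qed (simp add: cis_conv_exp)
  have i3: "integrable M (\<lambda>\<omega>. f (V \<omega>) * cis (X g \<omega>))"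
    by (rule integrable_const_bound[where B="B"]) (use B in \<open>auto simp: norm_mult cis_conv_exp\<close>)
  have "(\<integral>\<omega>. P (X (h m) \<omega>) \<omega> + Q' (X (h m) \<omega>) \<omega> + 0 \<partial>M)
     = (\<integral>\<omega>. f (V \<omega>) * X k \<omega> * cis (X g \<omega>) - (S (V \<omega>) + partial_deriv m f (V \<omega>) * b) * cis (X g \<omega>)
         - \<i> * c * (f (V \<omega>) * cis (X g \<omega>)) \<partial>M)"
    by (rule Bochner_Integration.integral_cong) (simp_all add: P_def Q'_def Vm algebra_simps)
  also have "\<dots> = (\<integral>\<omega>. f (V \<omega>) * X k \<omega> * cis (X g \<omega>) \<partial>M)
     - (\<integral>\<omega>. (S (V \<omega>) + partial_deriv m f (V \<omega>) * b) * cis (X g \<omega>) \<partial>M)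
     - \<i> * c * (\<integral>\<omega>. f (V \<omega>) * cis (X g \<omega>) \<partial>M)"
    using i1 i2 i3 by (simp add: mult.assoc)
  finally show ?case
    using main by (simp add: S_def V_def c_def b_def algebra_simps)
qed

text \<open>The case g = 0 of the identity with characters: X 0 vanishes almost surely, so the
  characters are 1 and the extra term has coefficient 0.\<close>

theorem gaussian_ibp:
  assumes f: "C1_compact_support m f"
  shows "(\<integral>\<omega>. f (\<lambda>i. X (h i) \<omega>) * X k \<omega> \<partial>M) =
    (\<integral>\<omega>. (\<Sum>i<m. partial_deriv i f (\<lambda>i. X (h i) \<omega>) *\<^sub>R h i) \<bullet> k \<partial>M)"
proof -
  have cf[measurable]: "(\<lambda>\<omega>. f (\<lambda>i. X (h i) \<omega>)) \<in> borel_measurable M"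
    and cd[measurable]: "\<And>i. i < m \<Longrightarrow> (\<lambda>\<omega>. partial_deriv i f (\<lambda>i. X (h i) \<omega>)) \<in> borel_measurable M"
    using f unfolding C1_compact_support_def by (simp_all add: measurable_cylinder)
  have sm[measurable]: "(\<lambda>\<omega>. \<Sum>i<m. partial_deriv i f (\<lambda>i. X (h i) \<omega>) * (h i \<bullet> k)) \<in> borel_measurable M"
    by (intro borel_measurable_sum borel_measurable_times cd) auto
  have c1: "AE \<omega> in M. cis (X 0 \<omega>) = 1" using X_zero by eventually_elim simp
  have "(\<integral>\<omega>. f (\<lambda>i. X (h i) \<omega>) * X k \<omega> * cis (X 0 \<omega>) \<partial>M) = complex_of_real (\<integral>\<omega>. f (\<lambda>i. X (h i) \<omega>) * X k \<omega> \<partial>M)"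
    unfolding integral_complex_of_real[symmetric] using c1
    by (intro integral_cong_AE) (auto simp: cis_conv_exp)
  moreover have "(\<integral>\<omega>. (\<Sum>i<m. partial_deriv i f (\<lambda>i. X (h i) \<omega>) * (h i \<bullet> k)) * cis (X 0 \<omega>) \<partial>M)
      = complex_of_real (\<integral>\<omega>. (\<Sum>i<m. partial_deriv i f (\<lambda>i. X (h i) \<omega>) * (h i \<bullet> k)) \<partial>M)"
    unfolding integral_complex_of_real[symmetric] using c1 sm
    by (intro integral_cong_AE) (auto simp: cis_conv_exp simp del: of_real_sum)
  ultimately have "complex_of_real (\<integral>\<omega>. f (\<lambda>i. X (h i) \<omega>) * X k \<omega> \<partial>M)
     = complex_of_real (\<integral>\<omega>. (\<Sum>i<m. partial_deriv i f (\<lambda>i. X (h i) \<omega>) * (h i \<bullet> k)) \<partial>M)"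
    using gaussian_ibp_cis[OF f, of h k 0] by (simp del: of_real_sum)
  thus ?thesis by (simp add: inner_sum_left)
qed

end

section \<open>Duality between derivative and divergence\<close>

lemma (in prob_space) integrable_inner_L2:
  fixes f g :: "'a \<Rightarrow> 'v::{real_inner, second_countable_topology, banach}"
  assumes [measurable]: "f \<in> borel_measurable M" "g \<in> borel_measurable M"
    and f: "integrable M (\<lambda>x. (norm (f x))\<^sup>2)" and g: "integrable M (\<lambda>x. (norm (g x))\<^sup>2)"
  shows "integrable M (\<lambda>x. f x \<bullet> g x)"
proof (rule Bochner_Integration.integrable_bound)
  show "integrable M (\<lambda>x. (norm (f x))\<^sup>2 + (norm (g x))\<^sup>2)" using f g by simp
  show "AE x in M. norm (f x \<bullet> g x) \<le> norm ((norm (f x))\<^sup>2 + (norm (g x))\<^sup>2)"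
  proof (rule AE_I2)
    fix x
    have "2 * (norm (f x) * norm (g x)) \<le> (norm (f x))\<^sup>2 + (norm (g x))\<^sup>2"
      using sum_squares_bound[of "norm (f x)" "norm (g x)"] by (simp add: mult.assoc)
    moreover have "0 \<le> norm (f x) * norm (g x)" by simp
    moreover have "\<bar>f x \<bullet> g x\<bar> \<le> norm (f x) * norm (g x)" by (rule Cauchy_Schwarz_ineq2)
    ultimately have "\<bar>f x \<bullet> g x\<bar> \<le> (norm (f x))\<^sup>2 + (norm (g x))\<^sup>2" by linarith
    thus "norm (f x \<bullet> g x) \<le> norm ((norm (f x))\<^sup>2 + (norm (g x))\<^sup>2)" by simp
  qed
qed measurable

text \<open>A single index at finite distance suffices: |F|^2 <= 2 |F_n|^2 + 2 |F_n - F|^2.\<close>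

lemma L2_tendsto_integrable:
  fixes F :: "'a \<Rightarrow> 'v::{real_normed_vector, second_countable_topology}"
  assumes [measurable]: "\<And>n. Fs n \<in> borel_measurable M" "F \<in> borel_measurable M"
    and Fs: "\<And>n. integrable M (\<lambda>x. (norm (Fs n x))\<^sup>2)" and lim: "L2_tendsto M Fs F"
  shows "integrable M (\<lambda>x. (norm (F x))\<^sup>2)"
proof -
  have "\<forall>\<^sub>F n in sequentially. (\<integral>\<^sup>+\<omega>. ennreal ((norm (Fs n \<omega> - F \<omega>))\<^sup>2) \<partial>M) < 1"
    using lim unfolding L2_tendsto_def by (rule order_tendstoD(2)) simp
  then obtain n where n: "(\<integral>\<^sup>+\<omega>. ennreal ((norm (Fs n \<omega> - F \<omega>))\<^sup>2) \<partial>M) < 1"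
    by (auto simp: eventually_sequentially)
  have d: "integrable M (\<lambda>\<omega>. (norm (Fs n \<omega> - F \<omega>))\<^sup>2)"
    using n by (intro integrableI_bounded) (auto intro: less_trans[of _ 1])
  show ?thesis
  proof (rule Bochner_Integration.integrable_bound)
    show "integrable M (\<lambda>\<omega>. 2 * (norm (Fs n \<omega>))\<^sup>2 + 2 * (norm (Fs n \<omega> - F \<omega>))\<^sup>2)"
      using d Fs by simp
    show "AE x in M. norm ((norm (F x))\<^sup>2) \<le> norm (2 * (norm (Fs n x))\<^sup>2 + 2 * (norm (Fs n x - F x))\<^sup>2)"
    proof (rule AE_I2)
      fix x
      have "norm (F x) \<le> norm (Fs n x) + norm (Fs n x - F x)"
        using norm_triangle_ineq4[of "Fs n x" "Fs n x - F x"] by simp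
      hence "(norm (F x))\<^sup>2 \<le> (norm (Fs n x) + norm (Fs n x - F x))\<^sup>2" by (rule power_mono) simp
      also have "\<dots> \<le> 2 * (norm (Fs n x))\<^sup>2 + 2 * (norm (Fs n x - F x))\<^sup>2"
        using sum_squares_bound[of "norm (Fs n x)" "norm (Fs n x - F x)"] by (simp add: power2_sum)
      finally show "norm ((norm (F x))\<^sup>2) \<le> norm (2 * (norm (Fs n x))\<^sup>2 + 2 * (norm (Fs n x - F x))\<^sup>2)" by simp
    qed
  qed measurable
qed

text \<open>Cauchy-Schwarz in squared form; the strict comparison of squares is undone at the end by
  monotonicity of the square.\<close>

lemma L2_tendsto_L1_mult:
  fixes F :: "'a \<Rightarrow> 'v::{real_normed_vector, second_countable_topology}" and K :: "'a \<Rightarrow> real"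
  assumes [measurable]: "\<And>n. Fs n \<in> borel_measurable M" "F \<in> borel_measurable M" "K \<in> borel_measurable M"
    and K: "integrable M (\<lambda>x. (K x)\<^sup>2)" and lim: "L2_tendsto M Fs F"
  shows "(\<lambda>n. \<integral>\<^sup>+x. ennreal (norm (Fs n x - F x) * \<bar>K x\<bar>) \<partial>M) \<longlonglongrightarrow> 0"
proof (rule tendsto_zero_ennreal)
  fix r :: real assume r: "0 < r"
  let ?y = "\<lambda>n. \<integral>\<^sup>+x. ennreal (norm (Fs n x - F x) * \<bar>K x\<bar>) \<partial>M"
  let ?C = "\<integral>\<^sup>+x. ennreal ((K x)\<^sup>2) \<partial>M"
  have C: "?C < top" using K by (simp add: integrable_iff_bounded)
  have "(\<lambda>n. (\<integral>\<^sup>+x. ennreal ((norm (Fs n x - F x))\<^sup>2) \<partial>M) * ?C) \<longlonglongrightarrow> 0 * ?C"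
    using lim C unfolding L2_tendsto_def by (intro tendsto_mult_ennreal tendsto_const) auto
  hence "(\<lambda>n. (\<integral>\<^sup>+x. ennreal ((norm (Fs n x - F x))\<^sup>2) \<partial>M) * ?C) \<longlonglongrightarrow> 0" by simp
  hence "\<forall>\<^sub>F n in sequentially. (\<integral>\<^sup>+x. ennreal ((norm (Fs n x - F x))\<^sup>2) \<partial>M) * ?C < (ennreal r)\<^sup>2"
    using r by (intro order_tendstoD(2)) (auto simp: ennreal_power)
  thus "\<forall>\<^sub>F n in sequentially. ?y n < ennreal r"
  proof eventually_elim
    case (elim n)
    have "(?y n)\<^sup>2 \<le> (\<integral>\<^sup>+x. ennreal ((norm (Fs n x - F x))\<^sup>2) \<partial>M) * ?C"
      using Cauchy_Schwarz_nn_integral[of "\<lambda>x. ennreal (norm (Fs n x - F x))" M "\<lambda>x. ennreal \<bar>K x\<bar>"]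
      by (simp add: ennreal_mult ennreal_power)
    hence lt: "(?y n)\<^sup>2 < (ennreal r)\<^sup>2" using elim by (rule le_less_trans)
    show ?case
    proof (rule ccontr)
      assume "\<not> ?y n < ennreal r"
      hence "(ennreal r)\<^sup>2 \<le> (?y n)\<^sup>2" by (intro power_mono) auto
      thus False using lt by simp
    qed
  qed
qed

lemma (in prob_space) L2_tendsto_inner:
  fixes F K :: "'a \<Rightarrow> 'v::{real_inner, second_countable_topology, banach}"
  assumes [measurable]: "\<And>n. Fs n \<in> borel_measurable M" "F \<in> borel_measurable M" "K \<in> borel_measurable M"
    and Fs: "\<And>n. integrable M (\<lambda>x. (norm (Fs n x))\<^sup>2)"
    and K: "integrable M (\<lambda>x. (norm (K x))\<^sup>2)" and lim: "L2_tendsto M Fs F"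
  shows "(\<lambda>n. \<integral>x. Fs n x \<bullet> K x \<partial>M) \<longlonglongrightarrow> (\<integral>x. F x \<bullet> K x \<partial>M)"
proof (rule tendsto_L1_int)
  have F: "integrable M (\<lambda>x. (norm (F x))\<^sup>2)"
    by (rule L2_tendsto_integrable[OF _ _ Fs lim]) measurable
  show "integrable M (\<lambda>x. Fs n x \<bullet> K x)" for n by (rule integrable_inner_L2[OF _ _ Fs K]) measurable
  show "integrable M (\<lambda>x. F x \<bullet> K x)" by (rule integrable_inner_L2[OF _ _ F K]) measurable
  show "(\<lambda>n. \<integral>\<^sup>+x. ennreal (norm (Fs n x \<bullet> K x - F x \<bullet> K x)) \<partial>M) \<longlonglongrightarrow> 0"
  proof (rule tendsto_sandwich[OF _ _ tendsto_const])
    show "(\<lambda>n. \<integral>\<^sup>+x. ennreal (norm (Fs n x - F x) * \<bar>norm (K x)\<bar>) \<partial>M) \<longlonglongrightarrow> 0"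
      using K lim by (intro L2_tendsto_L1_mult) auto
    show "\<forall>\<^sub>F n in sequentially. (\<integral>\<^sup>+x. ennreal (norm (Fs n x \<bullet> K x - F x \<bullet> K x)) \<partial>M)
        \<le> (\<integral>\<^sup>+x. ennreal (norm (Fs n x - F x) * \<bar>norm (K x)\<bar>) \<partial>M)"
      by (intro always_eventually allI nn_integral_mono ennreal_leI)
        (simp add: Cauchy_Schwarz_ineq2 flip: inner_diff_left)
  qed simp
qed

text \<open>The squared distances tend to 0 in L1, and a subsequence of them tends to 0 almost
  everywhere.\<close>

lemma L2_tendsto_AE_subseq:
  fixes F :: "'a \<Rightarrow> 'v::{real_normed_vector, second_countable_topology}"
  assumes [measurable]: "\<And>n. Fs n \<in> borel_measurable M" "F \<in> borel_measurable M"
    and Fs: "\<And>n. integrable M (\<lambda>x. (norm (Fs n x))\<^sup>2)" and lim: "L2_tendsto M Fs F"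
  shows "\<exists>r::nat\<Rightarrow>nat. strict_mono r \<and> (AE x in M. (\<lambda>n. Fs (r n) x) \<longlonglongrightarrow> F x)"
proof -
  have F: "integrable M (\<lambda>x. (norm (F x))\<^sup>2)"
    by (rule L2_tendsto_integrable[OF _ _ Fs lim]) measurable
  have d: "integrable M (\<lambda>\<omega>. (norm (Fs n \<omega> - F \<omega>))\<^sup>2)" for n
  proof (rule Bochner_Integration.integrable_bound)
    show "integrable M (\<lambda>\<omega>. 2 * (norm (Fs n \<omega>))\<^sup>2 + 2 * (norm (F \<omega>))\<^sup>2)"
      using F Fs by simp
    show "AE x in M. norm ((norm (Fs n x - F x))\<^sup>2) \<le> norm (2 * (norm (Fs n x))\<^sup>2 + 2 * (norm (F x))\<^sup>2)"
    proof (rule AE_I2)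
      fix x
      have "(norm (Fs n x - F x))\<^sup>2 \<le> (norm (Fs n x) + norm (F x))\<^sup>2"
        by (rule power_mono[OF norm_triangle_ineq4]) simp
      also have "\<dots> \<le> 2 * (norm (Fs n x))\<^sup>2 + 2 * (norm (F x))\<^sup>2"
        using sum_squares_bound[of "norm (Fs n x)" "norm (F x)"] by (simp add: power2_sum)
      finally show "norm ((norm (Fs n x - F x))\<^sup>2) \<le> norm (2 * (norm (Fs n x))\<^sup>2 + 2 * (norm (F x))\<^sup>2)" by simp
    qed
  qed measurable
  have "(\<lambda>n. \<integral>x. norm ((norm (Fs n x - F x))\<^sup>2) \<partial>M) \<longlonglongrightarrow> 0"
  proof -
    have "(\<integral>\<^sup>+\<omega>. ennreal ((norm (Fs n \<omega> - F \<omega>))\<^sup>2) \<partial>M) = ennreal (\<integral>x. norm ((norm (Fs n x - F x))\<^sup>2) \<partial>M)" for n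
      using nn_integral_eq_integral[OF d[of n]] by simp
    hence "(\<lambda>n. ennreal (\<integral>x. norm ((norm (Fs n x - F x))\<^sup>2) \<partial>M)) \<longlonglongrightarrow> ennreal 0"
      using lim unfolding L2_tendsto_def by simp
    thus ?thesis by (subst (asm) tendsto_ennreal_iff) auto
  qed
  from tendsto_L1_AE_subseq[OF d this] obtain r where r: "strict_mono r"
    "AE x in M. (\<lambda>n. (norm (Fs (r n) x - F x))\<^sup>2) \<longlonglongrightarrow> 0" by auto
  have "AE x in M. (\<lambda>n. Fs (r n) x) \<longlonglongrightarrow> F x"
    using r(2)
  proof eventually_elim
    case (elim x)
    hence "(\<lambda>n. sqrt ((norm (Fs (r n) x - F x))\<^sup>2)) \<longlonglongrightarrow> sqrt 0" by (rule tendsto_real_sqrt)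
    hence "(\<lambda>n. norm (Fs (r n) x - F x)) \<longlonglongrightarrow> 0" by simp
    thus ?case by (simp add: tendsto_norm_zero_iff LIM_zero_iff)
  qed
  thus ?thesis using r(1) by blast
qed

section \<open>Composition of cylindrical variables\<close>

lemma sum_lessThan_add: "(\<Sum>i<m + n. f i) = (\<Sum>i<m. f i) + (\<Sum>i<n. f (m + i))"
  for f :: "nat \<Rightarrow> 'b::comm_monoid_add"
  by (induction n) (simp_all add: add.assoc)

text \<open>\<open>s1\<close> and \<open>s2\<close> are the two partial derivatives of
  \<open>s\<close>. They are specified by the chain rule along curves, and smoothness by stability
  of \<open>smooth_gen\<close>, because composites are only ever differentiated in one coordinate at
  a time.\<close>

definition smooth_binary ::
  "(real \<Rightarrow> real \<Rightarrow> real) \<Rightarrow> (real \<Rightarrow> real \<Rightarrow> real) \<Rightarrow> (real \<Rightarrow> real \<Rightarrow> real) \<Rightarrow> bool" where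
  "smooth_binary s s1 s2 \<longleftrightarrow>
     (\<forall>N a b. smooth_gen N a \<longrightarrow> smooth_gen N b \<longrightarrow> smooth_gen N (\<lambda>x. s (a x) (b x))) \<and>
     (\<forall>a b a' b' t. (a has_real_derivative a') (at t) \<longrightarrow> (b has_real_derivative b') (at t) \<longrightarrow>
       ((\<lambda>t. s (a t) (b t)) has_real_derivative s1 (a t) (b t) * a' + s2 (a t) (b t) * b') (at t))"

text \<open>The two variables may be built from unrelated vectors. Their representations are put on
  disjoint blocks of coordinates, the first \<open>m\<close> and the following \<open>n\<close>, so
  each coordinate moves only one argument of \<open>s\<close>, and the derivative splits into one
  sum per block.\<close>

lemma compose2_cylinder:
  fixes h k :: "nat \<Rightarrow> 'h::real_inner" and X :: "'h \<Rightarrow> 'w \<Rightarrow> real" and m n :: nat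
  assumes f: "depends_below m f" "smooth_upto m f" and g: "depends_below n g" "smooth_upto n g"
    and s: "smooth_binary s s1 s2"
  defines "F \<equiv> \<lambda>x. s (f x) (g (\<lambda>i. x (i + m)))"
    and "H \<equiv> \<lambda>i. if i < m then h i else k (i - m)"
  shows "depends_below (m + n) F" "smooth_upto (m + n) F"
    and "\<And>i x. i < m \<Longrightarrow> partial_deriv i F x = s1 (f x) (g (\<lambda>i. x (i + m))) * partial_deriv i f x"
    and "\<And>j x. j < n \<Longrightarrow> partial_deriv (m + j) F x =
            s2 (f x) (g (\<lambda>i. x (i + m))) * partial_deriv j g (\<lambda>i. x (i + m))"
    and "F (\<lambda>i. X (H i) \<omega>) = s (f (\<lambda>i. X (h i) \<omega>)) (g (\<lambda>i. X (k i) \<omega>))"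
    and "(\<Sum>i<m + n. partial_deriv i F (\<lambda>i. X (H i) \<omega>) *\<^sub>R H i) =
      s1 (f (\<lambda>i. X (h i) \<omega>)) (g (\<lambda>i. X (k i) \<omega>)) *\<^sub>R (\<Sum>i<m. partial_deriv i f (\<lambda>i. X (h i) \<omega>) *\<^sub>R h i) +
      s2 (f (\<lambda>i. X (h i) \<omega>)) (g (\<lambda>i. X (k i) \<omega>)) *\<^sub>R (\<Sum>i<n. partial_deriv i g (\<lambda>i. X (k i) \<omega>) *\<^sub>R k i)"
proof -
  have smooth: "smooth_gen N a \<Longrightarrow> smooth_gen N b \<Longrightarrow> smooth_gen N (\<lambda>x. s (a x) (b x))" for N a b
    using s unfolding smooth_binary_def by blast
  have deriv: "((\<lambda>t. s (a t) (b t)) has_real_derivative s1 (a t) (b t) * a' + s2 (a t) (b t) * b') (at t)"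
    if "(a has_real_derivative a') (at t)" "(b has_real_derivative b') (at t)" for a b a' b' t
    using s that unfolding smooth_binary_def by blast
  show "depends_below (m + n) F"
    unfolding depends_below_def
  proof (intro allI impI)
    fix x y :: "nat \<Rightarrow> real" assume *: "\<forall>i<m + n. x i = y i"
    have "f x = f y" using * by (intro f(1)[unfolded depends_below_def, rule_format]) simp
    moreover have "g (\<lambda>i. x (i + m)) = g (\<lambda>i. y (i + m))"
      using * by (intro g(1)[unfolded depends_below_def, rule_format]) simp
    ultimately show "F x = F y" by (simp add: F_def)
  qed
  have gf: "smooth_gen (m + n) f" using smooth_gen.shift[OF f(2) f(1), of 0 "m + n"] by simp
  have gg: "smooth_gen (m + n) (\<lambda>x. g (\<lambda>i. x (i + m)))"
    by (rule smooth_gen.shift[OF g(2) g(1)]) simp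
  show "smooth_upto (m + n) F" unfolding F_def
    by (intro smooth_gen_imp_smooth_upto smooth gf gg)
  show p1: "partial_deriv i F x = s1 (f x) (g (\<lambda>i. x (i + m))) * partial_deriv i f x" if i: "i < m" for i x
  proof -
    have "(\<lambda>j. (x(i := t)) (j + m)) = (\<lambda>j. x (j + m))" for t using i by (auto simp: fun_eq_iff)
    hence "((\<lambda>t. g (\<lambda>j. (x(i := t)) (j + m))) has_real_derivative 0) (at (x i))" by simp
    from deriv[OF smooth_upto_DERIV[OF f(2) i, of x] this]
    show ?thesis unfolding partial_deriv_def F_def by (intro DERIV_imp_deriv) simp
  qed
  show p2: "partial_deriv (m + j) F x =
            s2 (f x) (g (\<lambda>i. x (i + m))) * partial_deriv j g (\<lambda>i. x (i + m))" if j: "j < n" for j x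
  proof -
    have e1: "f (x(m + j := t)) = f x" for t
      by (intro f(1)[unfolded depends_below_def, rule_format]) simp
    have d1: "((\<lambda>t. f (x(m + j := t))) has_real_derivative 0) (at (x (m + j)))" unfolding e1 by simp
    have e2: "(\<lambda>i. (x(m + j := t)) (i + m)) = (\<lambda>i. x (i + m))(j := t)" for t by (auto simp: fun_eq_iff)
    have d2: "((\<lambda>t. g (\<lambda>i. (x(m + j := t)) (i + m))) has_real_derivative partial_deriv j g (\<lambda>i. x (i + m))) (at (x (m + j)))"
      unfolding e2 using smooth_upto_DERIV[OF g(2) j, of "\<lambda>i. x (i + m)"] by (simp add: add.commute)
    from deriv[OF d1 d2] show ?thesis
      unfolding F_def partial_deriv_def[of "m + j" "\<lambda>x. s (f x) (g (\<lambda>i. x (i + m)))"]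
      by (intro DERIV_imp_deriv) simp
  qed
  have Hf: "q (\<lambda>i. X (H i) \<omega>) = q (\<lambda>i. X (h i) \<omega>)" if "depends_below m q" for q
    by (intro that[unfolded depends_below_def, rule_format]) (simp add: H_def)
  have Hg: "(\<lambda>i. X (H (i + m)) \<omega>) = (\<lambda>i. X (k i) \<omega>)" by (simp add: H_def)
  show "F (\<lambda>i. X (H i) \<omega>) = s (f (\<lambda>i. X (h i) \<omega>)) (g (\<lambda>i. X (k i) \<omega>))"
    unfolding F_def Hf[OF f(1)] Hg ..
  have "(\<Sum>i<m. partial_deriv i F (\<lambda>i. X (H i) \<omega>) *\<^sub>R H i) =
      (\<Sum>i<m. s1 (f (\<lambda>i. X (h i) \<omega>)) (g (\<lambda>i. X (k i) \<omega>)) *\<^sub>R (partial_deriv i f (\<lambda>i. X (h i) \<omega>) *\<^sub>R h i))"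
    by (intro sum.cong refl) (simp add: p1 Hg Hf[OF f(1)] Hf[OF depends_below_partial_deriv[OF f(1)]], simp add: H_def)
  moreover have "(\<Sum>j<n. partial_deriv (m + j) F (\<lambda>i. X (H i) \<omega>) *\<^sub>R H (m + j)) =
      (\<Sum>i<n. s2 (f (\<lambda>i. X (h i) \<omega>)) (g (\<lambda>i. X (k i) \<omega>)) *\<^sub>R (partial_deriv i g (\<lambda>i. X (k i) \<omega>) *\<^sub>R k i))"
    by (intro sum.cong refl) (simp add: p2 Hg Hf[OF f(1)], simp add: H_def)
  ultimately show "(\<Sum>i<m + n. partial_deriv i F (\<lambda>i. X (H i) \<omega>) *\<^sub>R H i) =
      s1 (f (\<lambda>i. X (h i) \<omega>)) (g (\<lambda>i. X (k i) \<omega>)) *\<^sub>R (\<Sum>i<m. partial_deriv i f (\<lambda>i. X (h i) \<omega>) *\<^sub>R h i) +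
      s2 (f (\<lambda>i. X (h i) \<omega>)) (g (\<lambda>i. X (k i) \<omega>)) *\<^sub>R (\<Sum>i<n. partial_deriv i g (\<lambda>i. X (k i) \<omega>) *\<^sub>R k i)"
    unfolding sum_lessThan_add scaleR_sum_right by simp
qed

text \<open>On the joined coordinates the support is still compact, since a large coordinate in
  either block annihilates one factor. A sum over the two blocks would not have this
  property.\<close>

lemma smooth_cylindrical_mult:
  assumes A: "smooth_cylindrical X A \<Gamma>A" and B: "smooth_cylindrical X B \<Gamma>B"
  shows "smooth_cylindrical X (\<lambda>\<omega>. A \<omega> * B \<omega>) (\<lambda>\<omega>. B \<omega> *\<^sub>R \<Gamma>A \<omega> + A \<omega> *\<^sub>R \<Gamma>B \<omega>)"
proof -
  obtain m f h where m: "m \<ge> 1" and f: "smooth_compact_support m f" and A: "A = (\<lambda>\<omega>. f (\<lambda>i. X (h i) \<omega>))"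
    and \<Gamma>A: "\<Gamma>A = (\<lambda>\<omega>. \<Sum>i<m. partial_deriv i f (\<lambda>i. X (h i) \<omega>) *\<^sub>R h i)"
    using A unfolding smooth_cylindrical_def by blast
  obtain n g k where n: "n \<ge> 1" and g: "smooth_compact_support n g" and B: "B = (\<lambda>\<omega>. g (\<lambda>i. X (k i) \<omega>))"
    and \<Gamma>B: "\<Gamma>B = (\<lambda>\<omega>. \<Sum>i<n. partial_deriv i g (\<lambda>i. X (k i) \<omega>) *\<^sub>R k i)"
    using B unfolding smooth_cylindrical_def by blast
  have fd: "depends_below m f" "smooth_upto m f" and gd: "depends_below n g" "smooth_upto n g"
    using f g by (auto simp: smooth_compact_support_iff)
  obtain R where R: "\<And>x. \<exists>i<m. R < \<bar>x i\<bar> \<Longrightarrow> f x = 0"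
    using f unfolding smooth_compact_support_iff by blast
  obtain R' where R': "\<And>x. \<exists>i<n. R' < \<bar>x i\<bar> \<Longrightarrow> g x = 0"
    using g unfolding smooth_compact_support_iff by blast
  have d: "((\<lambda>t. a t * b t) has_real_derivative b t * a' + a t * b') (at t)"
    if "(a has_real_derivative a') (at t)" "(b has_real_derivative b') (at t)" for a b a' b' t
    using DERIV_mult[OF that] by (simp add: mult.commute)
  have sb: "smooth_binary (\<lambda>a b. a * b) (\<lambda>a b. b) (\<lambda>a b. a)"
    unfolding smooth_binary_def by (intro conjI allI impI smooth_gen.mult d)
  note c = compose2_cylinder[OF fd gd sb]
  let ?F = "\<lambda>x. f x * g (\<lambda>i. x (i + m))"
  have "smooth_compact_support (m + n) ?F"
    unfolding smooth_compact_support_iff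
  proof (intro conjI exI[of _ "max R R'"] allI impI)
    show "depends_below (m + n) ?F" by (rule c(1))
    show "smooth_upto (m + n) ?F" by (rule c(2))
    fix x assume "\<exists>i<m + n. max R R' < \<bar>x i\<bar>"
    then obtain i where i: "i < m + n" "R < \<bar>x i\<bar>" "R' < \<bar>x i\<bar>" by auto
    show "?F x = 0"
    proof (cases "i < m")
      case True thus ?thesis using R[of x] i by auto
    next
      case False
      hence "\<exists>j<n. R' < \<bar>x (j + m)\<bar>" using i by (intro exI[of _ "i - m"]) auto
      thus ?thesis using R'[of "\<lambda>i. x (i + m)"] by simp
    qed
  qed
  moreover have "m + n \<ge> 1" using m by simp
  ultimately show ?thesis
    unfolding smooth_cylindrical_def A B \<Gamma>A \<Gamma>B
    by (intro exI[of _ "m + n"] exI[of _ ?F] exI[of _ "\<lambda>i. if i < m then h i else k (i - m)"] conjI ext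
        c(5)[where h=h and k=k, symmetric] c(6)[where h=h and k=k, symmetric])
qed

section \<open>Integration by parts in the domain of D and independence of the chosen
  derivative\<close>

context isonormal
begin

lemma smooth_cylindrical_bounded:
  assumes "smooth_cylindrical X G \<Gamma>"
  shows "G \<in> borel_measurable M" "\<Gamma> \<in> borel_measurable M"
    "\<exists>B\<ge>0. \<forall>\<omega>. \<bar>G \<omega>\<bar> \<le> B \<and> norm (\<Gamma> \<omega>) \<le> B"
proof -
  obtain m f h where f: "smooth_compact_support m f" and G: "G = (\<lambda>\<omega>. f (\<lambda>i. X (h i) \<omega>))"
    and \<Gamma>: "\<Gamma> = (\<lambda>\<omega>. \<Sum>i<m. partial_deriv i f (\<lambda>i. X (h i) \<omega>) *\<^sub>R h i)"
    using assms unfolding smooth_cylindrical_def by blast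
  note f1 = smooth_compact_support_imp_C1[OF f]
  show "G \<in> borel_measurable M" "\<Gamma> \<in> borel_measurable M"
    unfolding G \<Gamma> using f1 unfolding C1_compact_support_def
    by (auto intro!: measurable_cylinder borel_measurable_sum borel_measurable_scaleR)
  obtain B where B: "B \<ge> 0" "\<And>x. \<bar>f x\<bar> \<le> B" "\<And>i x. i < m \<Longrightarrow> \<bar>partial_deriv i f x\<bar> \<le> B"
    using C1_compact_support_bounds[OF f1] by blast
  define S where "S = (\<Sum>i<m. norm (h i))"
  have S: "S \<ge> 0" unfolding S_def by (intro sum_nonneg) auto
  have 1: "norm (\<Gamma> \<omega>) \<le> B * S" for \<omega>
  proof -
    have "norm (\<Gamma> \<omega>) \<le> (\<Sum>i<m. norm (partial_deriv i f (\<lambda>i. X (h i) \<omega>) *\<^sub>R h i))"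
      unfolding \<Gamma> by (rule norm_sum)
    also have "\<dots> \<le> (\<Sum>i<m. B * norm (h i))"
      unfolding norm_scaleR by (intro sum_mono mult_right_mono B) auto
    finally show ?thesis by (simp add: S_def sum_distrib_left)
  qed
  show "\<exists>B\<ge>0. \<forall>\<omega>. \<bar>G \<omega>\<bar> \<le> B \<and> norm (\<Gamma> \<omega>) \<le> B"
  proof (intro exI[of _ "B + B * S"] conjI allI)
    show "0 \<le> B + B * S" using B(1) S by simp
    show "\<bar>G \<omega>\<bar> \<le> B + B * S" for \<omega> unfolding G using B(1) B(2)[of "\<lambda>i. X (h i) \<omega>"] mult_nonneg_nonneg[OF B(1) S] by linarith
    show "norm (\<Gamma> \<omega>) \<le> B + B * S" for \<omega> using 1[of \<omega>] B(1) by simp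
  qed
qed

lemma smooth_cylindrical_L2:
  assumes "smooth_cylindrical X G \<Gamma>"
  shows "integrable M (\<lambda>\<omega>. (norm (G \<omega>))\<^sup>2)" "integrable M (\<lambda>\<omega>. (norm (\<Gamma> \<omega>))\<^sup>2)"
proof -
  note [measurable] = smooth_cylindrical_bounded(1,2)[OF assms]
  obtain B where B: "\<And>\<omega>. \<bar>G \<omega>\<bar> \<le> B" "\<And>\<omega>. norm (\<Gamma> \<omega>) \<le> B"
    using smooth_cylindrical_bounded(3)[OF assms] by blast
  show "integrable M (\<lambda>\<omega>. (norm (G \<omega>))\<^sup>2)"
    by (rule integrable_const_bound[of _ "B\<^sup>2"]) (use B(1) in \<open>auto simp: abs_le_square_iff[symmetric] intro!: AE_I2 order_trans[OF _ abs_ge_self]\<close>)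
  show "integrable M (\<lambda>\<omega>. (norm (\<Gamma> \<omega>))\<^sup>2)"
    by (rule integrable_const_bound[of _ "B\<^sup>2"]) (use B(2) in \<open>auto intro!: AE_I2 power_mono\<close>)
qed

lemma smooth_cylindrical_ibp:
  assumes "smooth_cylindrical X G \<Gamma>"
  shows "(\<integral>\<omega>. G \<omega> * X v \<omega> \<partial>M) = (\<integral>\<omega>. \<Gamma> \<omega> \<bullet> v \<partial>M)"
  using assms gaussian_ibp[OF smooth_compact_support_imp_C1, of _ _ _ v] unfolding smooth_cylindrical_def
  by blast

text \<open>Apply integration by parts to the product of \<open>H\<close> with a cylindrical
  approximation of \<open>G\<close> and pass to the limit in L2. The right-hand side contains
  \<open>G\<close> but not \<Gamma>, so it determines how every derivative of \<open>G\<close> pairs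
  with the field H v; this is the source of uniqueness.\<close>

lemma malliavin_ibp:
  assumes D: "has_malliavin_derivative M X G \<Gamma>" and H: "smooth_cylindrical X H \<Gamma>H"
  shows "(\<integral>\<omega>. \<Gamma> \<omega> \<bullet> (H \<omega> *\<^sub>R v) \<partial>M) = (\<integral>\<omega>. G \<omega> * (H \<omega> * X v \<omega> - \<Gamma>H \<omega> \<bullet> v) \<partial>M)"
proof -
  obtain Gs \<Gamma>s where s: "\<And>n. smooth_cylindrical X (Gs n) (\<Gamma>s n)" and
    lim: "L2_tendsto M Gs G" "L2_tendsto M \<Gamma>s \<Gamma>" and [measurable]: "G \<in> borel_measurable M" "\<Gamma> \<in> borel_measurable M"
    using D unfolding has_malliavin_derivative_def by blast
  note [measurable] = smooth_cylindrical_bounded(1,2)[OF s] smooth_cylindrical_bounded(1,2)[OF H]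
  obtain B where B: "B \<ge> 0" "\<And>\<omega>. \<bar>H \<omega>\<bar> \<le> B" "\<And>\<omega>. norm (\<Gamma>H \<omega>) \<le> B"
    using smooth_cylindrical_bounded(3)[OF H] by blast
  have i1: "integrable M (\<lambda>\<omega>. (norm (H \<omega> *\<^sub>R v))\<^sup>2)"
    using Bochner_Integration.integrable_mult_left[OF smooth_cylindrical_L2(1)[OF H], of "(norm v)\<^sup>2"]
    by (simp add: power_mult_distrib)
  have iHX: "integrable M (\<lambda>\<omega>. (norm (H \<omega> * X v \<omega>))\<^sup>2)"
  proof (rule Bochner_Integration.integrable_bound[where f="\<lambda>\<omega>. B\<^sup>2 * (X v \<omega>)\<^sup>2"])
    show "integrable M (\<lambda>\<omega>. B\<^sup>2 * (X v \<omega>)\<^sup>2)" using X_sq_integrable by simp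
    have "(\<bar>H \<omega>\<bar>)\<^sup>2 \<le> B\<^sup>2" for \<omega> by (rule power_mono[OF B(2)]) simp
    thus "AE \<omega> in M. norm ((norm (H \<omega> * X v \<omega>))\<^sup>2) \<le> norm (B\<^sup>2 * (X v \<omega>)\<^sup>2)"
      by (auto simp: power_mult_distrib abs_mult intro!: mult_right_mono)
  qed measurable
  have iv: "integrable M (\<lambda>\<omega>. (norm (\<Gamma>H \<omega> \<bullet> v))\<^sup>2)"
  proof (rule integrable_const_bound[of _ "(B * norm v)\<^sup>2"])
    have "\<bar>\<Gamma>H \<omega> \<bullet> v\<bar> \<le> B * norm v" for \<omega>
      by (rule order_trans[OF Cauchy_Schwarz_ineq2 mult_right_mono[OF B(3)]]) simp
    hence "\<bar>\<Gamma>H \<omega> \<bullet> v\<bar>\<^sup>2 \<le> (B * norm v)\<^sup>2" for \<omega> by (rule power_mono) simp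
    thus "AE x in M. norm ((norm (\<Gamma>H x \<bullet> v))\<^sup>2) \<le> (B * norm v)\<^sup>2" by simp
  qed measurable
  have i2: "integrable M (\<lambda>\<omega>. (norm (H \<omega> * X v \<omega> - \<Gamma>H \<omega> \<bullet> v))\<^sup>2)"
  proof (rule Bochner_Integration.integrable_bound)
    show "integrable M (\<lambda>\<omega>. 2 * (norm (H \<omega> * X v \<omega>))\<^sup>2 + 2 * (norm (\<Gamma>H \<omega> \<bullet> v))\<^sup>2)"
      by (intro Bochner_Integration.integrable_add Bochner_Integration.integrable_mult_right iHX iv)
    have "(a - b)\<^sup>2 \<le> 2 * a\<^sup>2 + 2 * b\<^sup>2" for a b :: real
      using sum_squares_bound[of a "- b"] by (simp add: power2_diff)
    thus "AE \<omega> in M. norm ((norm (H \<omega> * X v \<omega> - \<Gamma>H \<omega> \<bullet> v))\<^sup>2)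
      \<le> norm (2 * (norm (H \<omega> * X v \<omega>))\<^sup>2 + 2 * (norm (\<Gamma>H \<omega> \<bullet> v))\<^sup>2)" by simp
  qed measurable
  have eq: "(\<integral>\<omega>. \<Gamma>s n \<omega> \<bullet> (H \<omega> *\<^sub>R v) \<partial>M) = (\<integral>\<omega>. Gs n \<omega> \<bullet> (H \<omega> * X v \<omega> - \<Gamma>H \<omega> \<bullet> v) \<partial>M)" for n
  proof -
    have "(\<integral>\<omega>. Gs n \<omega> * H \<omega> * X v \<omega> \<partial>M) = (\<integral>\<omega>. (H \<omega> *\<^sub>R \<Gamma>s n \<omega> + Gs n \<omega> *\<^sub>R \<Gamma>H \<omega>) \<bullet> v \<partial>M)"
      by (rule smooth_cylindrical_ibp[OF smooth_cylindrical_mult[OF s H]])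
    also have "\<dots> = (\<integral>\<omega>. \<Gamma>s n \<omega> \<bullet> (H \<omega> *\<^sub>R v) + Gs n \<omega> \<bullet> (\<Gamma>H \<omega> \<bullet> v) \<partial>M)"
      by (simp add: inner_add_left)
    also have "\<dots> = (\<integral>\<omega>. \<Gamma>s n \<omega> \<bullet> (H \<omega> *\<^sub>R v) \<partial>M) + (\<integral>\<omega>. Gs n \<omega> \<bullet> (\<Gamma>H \<omega> \<bullet> v) \<partial>M)"
      by (intro Bochner_Integration.integral_add integrable_inner_L2 i1 iv smooth_cylindrical_L2[OF s]) measurable
    finally have e: "(\<integral>\<omega>. Gs n \<omega> \<bullet> (H \<omega> * X v \<omega>) \<partial>M) = (\<integral>\<omega>. \<Gamma>s n \<omega> \<bullet> (H \<omega> *\<^sub>R v) \<partial>M) + (\<integral>\<omega>. Gs n \<omega> \<bullet> (\<Gamma>H \<omega> \<bullet> v) \<partial>M)"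
      by (simp add: mult.assoc)
    have "(\<integral>\<omega>. Gs n \<omega> \<bullet> (H \<omega> * X v \<omega> - \<Gamma>H \<omega> \<bullet> v) \<partial>M) =
       (\<integral>\<omega>. Gs n \<omega> \<bullet> (H \<omega> * X v \<omega>) \<partial>M) - (\<integral>\<omega>. Gs n \<omega> \<bullet> (\<Gamma>H \<omega> \<bullet> v) \<partial>M)"
      unfolding inner_diff_right
      by (intro Bochner_Integration.integral_diff integrable_inner_L2 iHX iv smooth_cylindrical_L2[OF s]) measurable
    thus ?thesis using e by simp
  qed
  have "(\<lambda>n. \<integral>\<omega>. \<Gamma>s n \<omega> \<bullet> (H \<omega> *\<^sub>R v) \<partial>M) \<longlonglongrightarrow> (\<integral>\<omega>. \<Gamma> \<omega> \<bullet> (H \<omega> *\<^sub>R v) \<partial>M)"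
    by (rule L2_tendsto_inner[OF _ _ _ smooth_cylindrical_L2(2)[OF s] i1 lim(2)]) measurable
  moreover have "(\<lambda>n. \<integral>\<omega>. Gs n \<omega> \<bullet> (H \<omega> * X v \<omega> - \<Gamma>H \<omega> \<bullet> v) \<partial>M) \<longlonglongrightarrow> (\<integral>\<omega>. G \<omega> \<bullet> (H \<omega> * X v \<omega> - \<Gamma>H \<omega> \<bullet> v) \<partial>M)"
    by (rule L2_tendsto_inner[OF _ _ _ smooth_cylindrical_L2(1)[OF s] i2 lim(1)]) measurable
  ultimately have "(\<integral>\<omega>. \<Gamma> \<omega> \<bullet> (H \<omega> *\<^sub>R v) \<partial>M) = (\<integral>\<omega>. G \<omega> \<bullet> (H \<omega> * X v \<omega> - \<Gamma>H \<omega> \<bullet> v) \<partial>M)"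
    unfolding eq by (rule LIMSEQ_unique)
  thus ?thesis by simp
qed

lemma malliavin_derivative_L2:
  assumes "has_malliavin_derivative M X G \<Gamma>"
  shows "G \<in> borel_measurable M" "\<Gamma> \<in> borel_measurable M"
    "integrable M (\<lambda>\<omega>. (norm (G \<omega>))\<^sup>2)" "integrable M (\<lambda>\<omega>. (norm (\<Gamma> \<omega>))\<^sup>2)"
proof -
  obtain Gs \<Gamma>s where s: "\<And>n. smooth_cylindrical X (Gs n) (\<Gamma>s n)" and
    lim: "L2_tendsto M Gs G" "L2_tendsto M \<Gamma>s \<Gamma>" and m: "G \<in> borel_measurable M" "\<Gamma> \<in> borel_measurable M"
    using assms unfolding has_malliavin_derivative_def by blast
  show "G \<in> borel_measurable M" "\<Gamma> \<in> borel_measurable M" by (rule m)+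
  show "integrable M (\<lambda>\<omega>. (norm (G \<omega>))\<^sup>2)"
    by (rule L2_tendsto_integrable[OF smooth_cylindrical_bounded(1)[OF s] m(1) smooth_cylindrical_L2(1)[OF s] lim(1)])
  show "integrable M (\<lambda>\<omega>. (norm (\<Gamma> \<omega>))\<^sup>2)"
    by (rule L2_tendsto_integrable[OF smooth_cylindrical_bounded(2)[OF s] m(2) smooth_cylindrical_L2(2)[OF s] lim(2)])
qed

lemma smooth_cylindrical_has_derivative:
  assumes "smooth_cylindrical X G \<Gamma>" shows "has_malliavin_derivative M X G \<Gamma>"
  unfolding has_malliavin_derivative_def L2_tendsto_def
  using assms smooth_cylindrical_bounded[OF assms]
  by (intro conjI exI[of _ "\<lambda>_. G"] exI[of _ "\<lambda>_. \<Gamma>"]) auto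

text \<open>\<open>malliavin_deriv\<close> is an arbitrary choice among the derivatives; its pairing with \<open>u\<close> does not
  depend on the choice.\<close>

lemma malliavin_derivative_inner_unique:
  fixes u :: "'w \<Rightarrow> 'h"
  assumes D: "has_malliavin_derivative M X G \<Gamma>" "has_malliavin_derivative M X G \<Gamma>'"
    and u: "u \<in> D12_vec M X" and u2: "integrable M (\<lambda>\<omega>. (norm (u \<omega>))\<^sup>2)"
  shows "(\<integral>\<omega>. \<Gamma> \<omega> \<bullet> u \<omega> \<partial>M) = (\<integral>\<omega>. \<Gamma>' \<omega> \<bullet> u \<omega> \<partial>M)"
proof -
  obtain Us As where U: "\<And>n. smooth_cylindrical_vec X (Us n) (As n)" and lim: "L2_tendsto M Us u"
    and [measurable]: "u \<in> borel_measurable M"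
    using u unfolding D12_vec_def by blast
  note [measurable] = malliavin_derivative_L2(1,2)[OF D(1)] malliavin_derivative_L2(2)[OF D(2)]
  note L2 = malliavin_derivative_L2(4)[OF D(1)] malliavin_derivative_L2(4)[OF D(2)]
  \<comment> \<open>For the cylindrical fields that approximate \<open>u\<close>, both pairings
    equal the right-hand side of \<open>malliavin_ibp\<close>, which is the same for \<Gamma> and
    \<open>\<Gamma>'\<close>.\<close>
  have Us: "Us n \<in> borel_measurable M \<and> integrable M (\<lambda>\<omega>. (norm (Us n \<omega>))\<^sup>2) \<and>
      (\<integral>\<omega>. Us n \<omega> \<bullet> \<Gamma> \<omega> \<partial>M) = (\<integral>\<omega>. Us n \<omega> \<bullet> \<Gamma>' \<omega> \<partial>M)" for n
  proof -
    obtain m :: nat and H \<Gamma>H v where "\<forall>j<m. smooth_cylindrical X (H j) (\<Gamma>H j)"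
      and Un: "Us n = (\<lambda>\<omega>. \<Sum>j<m. H j \<omega> *\<^sub>R v j)"
      using U[of n] unfolding smooth_cylindrical_vec_def by blast
    hence H: "\<And>j. j < m \<Longrightarrow> smooth_cylindrical X (H j) (\<Gamma>H j)" by blast
    have Hm[measurable]: "j < m \<Longrightarrow> H j \<in> borel_measurable M" for j
      using smooth_cylindrical_bounded(1)[OF H] .
    have Hi: "integrable M (\<lambda>\<omega>. (norm (H j \<omega> *\<^sub>R v j))\<^sup>2)" if "j < m" for j
      using Bochner_Integration.integrable_mult_left[OF smooth_cylindrical_L2(1)[OF H[OF that]], of "(norm (v j))\<^sup>2"]
      by (simp add: power_mult_distrib)
    have meas: "Us n \<in> borel_measurable M" unfolding Un
      by (intro borel_measurable_sum borel_measurable_scaleR Hm) auto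
    obtain C where C: "\<And>j \<omega>. j < m \<Longrightarrow> \<bar>H j \<omega>\<bar> \<le> C j"
      using smooth_cylindrical_bounded(3)[OF H] by metis
    have "norm (Us n \<omega>) \<le> (\<Sum>j<m. C j * norm (v j))" for \<omega>
      unfolding Un by (rule order_trans[OF norm_sum], unfold norm_scaleR, intro sum_mono mult_right_mono C) auto
    hence "(norm (Us n \<omega>))\<^sup>2 \<le> (\<Sum>j<m. C j * norm (v j))\<^sup>2" for \<omega> by (rule power_mono) simp
    hence L2U: "integrable M (\<lambda>\<omega>. (norm (Us n \<omega>))\<^sup>2)"
      using meas by (intro integrable_const_bound[of _ "(\<Sum>j<m. C j * norm (v j))\<^sup>2"]) auto
    have sp: "(\<integral>\<omega>. Us n \<omega> \<bullet> K \<omega> \<partial>M) = (\<Sum>j<m. \<integral>\<omega>. K \<omega> \<bullet> (H j \<omega> *\<^sub>R v j) \<partial>M)"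
      if [measurable]: "K \<in> borel_measurable M" and K2: "integrable M (\<lambda>\<omega>. (norm (K \<omega>))\<^sup>2)" for K :: "'w \<Rightarrow> 'h"
    proof -
      have "(\<integral>\<omega>. Us n \<omega> \<bullet> K \<omega> \<partial>M) = (\<integral>\<omega>. (\<Sum>j<m. K \<omega> \<bullet> (H j \<omega> *\<^sub>R v j)) \<partial>M)"
        unfolding Un inner_sum_left by (simp add: inner_commute)
      also have "\<dots> = (\<Sum>j<m. \<integral>\<omega>. K \<omega> \<bullet> (H j \<omega> *\<^sub>R v j) \<partial>M)"
        using Hi Hm by (intro Bochner_Integration.integral_sum integrable_inner_L2 K2) auto
      finally show ?thesis .
    qed
    have "(\<integral>\<omega>. Us n \<omega> \<bullet> \<Gamma> \<omega> \<partial>M) = (\<integral>\<omega>. Us n \<omega> \<bullet> \<Gamma>' \<omega> \<partial>M)"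
      using sp[OF _ L2(1)] sp[OF _ L2(2)] malliavin_ibp[OF D(1) H] malliavin_ibp[OF D(2) H] by simp
    thus ?thesis using meas L2U by blast
  qed
  hence [measurable]: "\<And>n. Us n \<in> borel_measurable M" by blast
  have "(\<lambda>n. \<integral>\<omega>. Us n \<omega> \<bullet> \<Gamma> \<omega> \<partial>M) \<longlonglongrightarrow> (\<integral>\<omega>. u \<omega> \<bullet> \<Gamma> \<omega> \<partial>M)"
    using Us lim L2 by (intro L2_tendsto_inner) auto
  moreover have "(\<lambda>n. \<integral>\<omega>. Us n \<omega> \<bullet> \<Gamma>' \<omega> \<partial>M) \<longlonglongrightarrow> (\<integral>\<omega>. u \<omega> \<bullet> \<Gamma>' \<omega> \<partial>M)"
    using Us lim L2 by (intro L2_tendsto_inner) auto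
  ultimately have "(\<integral>\<omega>. u \<omega> \<bullet> \<Gamma> \<omega> \<partial>M) = (\<integral>\<omega>. u \<omega> \<bullet> \<Gamma>' \<omega> \<partial>M)"
    using Us LIMSEQ_unique by simp
  thus ?thesis by (simp add: inner_commute)
qed

text \<open>The adjoint relation is stated for the chosen derivative of \<open>G\<close>; uniqueness
  of the pairing replaces it by the explicit one.\<close>

lemma divergence_duality:
  assumes u: "u \<in> D12_vec M X" "has_divergence M X u Z" and G: "smooth_cylindrical X G \<Gamma>"
  shows "(\<integral>\<omega>. G \<omega> * Z \<omega> \<partial>M) = (\<integral>\<omega>. \<Gamma> \<omega> \<bullet> u \<omega> \<partial>M)"
proof -
  note D = smooth_cylindrical_has_derivative[OF G]
  have "G \<in> D12 M X" using D unfolding D12_def by blast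
  hence "(\<integral>\<omega>. G \<omega> * Z \<omega> \<partial>M) = (\<integral>\<omega>. malliavin_deriv M X G \<omega> \<bullet> u \<omega> \<partial>M)"
    using u(2) unfolding has_divergence_def by blast
  also have "\<dots> = (\<integral>\<omega>. \<Gamma> \<omega> \<bullet> u \<omega> \<partial>M)"
  proof (rule malliavin_derivative_inner_unique[OF _ D u(1)])
    show "has_malliavin_derivative M X G (malliavin_deriv M X G)"
      unfolding malliavin_deriv_def by (rule someI[of _ \<Gamma>]) (rule D)
    show "integrable M (\<lambda>\<omega>. (norm (u \<omega>))\<^sup>2)" using u(2) unfolding has_divergence_def by blast
  qed
  finally show ?thesis .
qed

end

section \<open>Duality for bounded cylindrical variables with bounded derivatives\<close>

text \<open>Unlike the smooth cylindrical variables, whose representing functions have compact support,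
  this class contains every \<open>X h\<close> and is closed under sums.\<close>

definition lipschitz_cylindrical ::
  "('h::real_inner \<Rightarrow> 'w \<Rightarrow> real) \<Rightarrow> ('w \<Rightarrow> real) \<Rightarrow> ('w \<Rightarrow> 'h) \<Rightarrow> bool" where
  "lipschitz_cylindrical X G \<Gamma> \<longleftrightarrow>
     (\<exists>n\<ge>1. \<exists>f h. depends_below n f \<and> smooth_upto n f \<and> (\<exists>B. \<forall>i<n. \<forall>x. \<bar>partial_deriv i f x\<bar> \<le> B) \<and>
        G = (\<lambda>\<omega>. f (\<lambda>i. X (h i) \<omega>)) \<and>
        \<Gamma> = (\<lambda>\<omega>. \<Sum>i<n. partial_deriv i f (\<lambda>i. X (h i) \<omega>) *\<^sub>R h i))"

lemma smooth_cylindrical_imp_lipschitz: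
  assumes "smooth_cylindrical X G \<Gamma>" shows "lipschitz_cylindrical X G \<Gamma>"
proof -
  obtain n f h where *: "n \<ge> 1" "smooth_compact_support n f" "G = (\<lambda>\<omega>. f (\<lambda>i. X (h i) \<omega>))"
    "\<Gamma> = (\<lambda>\<omega>. \<Sum>i<n. partial_deriv i f (\<lambda>i. X (h i) \<omega>) *\<^sub>R h i)"
    using assms unfolding smooth_cylindrical_def by blast
  obtain B where B: "B \<ge> 0" "\<And>x. \<bar>f x\<bar> \<le> B" "\<And>i x. i < n \<Longrightarrow> \<bar>partial_deriv i f x\<bar> \<le> B"
    using C1_compact_support_bounds[OF smooth_compact_support_imp_C1[OF *(2)]] by blast
  have f: "depends_below n f" "smooth_upto n f" using *(2) by (simp_all add: smooth_compact_support_iff)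
  show ?thesis unfolding lipschitz_cylindrical_def
    by (rule exI[of _ n], rule conjI, rule *(1), rule exI[of _ f], rule exI[of _ h], rule conjI, rule f(1),
        rule conjI, rule f(2), rule conjI, rule exI[of _ B], intro allI impI, erule B(3),
        rule conjI, rule *(3), rule *(4))
qed

lemma lipschitz_cylindrical_X: "lipschitz_cylindrical X (X h) (\<lambda>_. h)"
proof -
  have p: "partial_deriv 0 (\<lambda>x. x 0) x = 1" for x :: "nat \<Rightarrow> real"
    unfolding partial_deriv_def by (intro DERIV_imp_deriv) simp
  have a: "depends_below 1 (\<lambda>x. x 0)" by (simp add: depends_below_def)
  have b: "smooth_upto 1 (\<lambda>x. x 0)" by (rule smooth_gen_imp_smooth_upto[OF smooth_gen.coord])
  have c: "\<forall>i<1. \<forall>x. \<bar>partial_deriv i (\<lambda>x. x 0) x\<bar> \<le> 1" by (simp add: p)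
  have d: "(\<lambda>_. h) = (\<lambda>\<omega>. \<Sum>i<1. partial_deriv i (\<lambda>x. x 0) (\<lambda>i. X h \<omega>) *\<^sub>R h)" by (simp add: p)
  show ?thesis unfolding lipschitz_cylindrical_def
    by (rule exI[of _ "1::nat"], rule conjI, rule order_refl, rule exI[of _ "\<lambda>x::nat \<Rightarrow> real. x 0"],
        rule exI[of _ "\<lambda>_::nat. h"], rule conjI, rule a, rule conjI, rule b, rule conjI,
        rule exI[of _ "1::real"], rule c, rule conjI, rule refl, rule d)
qed

text \<open>The boundedness condition concerns the derivatives of \<open>s\<close>, so the
  composition covers sums as well as trigonometric functions; by the chain rule each partial
  derivative is bounded by \<open>C\<close> times the bound of its own block.\<close>

lemma lipschitz_cylindrical_compose2:
  assumes A: "lipschitz_cylindrical X A \<Gamma>A" and B: "lipschitz_cylindrical X B \<Gamma>B"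
    and s: "smooth_binary s s1 s2"
    and bound: "\<And>a b. \<bar>s1 a b\<bar> \<le> C" "\<And>a b. \<bar>s2 a b\<bar> \<le> C"
  shows "lipschitz_cylindrical X (\<lambda>\<omega>. s (A \<omega>) (B \<omega>))
    (\<lambda>\<omega>. s1 (A \<omega>) (B \<omega>) *\<^sub>R \<Gamma>A \<omega> + s2 (A \<omega>) (B \<omega>) *\<^sub>R \<Gamma>B \<omega>)"
proof -
  obtain m f h Bf where m: "m \<ge> 1" and f: "depends_below m f" "smooth_upto m f"
    "\<And>i x. i < m \<Longrightarrow> \<bar>partial_deriv i f x\<bar> \<le> Bf" and A: "A = (\<lambda>\<omega>. f (\<lambda>i. X (h i) \<omega>))"
    and \<Gamma>A: "\<Gamma>A = (\<lambda>\<omega>. \<Sum>i<m. partial_deriv i f (\<lambda>i. X (h i) \<omega>) *\<^sub>R h i)"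
    using A unfolding lipschitz_cylindrical_def by blast
  obtain n g k Bg where n: "n \<ge> 1" and g: "depends_below n g" "smooth_upto n g"
    "\<And>i x. i < n \<Longrightarrow> \<bar>partial_deriv i g x\<bar> \<le> Bg" and B: "B = (\<lambda>\<omega>. g (\<lambda>i. X (k i) \<omega>))"
    and \<Gamma>B: "\<Gamma>B = (\<lambda>\<omega>. \<Sum>i<n. partial_deriv i g (\<lambda>i. X (k i) \<omega>) *\<^sub>R k i)"
    using B unfolding lipschitz_cylindrical_def by blast
  note c = compose2_cylinder[OF f(1,2) g(1,2) s]
  let ?F = "\<lambda>x. s (f x) (g (\<lambda>i. x (i + m)))"
  have C0: "0 \<le> C" using bound(1)[of 0 0] by simp
  have "\<forall>i<m + n. \<forall>x. \<bar>partial_deriv i ?F x\<bar> \<le> max (C * Bf) (C * Bg)"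
  proof (intro allI impI)
    fix i x assume i: "i < m + n"
    show "\<bar>partial_deriv i ?F x\<bar> \<le> max (C * Bf) (C * Bg)"
    proof (cases "i < m")
      case True
      have "\<bar>partial_deriv i ?F x\<bar> \<le> C * Bf"
        unfolding c(3)[OF True] abs_mult by (intro mult_mono bound f(3) True C0) auto
      thus ?thesis by simp
    next
      case False
      then obtain j where j: "i = m + j" "j < n" using i by (metis add_diff_inverse_nat nat_add_left_cancel_less)
      have "\<bar>partial_deriv i ?F x\<bar> \<le> C * Bg"
        unfolding j(1) c(4)[OF j(2)] abs_mult by (intro mult_mono bound g(3) j(2) C0) auto
      thus ?thesis by simp
    qed
  qed
  moreover have "m + n \<ge> 1" using m by simp
  ultimately show ?thesis
    unfolding lipschitz_cylindrical_def A B \<Gamma>A \<Gamma>B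
    by (intro exI[of _ "m + n"] exI[of _ ?F] exI[of _ "\<lambda>i. if i < m then h i else k (i - m)"] conjI ext
        exI[of _ "max (C * Bf) (C * Bg)"] c(1) c(2)
        c(5)[where h=h and k=k, symmetric] c(6)[where h=h and k=k, symmetric])
qed

definition ball_cutoff :: "nat \<Rightarrow> real \<Rightarrow> (nat \<Rightarrow> real) \<Rightarrow> real" where
  "ball_cutoff n R x = exp 1 * flat_exp 0 (1 - (\<Sum>i<n. (x i)\<^sup>2) / R\<^sup>2)"

text \<open>The factor \<open>exp 1\<close> compensates the largest value exp (-1) of
  \<open>flat_exp 0\<close> on arguments up to 1, which is attained at the centre of the
  ball.\<close>

lemma ball_cutoff_bounds: "0 \<le> ball_cutoff n R x" "ball_cutoff n R x \<le> 1"
proof -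
  show "0 \<le> ball_cutoff n R x" by (simp add: ball_cutoff_def flat_exp_nonneg)
  have "flat_exp 0 y \<le> exp (-1)" if "y \<le> 1" for y
    using that by (auto simp: flat_exp_def field_simps)
  moreover have "1 - (\<Sum>i<n. (x i)\<^sup>2) / R\<^sup>2 \<le> 1" by (simp add: sum_nonneg)
  ultimately have "exp 1 * flat_exp 0 (1 - (\<Sum>i<n. (x i)\<^sup>2) / R\<^sup>2) \<le> exp 1 * exp (-1)"
    by (intro mult_left_mono) auto
  thus "ball_cutoff n R x \<le> 1" by (simp add: ball_cutoff_def flip: exp_add)
qed

lemma ball_cutoff_depends: "depends_below n (ball_cutoff n R)"
  unfolding depends_below_def ball_cutoff_def
  by (intro allI impI arg_cong2[where f="(*)"] refl arg_cong[where f="flat_exp 0"]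
      arg_cong2[where f="(-)"] arg_cong2[where f="(/)"] sum.cong) auto

lemma ball_cutoff_eq_0:
  assumes "i < n" "R < \<bar>x i\<bar>" "0 < R" shows "ball_cutoff n R x = 0"
proof -
  have "R\<^sup>2 < \<bar>x i\<bar>\<^sup>2" using assms by (intro power_strict_mono) auto
  also have "\<bar>x i\<bar>\<^sup>2 \<le> (\<Sum>i<n. (x i)\<^sup>2)" using assms by (simp, intro member_le_sum) auto
  finally have "1 \<le> (\<Sum>i<n. (x i)\<^sup>2) / R\<^sup>2" using assms by (simp add: le_divide_eq)
  thus ?thesis by (simp add: ball_cutoff_def flat_exp_def)
qed

lemma smooth_gen_ball_cutoff: "smooth_gen N (ball_cutoff n R)"
proof -
  have s: "smooth_gen N (\<lambda>x. \<Sum>i<n. x i * x i)"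
  proof (induction n)
    case 0 show ?case by (simp add: smooth_gen.const)
  next
    case (Suc n)
    from smooth_gen.add[OF Suc smooth_gen.mult[OF smooth_gen.coord smooth_gen.coord, of _ n n]]
    show ?case by simp
  qed
  have "smooth_gen N (\<lambda>x. exp 1 * flat_exp 0 (1 + (- 1 / R\<^sup>2) * (\<Sum>i<n. x i * x i)))"
    by (intro smooth_gen.mult smooth_gen.flat smooth_gen.add smooth_gen.const s)
  moreover have "(\<lambda>x. exp 1 * flat_exp 0 (1 + (- 1 / R\<^sup>2) * (\<Sum>i<n. x i * x i))) = ball_cutoff n R"
    by (simp add: ball_cutoff_def fun_eq_iff power2_eq_square)
  ultimately show ?thesis by simp
qed

lemma partial_deriv_ball_cutoff:
  assumes i: "i < n"
  shows "partial_deriv i (ball_cutoff n R) x =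
    exp 1 * (flat_exp 2 (1 - (\<Sum>i<n. (x i)\<^sup>2) / R\<^sup>2) * (- 2 * x i / R\<^sup>2))"
proof -
  have sum: "(\<Sum>j<n. ((x(i := t)) j)\<^sup>2) = t\<^sup>2 + (\<Sum>j\<in>{..<n} - {i}. (x j)\<^sup>2)" for t
    using i by (subst sum.remove[of _ i]) (auto intro!: sum.cong)
  have "((\<lambda>t. 1 - (\<Sum>j<n. ((x(i := t)) j)\<^sup>2) / R\<^sup>2) has_real_derivative (- 2 * x i / R\<^sup>2)) (at (x i))"
    unfolding sum divide_inverse by (auto intro!: derivative_eq_intros)
  from DERIV_cmult[OF DERIV_chain2[OF DERIV_flat_exp[of 0] this], of "exp 1"]
  show ?thesis unfolding partial_deriv_def ball_cutoff_def
    by (intro DERIV_imp_deriv) (simp add: numeral_2_eq_2)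
qed

text \<open>What matters is uniformity in R, which dominates the derivatives of all cutoffs at once.
  The 4 bounds \<open>flat_exp 2\<close>, the 2 bounds 2 |x_i| / R^2 while |x_i| <= R, and for
  larger |x_i| the cutoff is flat.\<close>

lemma partial_deriv_ball_cutoff_bound:
  assumes i: "i < n" and R: "1 \<le> R"
  shows "\<bar>partial_deriv i (ball_cutoff n R) x\<bar> \<le> 8 * exp 1"
proof (cases "\<bar>x i\<bar> \<le> R")
  case True
  have "\<bar>- 2 * x i / R\<^sup>2\<bar> = 2 * (\<bar>x i\<bar> / R) / R" using R by (simp add: abs_mult power2_eq_square)
  also have "\<dots> \<le> 2 * 1 / 1" using True R by (intro frac_le mult_left_mono) auto
  finally have 1: "\<bar>- 2 * x i / R\<^sup>2\<bar> \<le> 2" by simp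
  have "\<bar>partial_deriv i (ball_cutoff n R) x\<bar> \<le> exp 1 * (4 * 2)"
    unfolding partial_deriv_ball_cutoff[OF i] abs_mult[of "exp 1"] abs_mult[of "flat_exp _ _"]
    using flat_exp_nonneg flat_exp_2_le by (intro mult_mono 1) auto
  thus ?thesis by simp
next
  case False
  have "R\<^sup>2 < \<bar>x i\<bar>\<^sup>2" using False R by (intro power_strict_mono) auto
  also have "\<bar>x i\<bar>\<^sup>2 \<le> (\<Sum>i<n. (x i)\<^sup>2)" using i by (simp, intro member_le_sum) auto
  finally have "1 \<le> (\<Sum>i<n. (x i)\<^sup>2) / R\<^sup>2" using R by (simp add: le_divide_eq)
  thus ?thesis unfolding partial_deriv_ball_cutoff[OF i] by (simp add: flat_exp_def)
qed

lemma ball_cutoff_tendsto: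
  "(\<lambda>N. ball_cutoff n (real (Suc N)) x) \<longlonglongrightarrow> 1"
  "i < n \<Longrightarrow> (\<lambda>N. partial_deriv i (ball_cutoff n (real (Suc N))) x) \<longlonglongrightarrow> 0"
proof -
  have z: "(\<lambda>N. a / (real (Suc N))\<^sup>2) \<longlonglongrightarrow> 0" for a :: real
    using LIMSEQ_Suc[OF lim_const_over_n[of a]] LIMSEQ_Suc[OF lim_1_over_n[where 'a=real]]
    by (auto dest: tendsto_mult simp: power2_eq_square)
  have o: "(\<lambda>N. 1 - (\<Sum>i<n. (x i)\<^sup>2) / (real (Suc N))\<^sup>2) \<longlonglongrightarrow> 1"
    using tendsto_diff[OF tendsto_const[of 1] z] by simp
  have f: "(\<lambda>N. flat_exp k (1 - (\<Sum>i<n. (x i)\<^sup>2) / (real (Suc N))\<^sup>2)) \<longlonglongrightarrow> flat_exp k 1" for k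
    by (rule continuous_on_tendsto_compose[OF continuous_on_flat_exp o]) auto
  have "(\<lambda>N. exp 1 * flat_exp 0 (1 - (\<Sum>i<n. (x i)\<^sup>2) / (real (Suc N))\<^sup>2)) \<longlonglongrightarrow> exp 1 * flat_exp 0 1"
    by (intro tendsto_mult tendsto_const f)
  also have "exp 1 * flat_exp 0 1 = 1" by (simp add: flat_exp_def flip: exp_add)
  finally show "(\<lambda>N. ball_cutoff n (real (Suc N)) x) \<longlonglongrightarrow> 1" unfolding ball_cutoff_def .
  assume i: "i < n"
  have "(\<lambda>N. exp 1 * (flat_exp 2 (1 - (\<Sum>i<n. (x i)\<^sup>2) / (real (Suc N))\<^sup>2) * (- 2 * x i / (real (Suc N))\<^sup>2)))
     \<longlonglongrightarrow> exp 1 * (flat_exp 2 1 * 0)"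
    by (intro tendsto_mult tendsto_const f z)
  thus "(\<lambda>N. partial_deriv i (ball_cutoff n (real (Suc N))) x) \<longlonglongrightarrow> 0"
    unfolding partial_deriv_ball_cutoff[OF i] by simp
qed

context isonormal
begin

text \<open>Multiply by cutoffs of growing radius and pass to the limit. Boundedness of
  \<open>G\<close> dominates the left side and the term with the derivative of the cutoff, and
  bounded partial derivatives dominate the rest; the term with the derivative of the cutoff
  disappears pointwise.\<close>

lemma divergence_duality_lipschitz:
  assumes u: "u \<in> D12_vec M X" "has_divergence M X u Z"
    and G: "lipschitz_cylindrical X G \<Gamma>" and bound: "\<And>\<omega>. \<bar>G \<omega>\<bar> \<le> B"
  shows "G \<in> borel_measurable M" "\<Gamma> \<in> borel_measurable M" "\<exists>C. \<forall>\<omega>. norm (\<Gamma> \<omega>) \<le> C"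
    "(\<integral>\<omega>. G \<omega> * Z \<omega> \<partial>M) = (\<integral>\<omega>. \<Gamma> \<omega> \<bullet> u \<omega> \<partial>M)"
proof -
  obtain n f h L where n: "n \<ge> 1" and f: "depends_below n f" "smooth_upto n f"
    "\<And>i x. i < n \<Longrightarrow> \<bar>partial_deriv i f x\<bar> \<le> L" and Gf: "G = (\<lambda>\<omega>. f (\<lambda>i. X (h i) \<omega>))"
    and \<Gamma>f: "\<Gamma> = (\<lambda>\<omega>. \<Sum>i<n. partial_deriv i f (\<lambda>i. X (h i) \<omega>) *\<^sub>R h i)"
    using G unfolding lipschitz_cylindrical_def by blast
  have Gm[measurable]: "G \<in> borel_measurable M" unfolding Gf
    by (rule measurable_cylinder[OF smooth_upto_continuous[OF f(2)]])
  have pm: "i < n \<Longrightarrow> (\<lambda>\<omega>. partial_deriv i f (\<lambda>i. X (h i) \<omega>)) \<in> borel_measurable M" for i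
    by (rule measurable_cylinder[OF smooth_upto_continuous[OF smooth_upto_partial_deriv[OF f(2)]]])
  have \<Gamma>m[measurable]: "\<Gamma> \<in> borel_measurable M" unfolding \<Gamma>f
    using pm by (intro borel_measurable_sum borel_measurable_scaleR) auto
  define S where "S = (\<Sum>i<n. norm (h i))"
  have S0: "0 \<le> S" unfolding S_def by (intro sum_nonneg) auto
  have sumb: "norm (\<Sum>i<n. c i *\<^sub>R h i) \<le> C * S" if "\<And>i. i < n \<Longrightarrow> \<bar>c i\<bar> \<le> C" for c :: "nat \<Rightarrow> real" and C
  proof -
    have "norm (\<Sum>i<n. c i *\<^sub>R h i) \<le> (\<Sum>i<n. norm (c i *\<^sub>R h i))" by (rule norm_sum)
    also have "\<dots> \<le> (\<Sum>i<n. C * norm (h i))"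
      unfolding norm_scaleR by (intro sum_mono mult_right_mono that) auto
    finally show ?thesis by (simp add: S_def sum_distrib_left)
  qed
  have \<Gamma>b: "norm (\<Gamma> \<omega>) \<le> L * S" for \<omega> unfolding \<Gamma>f by (intro sumb f(3))
  show "G \<in> borel_measurable M" "\<Gamma> \<in> borel_measurable M" by fact+
  show "\<exists>C. \<forall>\<omega>. norm (\<Gamma> \<omega>) \<le> C" using \<Gamma>b by blast
  define V where "V = (\<lambda>\<omega> i. X (h i) \<omega>)"
  \<comment> \<open>The radius \<open>Suc N\<close> is at least 1, as the uniform bound on the
    derivatives of the cutoff requires.\<close>
  define \<kappa> where "\<kappa> = (\<lambda>N. ball_cutoff n (real (Suc N)))"
  define F where "F = (\<lambda>N x. f x * \<kappa> N x)"
  define K where "K = (\<lambda>N \<omega>. \<Sum>i<n. partial_deriv i (\<kappa> N) (V \<omega>) *\<^sub>R h i)"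
  have \<kappa>s: "smooth_upto n (\<kappa> N)" for N unfolding \<kappa>_def by (intro smooth_gen_imp_smooth_upto smooth_gen_ball_cutoff)
  have Fs: "smooth_compact_support n (F N)" for N
    unfolding smooth_compact_support_iff
  proof (intro conjI exI[of _ "real (Suc N)"] allI impI)
    show "depends_below n (F N)"
      using f(1) ball_cutoff_depends[of n "real (Suc N)"] unfolding depends_below_def F_def \<kappa>_def
      by (intro allI impI arg_cong2[where f="(*)"]) blast+
    have "smooth_gen n f" using smooth_gen.shift[OF f(2) f(1), of 0 n] by simp
    thus "smooth_upto n (F N)" unfolding F_def \<kappa>_def
      by (intro smooth_gen_imp_smooth_upto smooth_gen.mult smooth_gen_ball_cutoff)
    show "F N x = 0" if "\<exists>i<n. real (Suc N) < \<bar>x i\<bar>" for x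
      using that ball_cutoff_eq_0[of _ n "real (Suc N)" x] unfolding F_def \<kappa>_def by auto
  qed
  have pF: "partial_deriv i (F N) x = \<kappa> N x * partial_deriv i f x + f x * partial_deriv i (\<kappa> N) x" if "i < n" for i N x
  proof -
    from DERIV_mult[OF smooth_upto_DERIV[OF f(2) that, of x] smooth_upto_DERIV[OF \<kappa>s[of N] that, of x]]
    show ?thesis unfolding F_def partial_deriv_def[of i "\<lambda>x. f x * \<kappa> N x"]
      by (intro DERIV_imp_deriv) (simp add: mult.commute)
  qed
  have cyl: "smooth_cylindrical X (\<lambda>\<omega>. G \<omega> * \<kappa> N (V \<omega>)) (\<lambda>\<omega>. \<kappa> N (V \<omega>) *\<^sub>R \<Gamma> \<omega> + G \<omega> *\<^sub>R K N \<omega>)" for N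
    unfolding smooth_cylindrical_def
  proof (intro exI[of _ n] exI[of _ "F N"] exI[of _ h] conjI n Fs ext)
    show "G \<omega> * \<kappa> N (V \<omega>) = F N (\<lambda>i. X (h i) \<omega>)" for \<omega> by (simp add: F_def Gf V_def)
    have "(\<Sum>i<n. partial_deriv i (F N) (V \<omega>) *\<^sub>R h i) =
       (\<Sum>i<n. (\<kappa> N (V \<omega>) * partial_deriv i f (V \<omega>) + f (V \<omega>) * partial_deriv i (\<kappa> N) (V \<omega>)) *\<^sub>R h i)" for \<omega>
      by (intro sum.cong refl) (simp add: pF)
    thus "\<kappa> N (V \<omega>) *\<^sub>R \<Gamma> \<omega> + G \<omega> *\<^sub>R K N \<omega> = (\<Sum>i<n. partial_deriv i (F N) (\<lambda>i. X (h i) \<omega>) *\<^sub>R h i)" for \<omega>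
      by (simp add: \<Gamma>f K_def Gf V_def scaleR_sum_right scaleR_add_left sum.distrib)
  qed
  note dual = divergence_duality[OF u cyl]
  note cylm[measurable] = smooth_cylindrical_bounded(1,2)[OF cyl]
  have Zm[measurable]: "Z \<in> borel_measurable M" "u \<in> borel_measurable M"
    and Z2: "integrable M (\<lambda>\<omega>. (Z \<omega>)\<^sup>2)" "integrable M (\<lambda>\<omega>. (norm (u \<omega>))\<^sup>2)"
    using u(2) unfolding has_divergence_def by blast+
  have Zi: "integrable M Z" by (rule square_integrable_imp_integrable[OF Zm(1) Z2(1)])
  have ui: "integrable M (\<lambda>\<omega>. norm (u \<omega>))" by (rule square_integrable_imp_integrable[OF _ Z2(2)]) measurable
  have \<kappa>b: "0 \<le> \<kappa> N x" "\<kappa> N x \<le> 1" for N x unfolding \<kappa>_def by (rule ball_cutoff_bounds)+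
  have B0: "0 \<le> B" using bound order_trans[OF abs_ge_zero] by blast
  have "(\<lambda>N. \<integral>\<omega>. (G \<omega> * \<kappa> N (V \<omega>)) * Z \<omega> \<partial>M) \<longlonglongrightarrow> (\<integral>\<omega>. G \<omega> * Z \<omega> \<partial>M)"
  proof (rule integral_dominated_convergence[where w="\<lambda>\<omega>. B * \<bar>Z \<omega>\<bar>"])
    show "AE \<omega> in M. (\<lambda>N. (G \<omega> * \<kappa> N (V \<omega>)) * Z \<omega>) \<longlonglongrightarrow> G \<omega> * Z \<omega>"
    proof (rule AE_I2)
      fix \<omega>
      have "(\<lambda>N. (G \<omega> * \<kappa> N (V \<omega>)) * Z \<omega>) \<longlonglongrightarrow> (G \<omega> * 1) * Z \<omega>"
        unfolding \<kappa>_def by (intro tendsto_mult tendsto_const ball_cutoff_tendsto)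
      thus "(\<lambda>N. (G \<omega> * \<kappa> N (V \<omega>)) * Z \<omega>) \<longlonglongrightarrow> G \<omega> * Z \<omega>" by simp
    qed
    show "AE \<omega> in M. norm ((G \<omega> * \<kappa> N (V \<omega>)) * Z \<omega>) \<le> B * \<bar>Z \<omega>\<bar>" for N
    proof (rule AE_I2)
      fix \<omega>
      have "\<bar>G \<omega>\<bar> * \<bar>\<kappa> N (V \<omega>)\<bar> \<le> B * 1" using \<kappa>b by (intro mult_mono bound B0) auto
      thus "norm ((G \<omega> * \<kappa> N (V \<omega>)) * Z \<omega>) \<le> B * \<bar>Z \<omega>\<bar>"
        by (auto simp: abs_mult intro!: mult_right_mono)
    qed
  qed (use Zi in simp_all)
  moreover have "(\<lambda>N. \<integral>\<omega>. (\<kappa> N (V \<omega>) *\<^sub>R \<Gamma> \<omega> + G \<omega> *\<^sub>R K N \<omega>) \<bullet> u \<omega> \<partial>M) \<longlonglongrightarrow> (\<integral>\<omega>. \<Gamma> \<omega> \<bullet> u \<omega> \<partial>M)"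
  proof (rule integral_dominated_convergence[where w="\<lambda>\<omega>. (L * S + B * (8 * exp 1 * S)) * norm (u \<omega>)"])
    show "AE \<omega> in M. (\<lambda>N. (\<kappa> N (V \<omega>) *\<^sub>R \<Gamma> \<omega> + G \<omega> *\<^sub>R K N \<omega>) \<bullet> u \<omega>) \<longlonglongrightarrow> \<Gamma> \<omega> \<bullet> u \<omega>"
    proof (rule AE_I2)
      fix \<omega>
      have k: "(\<lambda>N. K N \<omega>) \<longlonglongrightarrow> (\<Sum>i<n. 0 *\<^sub>R h i)"
        unfolding K_def \<kappa>_def by (intro tendsto_sum tendsto_scaleR tendsto_const ball_cutoff_tendsto(2)) auto
      have "(\<lambda>N. (\<kappa> N (V \<omega>) *\<^sub>R \<Gamma> \<omega> + G \<omega> *\<^sub>R K N \<omega>) \<bullet> u \<omega>) \<longlonglongrightarrow> (1 *\<^sub>R \<Gamma> \<omega> + G \<omega> *\<^sub>R (\<Sum>i<n. 0 *\<^sub>R h i)) \<bullet> u \<omega>"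
        by (intro tendsto_inner tendsto_add tendsto_scaleR tendsto_const k)
          (unfold \<kappa>_def, rule ball_cutoff_tendsto)
      thus "(\<lambda>N. (\<kappa> N (V \<omega>) *\<^sub>R \<Gamma> \<omega> + G \<omega> *\<^sub>R K N \<omega>) \<bullet> u \<omega>) \<longlonglongrightarrow> \<Gamma> \<omega> \<bullet> u \<omega>" by simp
    qed
    show "AE \<omega> in M. norm ((\<kappa> N (V \<omega>) *\<^sub>R \<Gamma> \<omega> + G \<omega> *\<^sub>R K N \<omega>) \<bullet> u \<omega>) \<le> (L * S + B * (8 * exp 1 * S)) * norm (u \<omega>)" for N
    proof (rule AE_I2)
      fix \<omega>
      have "norm (K N \<omega>) \<le> 8 * exp 1 * S"
        unfolding K_def \<kappa>_def by (intro sumb partial_deriv_ball_cutoff_bound) auto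
      hence 1: "norm (G \<omega> *\<^sub>R K N \<omega>) \<le> B * (8 * exp 1 * S)"
        unfolding norm_scaleR by (intro mult_mono bound B0) auto
      have "norm (\<kappa> N (V \<omega>) *\<^sub>R \<Gamma> \<omega>) \<le> 1 * (L * S)"
        unfolding norm_scaleR using \<kappa>b by (intro mult_mono \<Gamma>b) auto
      hence "norm (\<kappa> N (V \<omega>) *\<^sub>R \<Gamma> \<omega> + G \<omega> *\<^sub>R K N \<omega>) \<le> L * S + B * (8 * exp 1 * S)"
        using norm_triangle_ineq[of "\<kappa> N (V \<omega>) *\<^sub>R \<Gamma> \<omega>" "G \<omega> *\<^sub>R K N \<omega>"] 1 by linarith
      hence "norm (\<kappa> N (V \<omega>) *\<^sub>R \<Gamma> \<omega> + G \<omega> *\<^sub>R K N \<omega>) * norm (u \<omega>) \<le> (L * S + B * (8 * exp 1 * S)) * norm (u \<omega>)"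
        by (rule mult_right_mono) simp
      thus "norm ((\<kappa> N (V \<omega>) *\<^sub>R \<Gamma> \<omega> + G \<omega> *\<^sub>R K N \<omega>) \<bullet> u \<omega>) \<le> (L * S + B * (8 * exp 1 * S)) * norm (u \<omega>)"
        using Cauchy_Schwarz_ineq2[of "\<kappa> N (V \<omega>) *\<^sub>R \<Gamma> \<omega> + G \<omega> *\<^sub>R K N \<omega>" "u \<omega>"] by simp
    qed
  qed (use ui in simp_all)
  ultimately show "(\<integral>\<omega>. G \<omega> * Z \<omega> \<partial>M) = (\<integral>\<omega>. \<Gamma> \<omega> \<bullet> u \<omega> \<partial>M)"
    unfolding dual by (rule LIMSEQ_unique)
qed

end

section \<open>Duality for trigonometric functions damped by an exponential of the squared
  variable\<close>

text \<open>A smooth function equal to \<open>exp (-\<mu> v)\<close> for \<open>v \<ge> 0\<close> and bounded for \<open>v < 0\<close>: the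
  approximations of \<open>S\<^sup>2\<close> may be negative.\<close>

definition damped_exp :: "real \<Rightarrow> real \<Rightarrow> real" where
  "damped_exp \<mu> v = exp (- \<mu> * v + 3 * \<mu> * (v * flat_exp 0 (- v)))"

definition damped_exp_deriv :: "real \<Rightarrow> real \<Rightarrow> real" where
  "damped_exp_deriv \<mu> v = damped_exp \<mu> v * (- \<mu> + 3 * \<mu> * (flat_exp 0 (- v) - v * flat_exp 2 (- v)))"

lemma DERIV_damped_exp: "(damped_exp \<mu> has_real_derivative damped_exp_deriv \<mu> v) (at v)"
proof -
  have "((\<lambda>v. flat_exp 0 (- v)) has_real_derivative (flat_exp 2 (- v)) * (- 1)) (at v)"
  proof -
    have "(uminus has_real_derivative - 1) (at v)" by (auto intro!: derivative_eq_intros)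
    from DERIV_chain2[OF DERIV_flat_exp this, of 0] show ?thesis by (simp add: numeral_2_eq_2)
  qed
  from DERIV_mult[OF DERIV_ident this]
  have "((\<lambda>v. v * flat_exp 0 (- v)) has_real_derivative (flat_exp 0 (- v) - v * flat_exp 2 (- v))) (at v)"
    by (simp add: mult.commute)
  from DERIV_add[OF DERIV_cmult[OF DERIV_ident, of "- \<mu>"] DERIV_cmult[OF this, of "3 * \<mu>"]]
  have "((\<lambda>v. - \<mu> * v + 3 * \<mu> * (v * flat_exp 0 (- v))) has_real_derivative
    (- \<mu> + 3 * \<mu> * (flat_exp 0 (- v) - v * flat_exp 2 (- v)))) (at v)" by simp
  from DERIV_chain2[OF DERIV_exp this] show ?thesis
    unfolding damped_exp_deriv_def damped_exp_def[abs_def] by simp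
qed

lemma damped_exp_nonneg: "0 \<le> v \<Longrightarrow> damped_exp \<mu> v = exp (- \<mu> * v)"
  "0 \<le> v \<Longrightarrow> damped_exp_deriv \<mu> v = - \<mu> * exp (- \<mu> * v)"
  by (simp_all add: damped_exp_def damped_exp_deriv_def flat_exp_def)

text \<open>For v <= -1 the correction has weight at least 3 exp (-1) >= 1 and cancels the growth of
  -\<mu> v, which is why the coefficient is 3; for larger v the correction is at most 0 and -\<mu> v
  is at most \<mu>. In the derivative the bracket multiplied by 3 \<mu> lies between 0 and 2, whence
  7 = 1 + 3 times 2.\<close>

lemma damped_exp_bounds:
  assumes \<mu>: "0 \<le> \<mu>"
  shows "\<bar>damped_exp \<mu> v\<bar> \<le> exp \<mu>" "\<bar>damped_exp_deriv \<mu> v\<bar> \<le> exp \<mu> * (7 * \<mu>)"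
proof -
  have "- \<mu> * v + 3 * \<mu> * (v * flat_exp 0 (- v)) \<le> \<mu>"
  proof (cases "v \<le> -1")
    case True
    have "exp (-1) \<le> flat_exp 0 (- v)" using True by (simp add: flat_exp_def field_simps)
    moreover have "1 / 3 \<le> exp (- 1 :: real)"
      using e_less_272 by (simp add: exp_minus field_simps)
    ultimately have "1 / 3 \<le> flat_exp 0 (- v)" by linarith
    hence "v * flat_exp 0 (- v) \<le> v * (1 / 3)" using True by (intro mult_left_mono_neg) auto
    hence "3 * \<mu> * (v * flat_exp 0 (- v)) \<le> 3 * \<mu> * (v * (1 / 3))"
      by (rule mult_left_mono) (use \<mu> in simp)
    moreover have "3 * \<mu> * (v * (1 / 3)) = \<mu> * v" by simp
    ultimately show ?thesis using \<mu> unfolding mult_minus_left by linarith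
  next
    case False
    have "v * flat_exp 0 (- v) \<le> 0"
      by (auto simp: flat_exp_def mult_le_0_iff)
    hence "3 * \<mu> * (v * flat_exp 0 (- v)) \<le> 0" using \<mu> by (simp add: mult_le_0_iff)
    moreover have "\<mu> * (- v) \<le> \<mu> * 1" using \<mu> False by (intro mult_left_mono) auto
    ultimately show ?thesis by simp
  qed
  thus 1: "\<bar>damped_exp \<mu> v\<bar> \<le> exp \<mu>" by (simp add: damped_exp_def)
  \<comment> \<open>Multiplication by the argument lowers the exponent by one, so a product with an
    unbounded factor becomes the bounded \<open>flat_exp 1\<close>.\<close>
  have "- v * flat_exp 2 (- v) = flat_exp 1 (- v)" by (simp add: flat_exp_def power2_eq_square)
  hence "- v * flat_exp 2 (- v) \<le> 1" "0 \<le> - v * flat_exp 2 (- v)"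
    using flat_exp_1_le_1[of "- v"] flat_exp_nonneg[of 1 "- v"] by simp_all
  hence g: "flat_exp 0 (- v) - v * flat_exp 2 (- v) \<le> 2" "0 \<le> flat_exp 0 (- v) - v * flat_exp 2 (- v)"
    using flat_exp_0_le_1[of "- v"] flat_exp_nonneg[of 0 "- v"] by linarith+
  have "\<bar>- \<mu> + 3 * \<mu> * (flat_exp 0 (- v) - v * flat_exp 2 (- v))\<bar>
      \<le> \<mu> + 3 * \<mu> * (flat_exp 0 (- v) - v * flat_exp 2 (- v))"
    using \<mu> mult_nonneg_nonneg[OF _ g(2), of "3 * \<mu>"] by simp
  also have "\<dots> \<le> \<mu> + 3 * \<mu> * 2" using \<mu> g(1) by (intro add_mono mult_left_mono) auto
  finally have "\<bar>- \<mu> + 3 * \<mu> * (flat_exp 0 (- v) - v * flat_exp 2 (- v))\<bar> \<le> 7 * \<mu>" by simp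
  thus "\<bar>damped_exp_deriv \<mu> v\<bar> \<le> exp \<mu> * (7 * \<mu>)"
    unfolding damped_exp_deriv_def abs_mult[of "damped_exp \<mu> v"] by (intro mult_mono 1) auto
qed

lemma continuous_damped_exp: "isCont (damped_exp \<mu>) v" "isCont (damped_exp_deriv \<mu>) v"
proof -
  show c: "isCont (damped_exp \<mu>) v" by (rule DERIV_isCont[OF DERIV_damped_exp])
  have f: "isCont (\<lambda>v. flat_exp k (- v)) v" for k
  proof -
    have "isCont (uminus :: real \<Rightarrow> real) v" by (rule DERIV_isCont[of _ "- 1"]) (auto intro!: derivative_eq_intros)
    thus ?thesis by (rule isCont_o2[OF _ DERIV_isCont[OF DERIV_flat_exp]])
  qed
  show "isCont (damped_exp_deriv \<mu>) v"
    unfolding damped_exp_deriv_def[abs_def] by (intro continuous_intros c f)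
qed

lemma smooth_binary_cos_damped:
  "smooth_binary (\<lambda>x v. cos (l * x + c) * damped_exp \<mu> v)
     (\<lambda>x v. - l * sin (l * x + c) * damped_exp \<mu> v) (\<lambda>x v. cos (l * x + c) * damped_exp_deriv \<mu> v)"
  unfolding smooth_binary_def
proof (intro conjI allI impI)
  fix N a b assume a: "smooth_gen N a" and b: "smooth_gen N b"
  have "smooth_gen N (\<lambda>x. cos (l * a x + c) * exp (- \<mu> * b x + 3 * \<mu> * (b x * flat_exp 0 ((- 1) * b x))))"
    by (intro smooth_gen.mult smooth_gen.cos smooth_gen.exp smooth_gen.add smooth_gen.const smooth_gen.flat a b)
  thus "smooth_gen N (\<lambda>x. cos (l * a x + c) * damped_exp \<mu> (b x))" by (simp add: damped_exp_def)
next
  fix a b :: "real \<Rightarrow> real" and a' b' t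
  assume a: "(a has_real_derivative a') (at t)" and b: "(b has_real_derivative b') (at t)"
  have "((\<lambda>t. l * a t + c) has_real_derivative l * a') (at t)"
    using DERIV_add[OF DERIV_cmult[OF a, of l] DERIV_const[of c]] by simp
  from DERIV_mult[OF DERIV_chain2[OF DERIV_cos this] DERIV_chain2[OF DERIV_damped_exp b]]
  show "((\<lambda>t. cos (l * a t + c) * damped_exp \<mu> (b t)) has_real_derivative
      - l * sin (l * a t + c) * damped_exp \<mu> (b t) * a' + cos (l * a t + c) * damped_exp_deriv \<mu> (b t) * b') (at t)"
    by (simp add: mult_ac)
qed

lemma smooth_binary_add_scaled: "smooth_binary (\<lambda>x y. x + \<sigma> * y) (\<lambda>_ _. 1) (\<lambda>_ _. \<sigma>)"
  unfolding smooth_binary_def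
proof (intro conjI allI impI)
  fix N a b assume a: "smooth_gen N a" and b: "smooth_gen N b"
  show "smooth_gen N (\<lambda>x. a x + \<sigma> * b x)"
    by (intro smooth_gen.mult smooth_gen.add smooth_gen.const a b)
next
  fix a b :: "real \<Rightarrow> real" and a' b' t
  assume a: "(a has_real_derivative a') (at t)" and b: "(b has_real_derivative b') (at t)"
  from DERIV_add[OF a DERIV_cmult[OF b, of \<sigma>]]
  show "((\<lambda>t. a t + \<sigma> * b t) has_real_derivative 1 * a' + \<sigma> * b') (at t)" by simp
qed

text \<open>Replace \<open>\<Gamma>s n\<close> by its limit: with \<Gamma> fixed, the bounded
  weights converge almost everywhere and dominated convergence applies, and the error is controlled
  by the L2 distance times \<open>C\<close> and the norm of \<open>u\<close>.\<close>

lemma (in prob_space) weighted_L2_limit: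
  fixes \<Gamma> u :: "'a \<Rightarrow> 'v::{real_inner, second_countable_topology, banach}" and \<alpha> :: "nat \<Rightarrow> 'a \<Rightarrow> real"
  assumes [measurable]: "\<And>n. \<alpha> n \<in> borel_measurable M" "\<beta> \<in> borel_measurable M"
      "\<And>n. \<Gamma>s n \<in> borel_measurable M" "\<Gamma> \<in> borel_measurable M" "u \<in> borel_measurable M"
    and bound: "\<And>n x. \<bar>\<alpha> n x\<bar> \<le> C" and \<alpha>: "AE x in M. (\<lambda>n. \<alpha> n x) \<longlonglongrightarrow> \<beta> x"
    and \<Gamma>s: "\<And>n. integrable M (\<lambda>x. (norm (\<Gamma>s n x))\<^sup>2)" and u: "integrable M (\<lambda>x. (norm (u x))\<^sup>2)"
    and lim: "L2_tendsto M \<Gamma>s \<Gamma>"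
  shows "(\<lambda>n. \<integral>x. \<alpha> n x * (\<Gamma>s n x \<bullet> u x) \<partial>M) \<longlonglongrightarrow> (\<integral>x. \<beta> x * (\<Gamma> x \<bullet> u x) \<partial>M)"
proof -
  have C0: "0 \<le> C" using bound[of 0 undefined] by simp
  have \<Gamma>: "integrable M (\<lambda>x. (norm (\<Gamma> x))\<^sup>2)"
    by (rule L2_tendsto_integrable[OF _ _ \<Gamma>s lim]) measurable
  have i: "integrable M (\<lambda>x. \<Gamma>s n x \<bullet> u x)" "integrable M (\<lambda>x. \<Gamma> x \<bullet> u x)" for n
    by (intro integrable_inner_L2 \<Gamma>s \<Gamma> u; measurable)+
  have iw: "integrable M (\<lambda>x. \<alpha> n x * f x)" if f: "integrable M f" for f n
  proof (rule Bochner_Integration.integrable_bound)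
    show "integrable M (\<lambda>x. C * f x)" using f by simp
    show "(\<lambda>x. \<alpha> n x * f x) \<in> borel_measurable M" using f by measurable
    show "AE x in M. norm (\<alpha> n x * f x) \<le> norm (C * f x)"
      using bound C0 by (auto simp: abs_mult intro!: mult_right_mono)
  qed
  have 1: "(\<lambda>n. \<integral>x. \<alpha> n x * (\<Gamma> x \<bullet> u x) \<partial>M) \<longlonglongrightarrow> (\<integral>x. \<beta> x * (\<Gamma> x \<bullet> u x) \<partial>M)"
  proof (rule integral_dominated_convergence[where w="\<lambda>x. C * \<bar>\<Gamma> x \<bullet> u x\<bar>"])
    show "AE x in M. (\<lambda>n. \<alpha> n x * (\<Gamma> x \<bullet> u x)) \<longlonglongrightarrow> \<beta> x * (\<Gamma> x \<bullet> u x)"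
      using \<alpha> by eventually_elim (intro tendsto_mult tendsto_const)
    show "AE x in M. norm (\<alpha> n x * (\<Gamma> x \<bullet> u x)) \<le> C * \<bar>\<Gamma> x \<bullet> u x\<bar>" for n
      using bound by (auto simp: abs_mult intro!: mult_right_mono)
  qed (use i in simp_all)
  have 2: "(\<lambda>n. \<integral>x. \<alpha> n x * (\<Gamma>s n x \<bullet> u x - \<Gamma> x \<bullet> u x) \<partial>M) \<longlonglongrightarrow> (\<integral>x. 0 \<partial>M)"
  proof (rule tendsto_L1_int)
    show "integrable M (\<lambda>x. \<alpha> n x * (\<Gamma>s n x \<bullet> u x - \<Gamma> x \<bullet> u x))" for n
      by (intro iw Bochner_Integration.integrable_diff i)
    show "(\<lambda>n. \<integral>\<^sup>+x. ennreal (norm (\<alpha> n x * (\<Gamma>s n x \<bullet> u x - \<Gamma> x \<bullet> u x) - 0)) \<partial>M) \<longlonglongrightarrow> 0"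
    proof (rule tendsto_sandwich[OF _ _ tendsto_const])
      have "integrable M (\<lambda>x. (C * norm (u x))\<^sup>2)" using u by (simp add: power_mult_distrib)
      thus "(\<lambda>n. \<integral>\<^sup>+x. ennreal (norm (\<Gamma>s n x - \<Gamma> x) * \<bar>C * norm (u x)\<bar>) \<partial>M) \<longlonglongrightarrow> 0"
        using lim by (intro L2_tendsto_L1_mult) auto
      have "norm (\<alpha> n x * (\<Gamma>s n x \<bullet> u x - \<Gamma> x \<bullet> u x) - 0) \<le> norm (\<Gamma>s n x - \<Gamma> x) * \<bar>C * norm (u x)\<bar>" for n x
      proof -
        have "\<bar>\<alpha> n x\<bar> * \<bar>(\<Gamma>s n x - \<Gamma> x) \<bullet> u x\<bar> \<le> C * (norm (\<Gamma>s n x - \<Gamma> x) * norm (u x))"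
          by (intro mult_mono bound Cauchy_Schwarz_ineq2 C0) auto
        thus ?thesis using C0 by (simp add: abs_mult mult_ac inner_diff_left)
      qed
      thus "\<forall>\<^sub>F n in sequentially. (\<integral>\<^sup>+x. ennreal (norm (\<alpha> n x * (\<Gamma>s n x \<bullet> u x - \<Gamma> x \<bullet> u x) - 0)) \<partial>M)
        \<le> (\<integral>\<^sup>+x. ennreal (norm (\<Gamma>s n x - \<Gamma> x) * \<bar>C * norm (u x)\<bar>) \<partial>M)"
        by (intro always_eventually allI nn_integral_mono ennreal_leI)
    qed simp
  qed simp
  have "(\<integral>x. \<alpha> n x * (\<Gamma>s n x \<bullet> u x) \<partial>M) =
     (\<integral>x. \<alpha> n x * (\<Gamma> x \<bullet> u x) \<partial>M) + (\<integral>x. \<alpha> n x * (\<Gamma>s n x \<bullet> u x - \<Gamma> x \<bullet> u x) \<partial>M)" for n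
    by (subst Bochner_Integration.integral_add[symmetric])
      (auto intro!: iw Bochner_Integration.integrable_diff i Bochner_Integration.integral_cong simp: algebra_simps)
  thus ?thesis using tendsto_add[OF 1 2] by simp
qed

lemma L2_tendsto_subseq: "L2_tendsto M Fs F \<Longrightarrow> strict_mono r \<Longrightarrow> L2_tendsto M (\<lambda>n. Fs (r n)) F"
  unfolding L2_tendsto_def using LIMSEQ_subseq_LIMSEQ[of _ 0 r] by (simp add: o_def)

lemma L2_tendsto_const_add:
  fixes Gs :: "nat \<Rightarrow> 'a \<Rightarrow> 'v::{real_normed_vector, second_countable_topology}"
  assumes [measurable]: "\<And>n. Gs n \<in> borel_measurable M" "G \<in> borel_measurable M"
    and lim: "L2_tendsto M Gs G"
  shows "L2_tendsto M (\<lambda>n x. h + s *\<^sub>R Gs n x) (\<lambda>x. h + s *\<^sub>R G x)"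
proof -
  have "norm ((h + s *\<^sub>R a) - (h + s *\<^sub>R b)) = \<bar>s\<bar> * norm (a - b)" for a b :: 'v
    by (simp flip: scaleR_diff_right)
  hence "(\<integral>\<^sup>+x. ennreal ((norm ((h + s *\<^sub>R Gs n x) - (h + s *\<^sub>R G x)))\<^sup>2) \<partial>M) = ennreal (s\<^sup>2) * (\<integral>\<^sup>+x. ennreal ((norm (Gs n x - G x))\<^sup>2) \<partial>M)" for n
    by (subst nn_integral_cmult[symmetric]) (auto simp: power_mult_distrib ennreal_mult)
  moreover have "(\<lambda>n. ennreal (s\<^sup>2) * (\<integral>\<^sup>+x. ennreal ((norm (Gs n x - G x))\<^sup>2) \<partial>M)) \<longlonglongrightarrow> ennreal (s\<^sup>2) * 0"
    using lim unfolding L2_tendsto_def by (intro ennreal_tendsto_cmult) auto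
  ultimately show ?thesis unfolding L2_tendsto_def by simp
qed

context isonormal
begin

text \<open>Apply the duality to the bounded variables obtained from cylindrical approximations of
  \<open>F\<close> and \<open>B\<close>, with \<open>damped_exp\<close> in place of the exponential,
  and pass to the limit. The gradients converge in L2, the bounded coefficients almost everywhere
  along a subsequence. The phase \<open>c\<close> makes the identity cover the sine too.\<close>

lemma divergence_cos_identity:
  assumes u: "u \<in> D12_vec M X" "has_divergence M X u Z"
    and F: "has_malliavin_derivative M X F \<Gamma>F" and B: "has_malliavin_derivative M X B \<Gamma>B"
    and B0: "\<And>\<omega>. 0 \<le> B \<omega>" and \<mu>: "0 \<le> \<mu>"
  shows "(\<integral>\<omega>. cos (l * (X h \<omega> + \<sigma> * F \<omega>) + c) * exp (- \<mu> * B \<omega>) * Z \<omega> \<partial>M) =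
     (\<integral>\<omega>. (- l * sin (l * (X h \<omega> + \<sigma> * F \<omega>) + c) * exp (- \<mu> * B \<omega>)) * ((h + \<sigma> *\<^sub>R \<Gamma>F \<omega>) \<bullet> u \<omega>) \<partial>M)
     + (\<integral>\<omega>. (cos (l * (X h \<omega> + \<sigma> * F \<omega>) + c) * (- \<mu> * exp (- \<mu> * B \<omega>))) * (\<Gamma>B \<omega> \<bullet> u \<omega>) \<partial>M)"
proof -
  note [measurable] = malliavin_derivative_L2(1,2)[OF F] malliavin_derivative_L2(1,2)[OF B]
  have [measurable]: "u \<in> borel_measurable M" "Z \<in> borel_measurable M"
    and u2: "integrable M (\<lambda>\<omega>. (norm (u \<omega>))\<^sup>2)" and Z2: "integrable M (\<lambda>\<omega>. (Z \<omega>)\<^sup>2)"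
    using u(2) unfolding has_divergence_def by blast+
  have Zi: "integrable M Z" by (rule square_integrable_imp_integrable[OF _ Z2]) measurable
  obtain Fs0 \<Gamma>Fs0 where F0: "\<And>n. smooth_cylindrical X (Fs0 n) (\<Gamma>Fs0 n)" "L2_tendsto M Fs0 F" "L2_tendsto M \<Gamma>Fs0 \<Gamma>F"
    using F unfolding has_malliavin_derivative_def by blast
  obtain Bs0 \<Gamma>Bs0 where B1: "\<And>n. smooth_cylindrical X (Bs0 n) (\<Gamma>Bs0 n)" "L2_tendsto M Bs0 B" "L2_tendsto M \<Gamma>Bs0 \<Gamma>B"
    using B unfolding has_malliavin_derivative_def by blast
  note Fm0 = smooth_cylindrical_bounded(1,2)[OF F0(1)] and Bm0 = smooth_cylindrical_bounded(1,2)[OF B1(1)]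
  \<comment> \<open>Two successive extractions, first for \<open>F\<close> and then, inside it, for
    \<open>B\<close>, give one subsequence along which both converge almost everywhere.\<close>
  obtain r where r: "strict_mono r" "AE x in M. (\<lambda>n. Fs0 (r n) x) \<longlonglongrightarrow> F x"
    using L2_tendsto_AE_subseq[OF Fm0(1) malliavin_derivative_L2(1)[OF F] smooth_cylindrical_L2(1)[OF F0(1)] F0(2)] by blast
  obtain q where q: "strict_mono q" "AE x in M. (\<lambda>n. Bs0 (r (q n)) x) \<longlonglongrightarrow> B x"
    using L2_tendsto_AE_subseq[OF Bm0(1) malliavin_derivative_L2(1)[OF B] smooth_cylindrical_L2(1)[OF B1(1)]
        L2_tendsto_subseq[OF B1(2) r(1)]] by blast
  define Fs where "Fs = (\<lambda>n. Fs0 (r (q n)))"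
  define \<Gamma>Fs where "\<Gamma>Fs = (\<lambda>n. \<Gamma>Fs0 (r (q n)))"
  define Bs where "Bs = (\<lambda>n. Bs0 (r (q n)))"
  define \<Gamma>Bs where "\<Gamma>Bs = (\<lambda>n. \<Gamma>Bs0 (r (q n)))"
  have Fs: "smooth_cylindrical X (Fs n) (\<Gamma>Fs n)" and Bs: "smooth_cylindrical X (Bs n) (\<Gamma>Bs n)" for n
    unfolding Fs_def \<Gamma>Fs_def Bs_def \<Gamma>Bs_def by (rule F0 B1)+
  have lim: "L2_tendsto M \<Gamma>Fs \<Gamma>F" "L2_tendsto M \<Gamma>Bs \<Gamma>B"
    unfolding \<Gamma>Fs_def \<Gamma>Bs_def
    by (rule L2_tendsto_subseq[OF L2_tendsto_subseq[OF F0(3) r(1)] q(1)],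
        rule L2_tendsto_subseq[OF L2_tendsto_subseq[OF B1(3) r(1)] q(1)])
  have aeF: "AE x in M. (\<lambda>n. Fs n x) \<longlonglongrightarrow> F x"
    using r(2)
  proof eventually_elim
    case (elim x)
    from LIMSEQ_subseq_LIMSEQ[OF this q(1)] show ?case by (simp add: Fs_def o_def)
  qed
  have aeB: "AE x in M. (\<lambda>n. Bs n x) \<longlonglongrightarrow> B x" using q(2) by (simp add: Bs_def)
  note Fm[measurable] = smooth_cylindrical_bounded(1,2)[OF Fs] and Bm[measurable] = smooth_cylindrical_bounded(1,2)[OF Bs]
  define A where "A = (\<lambda>n \<omega>. X h \<omega> + \<sigma> * Fs n \<omega>)"
  have Am[measurable]: "A n \<in> borel_measurable M" for n unfolding A_def by measurable
  have lA: "lipschitz_cylindrical X (A n) (\<lambda>\<omega>. 1 *\<^sub>R h + \<sigma> *\<^sub>R \<Gamma>Fs n \<omega>)" for n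
    unfolding A_def
    by (rule lipschitz_cylindrical_compose2[OF lipschitz_cylindrical_X smooth_cylindrical_imp_lipschitz[OF Fs]
        smooth_binary_add_scaled, where C="max 1 \<bar>\<sigma>\<bar>"]) auto
  define E where "E = exp \<mu>"
  define C where "C = max (\<bar>l\<bar> * E) (E * (7 * \<mu>))"
  have E0: "0 \<le> E" by (simp add: E_def)
  have b1: "\<bar>- l * sin (l * x + c) * damped_exp \<mu> v\<bar> \<le> C" for x v
  proof -
    have "\<bar>- l * sin (l * x + c)\<bar> * \<bar>damped_exp \<mu> v\<bar> \<le> (\<bar>l\<bar> * 1) * E"
      unfolding abs_mult E_def by (intro mult_mono damped_exp_bounds \<mu>) auto
    thus ?thesis by (simp add: abs_mult C_def)
  qed
  have b2: "\<bar>cos (l * x + c) * damped_exp_deriv \<mu> v\<bar> \<le> C" for x v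
  proof -
    have "\<bar>cos (l * x + c)\<bar> * \<bar>damped_exp_deriv \<mu> v\<bar> \<le> 1 * (E * (7 * \<mu>))"
      unfolding E_def by (intro mult_mono damped_exp_bounds \<mu>) auto
    thus ?thesis by (simp add: abs_mult C_def)
  qed
  have b3: "\<bar>cos (l * x + c) * damped_exp \<mu> v\<bar> \<le> E" for x v
  proof -
    have "\<bar>cos (l * x + c)\<bar> * \<bar>damped_exp \<mu> v\<bar> \<le> 1 * E"
      unfolding E_def by (intro mult_mono damped_exp_bounds \<mu>) auto
    thus ?thesis by (simp add: abs_mult)
  qed
  define \<alpha> where "\<alpha> = (\<lambda>n \<omega>. - l * sin (l * A n \<omega> + c) * damped_exp \<mu> (Bs n \<omega>))"
  define \<beta> where "\<beta> = (\<lambda>n \<omega>. cos (l * A n \<omega> + c) * damped_exp_deriv \<mu> (Bs n \<omega>))"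
  define \<gamma> where "\<gamma> = (\<lambda>n \<omega>. cos (l * A n \<omega> + c) * damped_exp \<mu> (Bs n \<omega>))"
  have lip: "lipschitz_cylindrical X (\<gamma> n) (\<lambda>\<omega>. \<alpha> n \<omega> *\<^sub>R (1 *\<^sub>R h + \<sigma> *\<^sub>R \<Gamma>Fs n \<omega>) + \<beta> n \<omega> *\<^sub>R \<Gamma>Bs n \<omega>)" for n
    unfolding \<alpha>_def \<beta>_def \<gamma>_def
    by (rule lipschitz_cylindrical_compose2[OF lA smooth_cylindrical_imp_lipschitz[OF Bs]
        smooth_binary_cos_damped[where l=l and c=c and \<mu>=\<mu>] b1 b2])
  have dual: "(\<integral>\<omega>. \<gamma> n \<omega> * Z \<omega> \<partial>M) =
      (\<integral>\<omega>. (\<alpha> n \<omega> *\<^sub>R (1 *\<^sub>R h + \<sigma> *\<^sub>R \<Gamma>Fs n \<omega>) + \<beta> n \<omega> *\<^sub>R \<Gamma>Bs n \<omega>) \<bullet> u \<omega> \<partial>M)" for n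
    by (rule divergence_duality_lipschitz(4)[OF u lip, of _ E]) (simp add: \<gamma>_def b3)
  have dm[measurable]: "damped_exp \<mu> \<in> borel_measurable borel" "damped_exp_deriv \<mu> \<in> borel_measurable borel"
    by (auto intro!: borel_measurable_continuous_onI continuous_at_imp_continuous_on continuous_damped_exp)
  have [measurable]: "\<alpha> n \<in> borel_measurable M" "\<beta> n \<in> borel_measurable M" "\<gamma> n \<in> borel_measurable M" for n
    unfolding \<alpha>_def \<beta>_def \<gamma>_def by measurable
  define a where "a = (\<lambda>\<omega>. - l * sin (l * (X h \<omega> + \<sigma> * F \<omega>) + c) * exp (- \<mu> * B \<omega>))"
  define b where "b = (\<lambda>\<omega>. cos (l * (X h \<omega> + \<sigma> * F \<omega>) + c) * (- \<mu> * exp (- \<mu> * B \<omega>)))"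
  define g where "g = (\<lambda>\<omega>. cos (l * (X h \<omega> + \<sigma> * F \<omega>) + c) * exp (- \<mu> * B \<omega>))"
  have abm[measurable]: "a \<in> borel_measurable M" "b \<in> borel_measurable M" "g \<in> borel_measurable M"
    unfolding a_def b_def g_def by measurable
  have ae: "AE \<omega> in M. (\<lambda>n. \<alpha> n \<omega>) \<longlonglongrightarrow> a \<omega> \<and> (\<lambda>n. \<beta> n \<omega>) \<longlonglongrightarrow> b \<omega> \<and> (\<lambda>n. \<gamma> n \<omega>) \<longlonglongrightarrow> g \<omega>"
    using aeF aeB
  proof eventually_elim
    case (elim \<omega>)
    have A: "(\<lambda>n. l * A n \<omega> + c) \<longlonglongrightarrow> l * (X h \<omega> + \<sigma> * F \<omega>) + c"
      unfolding A_def by (intro tendsto_intros elim)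
    \<comment> \<open>The limit \<open>B\<close> is nonnegative although its approximations need not
      be, so the damped exponential converges to the true one.\<close>
    have d: "(\<lambda>n. damped_exp \<mu> (Bs n \<omega>)) \<longlonglongrightarrow> exp (- \<mu> * B \<omega>)"
      using isCont_tendsto_compose[OF continuous_damped_exp(1) elim(2), of \<mu>] damped_exp_nonneg(1)[OF B0] by simp
    have d': "(\<lambda>n. damped_exp_deriv \<mu> (Bs n \<omega>)) \<longlonglongrightarrow> - \<mu> * exp (- \<mu> * B \<omega>)"
      using isCont_tendsto_compose[OF continuous_damped_exp(2) elim(2), of \<mu>] damped_exp_nonneg(2)[OF B0] by simp
    show ?case unfolding \<alpha>_def \<beta>_def \<gamma>_def a_def b_def g_def
      by (intro conjI tendsto_mult tendsto_const tendsto_sin tendsto_cos A d d')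
  qed
  have L2h: "integrable M (\<lambda>\<omega>. (norm (h + \<sigma> *\<^sub>R \<Gamma>Fs n \<omega>))\<^sup>2)" for n
  proof -
    obtain K where K: "\<And>\<omega>. norm (\<Gamma>Fs n \<omega>) \<le> K" using smooth_cylindrical_bounded(3)[OF Fs[of n]] by blast
    have "norm (h + \<sigma> *\<^sub>R \<Gamma>Fs n \<omega>) \<le> norm h + \<bar>\<sigma>\<bar> * K" for \<omega>
      using norm_triangle_ineq[of h "\<sigma> *\<^sub>R \<Gamma>Fs n \<omega>"] mult_left_mono[OF K[of \<omega>], of "\<bar>\<sigma>\<bar>"] by simp
    hence "(norm (h + \<sigma> *\<^sub>R \<Gamma>Fs n \<omega>))\<^sup>2 \<le> (norm h + \<bar>\<sigma>\<bar> * K)\<^sup>2" for \<omega> by (rule power_mono) simp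
    thus ?thesis by (intro integrable_const_bound[of _ "(norm h + \<bar>\<sigma>\<bar> * K)\<^sup>2"]) auto
  qed
  have w1: "(\<lambda>n. \<integral>\<omega>. \<alpha> n \<omega> * ((h + \<sigma> *\<^sub>R \<Gamma>Fs n \<omega>) \<bullet> u \<omega>) \<partial>M) \<longlonglongrightarrow> (\<integral>\<omega>. a \<omega> * ((h + \<sigma> *\<^sub>R \<Gamma>F \<omega>) \<bullet> u \<omega>) \<partial>M)"
  proof (rule weighted_L2_limit[where C=C])
    show "\<bar>\<alpha> n x\<bar> \<le> C" for n x unfolding \<alpha>_def by (rule b1)
    show "AE x in M. (\<lambda>n. \<alpha> n x) \<longlonglongrightarrow> a x" using ae by eventually_elim simp
    show "L2_tendsto M (\<lambda>n \<omega>. h + \<sigma> *\<^sub>R \<Gamma>Fs n \<omega>) (\<lambda>\<omega>. h + \<sigma> *\<^sub>R \<Gamma>F \<omega>)"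
      by (rule L2_tendsto_const_add[OF _ _ lim(1)]) measurable
  qed (use L2h u2 in \<open>simp_all\<close>)
  have w2: "(\<lambda>n. \<integral>\<omega>. \<beta> n \<omega> * (\<Gamma>Bs n \<omega> \<bullet> u \<omega>) \<partial>M) \<longlonglongrightarrow> (\<integral>\<omega>. b \<omega> * (\<Gamma>B \<omega> \<bullet> u \<omega>) \<partial>M)"
  proof (rule weighted_L2_limit[where C=C])
    show "\<bar>\<beta> n x\<bar> \<le> C" for n x unfolding \<beta>_def by (rule b2)
    show "AE x in M. (\<lambda>n. \<beta> n x) \<longlonglongrightarrow> b x" using ae by eventually_elim simp
  qed (use lim(2) smooth_cylindrical_L2(2)[OF Bs] u2 in \<open>simp_all\<close>)
  have w3: "(\<lambda>n. \<integral>\<omega>. \<gamma> n \<omega> * Z \<omega> \<partial>M) \<longlonglongrightarrow> (\<integral>\<omega>. g \<omega> * Z \<omega> \<partial>M)"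
  proof (rule integral_dominated_convergence[where w="\<lambda>\<omega>. E * \<bar>Z \<omega>\<bar>"])
    show "AE \<omega> in M. (\<lambda>n. \<gamma> n \<omega> * Z \<omega>) \<longlonglongrightarrow> g \<omega> * Z \<omega>"
      using ae by eventually_elim (intro tendsto_mult tendsto_const, simp)
    show "AE \<omega> in M. norm (\<gamma> n \<omega> * Z \<omega>) \<le> E * \<bar>Z \<omega>\<bar>" for n
      by (intro AE_I2) (simp add: \<gamma>_def abs_mult[of _ "Z _"] mult_right_mono b3)
  qed (use Zi in simp_all)
  have split: "(\<integral>\<omega>. (\<alpha> n \<omega> *\<^sub>R (1 *\<^sub>R h + \<sigma> *\<^sub>R \<Gamma>Fs n \<omega>) + \<beta> n \<omega> *\<^sub>R \<Gamma>Bs n \<omega>) \<bullet> u \<omega> \<partial>M) =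
     (\<integral>\<omega>. \<alpha> n \<omega> * ((h + \<sigma> *\<^sub>R \<Gamma>Fs n \<omega>) \<bullet> u \<omega>) \<partial>M) + (\<integral>\<omega>. \<beta> n \<omega> * (\<Gamma>Bs n \<omega> \<bullet> u \<omega>) \<partial>M)" for n
  proof -
    have i: "integrable M (\<lambda>\<omega>. w \<omega> * (K \<omega> \<bullet> u \<omega>))" if [measurable]: "w \<in> borel_measurable M" "K \<in> borel_measurable M"
      and w: "\<And>\<omega>. \<bar>w \<omega>\<bar> \<le> C" and K: "integrable M (\<lambda>\<omega>. (norm (K \<omega>))\<^sup>2)" for w :: "'w \<Rightarrow> real" and K :: "'w \<Rightarrow> 'h"
    proof (rule Bochner_Integration.integrable_bound)
      show "integrable M (\<lambda>\<omega>. C * (K \<omega> \<bullet> u \<omega>))"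
        by (intro Bochner_Integration.integrable_mult_right integrable_inner_L2 K u2) measurable
      show "AE \<omega> in M. norm (w \<omega> * (K \<omega> \<bullet> u \<omega>)) \<le> norm (C * (K \<omega> \<bullet> u \<omega>))"
        using w by (intro AE_I2) (auto simp: abs_mult intro!: mult_right_mono order_trans[OF w abs_ge_self])
    qed measurable
    have e: "(\<alpha> n \<omega> *\<^sub>R (h + \<sigma> *\<^sub>R \<Gamma>Fs n \<omega>) + \<beta> n \<omega> *\<^sub>R \<Gamma>Bs n \<omega>) \<bullet> u \<omega> =
      \<alpha> n \<omega> * ((h + \<sigma> *\<^sub>R \<Gamma>Fs n \<omega>) \<bullet> u \<omega>) + \<beta> n \<omega> * (\<Gamma>Bs n \<omega> \<bullet> u \<omega>)" for \<omega>
      by (simp only: inner_add_left[of "\<alpha> n \<omega> *\<^sub>R (h + \<sigma> *\<^sub>R \<Gamma>Fs n \<omega>)"] inner_scaleR_left)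
    show ?thesis unfolding scaleR_one e
    proof (rule Bochner_Integration.integral_add)
      show "integrable M (\<lambda>\<omega>. \<alpha> n \<omega> * ((h + \<sigma> *\<^sub>R \<Gamma>Fs n \<omega>) \<bullet> u \<omega>))"
        by (rule i) (measurable, unfold \<alpha>_def, rule b1, rule L2h)
      show "integrable M (\<lambda>\<omega>. \<beta> n \<omega> * (\<Gamma>Bs n \<omega> \<bullet> u \<omega>))"
        by (rule i) (measurable, unfold \<beta>_def, rule b2, rule smooth_cylindrical_L2(2)[OF Bs])
    qed
  qed
  have "(\<integral>\<omega>. g \<omega> * Z \<omega> \<partial>M) = (\<integral>\<omega>. a \<omega> * ((h + \<sigma> *\<^sub>R \<Gamma>F \<omega>) \<bullet> u \<omega>) \<partial>M) + (\<integral>\<omega>. b \<omega> * (\<Gamma>B \<omega> \<bullet> u \<omega>) \<partial>M)"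
    by (rule LIMSEQ_unique[OF w3[unfolded dual split] tendsto_add[OF w1 w2]])
  thus ?thesis unfolding a_def b_def g_def .
qed

end

section \<open>Test functions of class \<open>C\<^sup>2\<close>\<close>

text \<open>The one-dimensional version of the ball cutoff, with its first two derivatives written
  out: scaling the cutoff inside a product has to be followed through both of them.\<close>

lemma exists_C2_cutoff:
  obtains \<kappa> \<kappa>1 \<kappa>2 :: "real \<Rightarrow> real" and C where "C \<ge> 0"
    "\<And>t. (\<kappa> has_real_derivative \<kappa>1 t) (at t)" "\<And>t. (\<kappa>1 has_real_derivative \<kappa>2 t) (at t)"
    "continuous_on UNIV \<kappa>2" "\<And>t. 1 \<le> \<bar>t\<bar> \<Longrightarrow> \<kappa> t = 0 \<and> \<kappa>1 t = 0 \<and> \<kappa>2 t = 0"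
    "\<And>t. \<bar>\<kappa> t\<bar> \<le> C \<and> \<bar>\<kappa>1 t\<bar> \<le> C \<and> \<bar>\<kappa>2 t\<bar> \<le> C" "\<kappa> 0 = 1"
proof -
  define \<kappa> where "\<kappa> = (\<lambda>t::real. exp 1 * flat_exp 0 (1 - t\<^sup>2))"
  define \<kappa>1 where "\<kappa>1 = (\<lambda>t::real. exp 1 * (flat_exp 2 (1 - t\<^sup>2) * (- 2 * t)))"
  define \<kappa>2 where "\<kappa>2 = (\<lambda>t::real. exp 1 * ((flat_exp 4 (1 - t\<^sup>2) - 2 * flat_exp 3 (1 - t\<^sup>2)) * (- 2 * t) * (- 2 * t)
     + (- 2) * flat_exp 2 (1 - t\<^sup>2)))"
  have q: "((\<lambda>t. 1 - t\<^sup>2) has_real_derivative - 2 * t) (at t)" for t :: real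
    by (auto intro!: derivative_eq_intros)
  have f: "((\<lambda>t. flat_exp k (1 - t\<^sup>2)) has_real_derivative
      (flat_exp (k + 2) (1 - t\<^sup>2) - real k * flat_exp (Suc k) (1 - t\<^sup>2)) * (- 2 * t)) (at t)" for k t
    by (rule DERIV_chain2[OF DERIV_flat_exp q])
  have d1: "(\<kappa> has_real_derivative \<kappa>1 t) (at t)" for t
    using DERIV_cmult[OF f[of 0], of "exp 1"] unfolding \<kappa>_def \<kappa>1_def by (simp add: numeral_2_eq_2)
  have l: "((\<lambda>t. - 2 * t) has_real_derivative - 2) (at t)" for t :: real
    by (auto intro!: derivative_eq_intros)
  have "2 + 2 = (4::nat)" "Suc 2 = 3" by simp_all
  note f2 = f[of 2, unfolded this]
  have d2: "(\<kappa>1 has_real_derivative \<kappa>2 t) (at t)" for t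
    using DERIV_cmult[OF DERIV_mult[OF f2 l], of "exp 1"] unfolding \<kappa>1_def \<kappa>2_def by simp
  have c: "continuous_on UNIV (\<lambda>t::real. flat_exp k (1 - t\<^sup>2))" for k
    by (rule continuous_on_compose2[OF continuous_on_flat_exp]) (auto intro!: continuous_intros)
  have c2: "continuous_on UNIV \<kappa>2" unfolding \<kappa>2_def by (intro continuous_intros c)
  have c1: "continuous_on UNIV \<kappa>1" unfolding \<kappa>1_def by (intro continuous_intros c)
  have c0: "continuous_on UNIV \<kappa>" unfolding \<kappa>_def by (intro continuous_intros c)
  have z: "\<kappa> t = 0 \<and> \<kappa>1 t = 0 \<and> \<kappa>2 t = 0" if "1 \<le> \<bar>t\<bar>" for t
  proof -
    have "1 \<le> t\<^sup>2" using that by (simp add: abs_square_le_1 abs_le_square_iff[of 1 t, simplified])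
    thus ?thesis by (simp add: \<kappa>_def \<kappa>1_def \<kappa>2_def flat_exp_def)
  qed
  have b: "\<exists>B\<ge>0. \<forall>t. \<bar>g t\<bar> \<le> B" if g: "continuous_on UNIV g" and z: "\<And>t. 1 \<le> \<bar>t\<bar> \<Longrightarrow> g t = 0" for g :: "real \<Rightarrow> real"
  proof -
    have "bounded (g ` {-1..1})"
      by (intro compact_imp_bounded compact_continuous_image continuous_on_subset[OF g]) auto
    then obtain B where "\<forall>x\<in>g ` {-1..1}. norm x \<le> B" unfolding bounded_iff by blast
    hence B: "\<bar>g t\<bar> \<le> B" if "t \<in> {-1..1}" for t using that by simp
    have "\<bar>g t\<bar> \<le> max B 0" for t
      using B[of t] z[of t] by (cases "\<bar>t\<bar> \<le> 1") (auto simp: abs_le_iff)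
    thus ?thesis by (intro exI[of _ "max B 0"]) auto
  qed
  obtain B0 where B0: "B0 \<ge> 0" "\<And>t. \<bar>\<kappa> t\<bar> \<le> B0" using b[OF c0] z by auto
  obtain B1 where B1: "B1 \<ge> 0" "\<And>t. \<bar>\<kappa>1 t\<bar> \<le> B1" using b[OF c1] z by auto
  obtain B2 where B2: "B2 \<ge> 0" "\<And>t. \<bar>\<kappa>2 t\<bar> \<le> B2" using b[OF c2] z by auto
  show thesis
  proof (rule that[of "B0 + B1 + B2" \<kappa> \<kappa>1 \<kappa>2])
    show "\<bar>\<kappa> t\<bar> \<le> B0 + B1 + B2 \<and> \<bar>\<kappa>1 t\<bar> \<le> B0 + B1 + B2 \<and> \<bar>\<kappa>2 t\<bar> \<le> B0 + B1 + B2" for t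
      using B0(2)[of t] B1(2)[of t] B2(2)[of t] B0(1) B1(1) B2(1) by simp
    show "\<kappa> 0 = 1" by (simp add: \<kappa>_def flat_exp_def flip: exp_add)
  qed (use B0(1) B1(1) B2(1) d1 d2 c2 z in auto)
qed

text \<open>\<open>fourier_transfer\<close> for integrands that are products of a function of z and
  a function of w. At fixed z its hypothesis is the relation \<open>zero\<close> multiplied by the
  constant \<theta>(z).\<close>

lemma fourier_ibp_compact:
  fixes p q r Y :: "'a \<Rightarrow> real" and \<theta> \<theta>1 \<theta>2 :: "real \<Rightarrow> real"
  assumes W: "prob_space W" and Y[measurable]: "Y \<in> borel_measurable W"
    and p: "integrable W p" and q: "integrable W q" and r: "integrable W r"
    and zero: "\<And>l. (\<integral>w. (complex_of_real (p w) + \<i> * l * q w - (complex_of_real l)\<^sup>2 * r w) * cis (l * Y w) \<partial>W) = 0"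
    and d: "\<And>t. (\<theta> has_real_derivative \<theta>1 t) (at t)" "\<And>t. (\<theta>1 has_real_derivative \<theta>2 t) (at t)"
    and c: "continuous_on UNIV \<theta>2" and supp: "\<And>t. K \<le> \<bar>t\<bar> \<Longrightarrow> \<theta> t = 0 \<and> \<theta>1 t = 0 \<and> \<theta>2 t = 0"
    and b: "\<And>t. \<bar>\<theta> t\<bar> \<le> L" "\<And>t. \<bar>\<theta>1 t\<bar> \<le> L" "\<And>t. \<bar>\<theta>2 t\<bar> \<le> L"
  shows "(\<integral>w. p w * \<theta> (Y w) + q w * \<theta>1 (Y w) + r w * \<theta>2 (Y w) \<partial>W) = 0"
proof -
  note [measurable] = borel_measurable_integrable[OF p] borel_measurable_integrable[OF q] borel_measurable_integrable[OF r]
  have c0: "continuous_on UNIV \<theta>" and c1: "continuous_on UNIV \<theta>1"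
    by (intro continuous_at_imp_continuous_on ballI DERIV_isCont[OF d(1)] DERIV_isCont[OF d(2)])+
  have [measurable]: "\<theta> \<in> borel_measurable borel" "\<theta>1 \<in> borel_measurable borel" "\<theta>2 \<in> borel_measurable borel"
    by (intro borel_measurable_continuous_onI c0 c1 c)+
  define D where "D = (\<lambda>w. L * (\<bar>p w\<bar> + \<bar>q w\<bar> + \<bar>r w\<bar>))"
  have L0: "0 \<le> L" using b(1)[of 0] by simp
  have D: "integrable W D" unfolding D_def using p q r by simp
  have nb: "norm (complex_of_real x * complex_of_real (f w)) \<le> D w"
    if "\<bar>x\<bar> \<le> L" "f = p \<or> f = q \<or> f = r" for x f w
  proof -
    have "\<bar>x\<bar> * \<bar>f w\<bar> \<le> L * (\<bar>p w\<bar> + \<bar>q w\<bar> + \<bar>r w\<bar>)"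
      using that by (intro mult_mono L0) auto
    thus ?thesis by (simp add: norm_mult D_def)
  qed
  define P where "P = (\<lambda>(f::real \<Rightarrow> real) (g::'a \<Rightarrow> real) z w. complex_of_real (f z) * complex_of_real (g w))"
  have vd: "((\<lambda>z. P f g z w) has_vector_derivative P f' g z w) (at z)" if "(f has_real_derivative f' z) (at z)" for f f' g z w
    unfolding P_def by (intro has_vector_derivative_mult_left has_vector_derivative_of_real that)
  have "(\<integral>w. P \<theta> p (Y w) w + P \<theta>1 q (Y w) w + P \<theta>2 r (Y w) w \<partial>W) = 0"
  proof (rule fourier_transfer[where D=D and Q="P \<theta> q" and R="P \<theta> r" and R'="P \<theta>1 r" and K=K, OF W Y D])
    show "(\<lambda>(z, w). P \<theta> p z w) \<in> borel_measurable (borel \<Otimes>\<^sub>M W)"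
      "(\<lambda>(z, w). P \<theta> q z w) \<in> borel_measurable (borel \<Otimes>\<^sub>M W)"
      "(\<lambda>(z, w). P \<theta> r z w) \<in> borel_measurable (borel \<Otimes>\<^sub>M W)"
      "(\<lambda>(z, w). P \<theta>1 q z w) \<in> borel_measurable (borel \<Otimes>\<^sub>M W)"
      "(\<lambda>(z, w). P \<theta>2 r z w) \<in> borel_measurable (borel \<Otimes>\<^sub>M W)"
      unfolding P_def by measurable
    show "norm (P \<theta> p z w) \<le> D w" "norm (P \<theta> q z w) \<le> D w" "norm (P \<theta> r z w) \<le> D w"
      "norm (P \<theta>1 q z w) \<le> D w" "norm (P \<theta>2 r z w) \<le> D w" for z w
      unfolding P_def by (intro nb b; simp)+
    show "P \<theta> p z w = 0 \<and> P \<theta> q z w = 0 \<and> P \<theta> r z w = 0 \<and> P \<theta>1 q z w = 0 \<and> P \<theta>1 r z w = 0 \<and> P \<theta>2 r z w = 0"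
      if "K \<le> \<bar>z\<bar>" for z w using supp[OF that] by (simp add: P_def)
    show "((\<lambda>z. P \<theta> q z w) has_vector_derivative P \<theta>1 q z w) (at z)"
      "((\<lambda>z. P \<theta> r z w) has_vector_derivative P \<theta>1 r z w) (at z)"
      "((\<lambda>z. P \<theta>1 r z w) has_vector_derivative P \<theta>2 r z w) (at z)" for z w
      by (rule vd, rule d)+
    show "continuous_on UNIV (\<lambda>z. P \<theta> p z w)" "continuous_on UNIV (\<lambda>z. P \<theta>1 q z w)"
      "continuous_on UNIV (\<lambda>z. P \<theta>2 r z w)" for w
      unfolding P_def by (intro continuous_intros c0 c1 c)+
    show "(\<integral>w. (P \<theta> p z w + \<i> * l * P \<theta> q z w - (complex_of_real l)\<^sup>2 * P \<theta> r z w) * cis (l * Y w) \<partial>W) = 0" for z l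
    proof -
      have "(\<lambda>w. (P \<theta> p z w + \<i> * l * P \<theta> q z w - (complex_of_real l)\<^sup>2 * P \<theta> r z w) * cis (l * Y w))
       = (\<lambda>w. complex_of_real (\<theta> z) * ((complex_of_real (p w) + \<i> * l * q w - (complex_of_real l)\<^sup>2 * r w) * cis (l * Y w)))"
        unfolding P_def by (rule ext) (simp only: ring_distribs mult_ac)
      thus ?thesis using zero[of l] by simp
    qed
  qed
  also have "(\<integral>w. P \<theta> p (Y w) w + P \<theta>1 q (Y w) w + P \<theta>2 r (Y w) w \<partial>W)
      = (\<integral>w. complex_of_real (p w * \<theta> (Y w) + q w * \<theta>1 (Y w) + r w * \<theta>2 (Y w)) \<partial>W)"
    by (rule Bochner_Integration.integral_cong) (simp_all add: P_def mult.commute)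
  finally show ?thesis unfolding integral_complex_of_real by simp
qed

text \<open>Cut off by \<kappa>(e t) and let e tend to 0. Since the first derivative is bounded,
  \<theta> grows at most linearly; this is why \<open>p w * Y w\<close> has to be integrable, and
  why the terms with derivatives of the cutoff stay bounded and then vanish in the limit.\<close>

lemma fourier_ibp:
  fixes p q r Y :: "'a \<Rightarrow> real" and \<theta> \<theta>1 \<theta>2 :: "real \<Rightarrow> real"
  assumes W: "prob_space W" and Y[measurable]: "Y \<in> borel_measurable W"
    and p: "integrable W p" and q: "integrable W q" and r: "integrable W r"
    and pY: "integrable W (\<lambda>w. p w * Y w)"
    and zero: "\<And>l. (\<integral>w. (complex_of_real (p w) + \<i> * l * q w - (complex_of_real l)\<^sup>2 * r w) * cis (l * Y w) \<partial>W) = 0"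
    and d: "\<And>t. (\<theta> has_real_derivative \<theta>1 t) (at t)" "\<And>t. (\<theta>1 has_real_derivative \<theta>2 t) (at t)"
    and c: "continuous_on UNIV \<theta>2" and b: "\<And>t. \<bar>\<theta>1 t\<bar> \<le> C1" "\<And>t. \<bar>\<theta>2 t\<bar> \<le> C2"
  shows "(\<integral>w. p w * \<theta> (Y w) + q w * \<theta>1 (Y w) + r w * \<theta>2 (Y w) \<partial>W) = 0"
proof -
  obtain \<kappa> \<kappa>1 \<kappa>2 :: "real \<Rightarrow> real" and C where C: "C \<ge> 0"
    and dk: "\<And>t. (\<kappa> has_real_derivative \<kappa>1 t) (at t)" "\<And>t. (\<kappa>1 has_real_derivative \<kappa>2 t) (at t)"
    and ck: "continuous_on UNIV \<kappa>2" and sk: "\<And>t. 1 \<le> \<bar>t\<bar> \<Longrightarrow> \<kappa> t = 0 \<and> \<kappa>1 t = 0 \<and> \<kappa>2 t = 0"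
    and bk: "\<And>t. \<bar>\<kappa> t\<bar> \<le> C \<and> \<bar>\<kappa>1 t\<bar> \<le> C \<and> \<bar>\<kappa>2 t\<bar> \<le> C" and k0: "\<kappa> 0 = 1"
    by (rule exists_C2_cutoff, rule that; assumption)
  note [measurable] = borel_measurable_integrable[OF p] borel_measurable_integrable[OF q] borel_measurable_integrable[OF r]
  have c0: "continuous_on UNIV \<theta>" and c1: "continuous_on UNIV \<theta>1" and ck0: "continuous_on UNIV \<kappa>" and ck1: "continuous_on UNIV \<kappa>1"
    by (intro continuous_at_imp_continuous_on ballI DERIV_isCont[OF d(1)] DERIV_isCont[OF d(2)]
        DERIV_isCont[OF dk(1)] DERIV_isCont[OF dk(2)])+
  have [measurable]: "\<theta> \<in> borel_measurable borel" "\<theta>1 \<in> borel_measurable borel" "\<theta>2 \<in> borel_measurable borel"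
    "\<kappa> \<in> borel_measurable borel" "\<kappa>1 \<in> borel_measurable borel" "\<kappa>2 \<in> borel_measurable borel"
    by (intro borel_measurable_continuous_onI c0 c1 c ck0 ck1 ck)+
  have C12: "0 \<le> C1" "0 \<le> C2" using b(1)[of 0] b(2)[of 0] by simp_all
  define A where "A = \<bar>\<theta> 0\<bar>"
  have growth: "\<bar>\<theta> t\<bar> \<le> A + C1 * \<bar>t\<bar>" for t
  proof -
    have "norm (\<theta> t - \<theta> 0) \<le> C1 * norm (t - 0)"
      by (rule field_differentiable_bound[where S=UNIV and f'=\<theta>1]) (use d(1) b(1) in auto)
    thus ?thesis unfolding A_def by simp
  qed
  define e where "e = (\<lambda>n. inverse (real (Suc n)))"
  have e0: "0 < e n" "e n \<le> 1" for n by (simp_all add: e_def field_simps)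
  have elim: "e \<longlonglongrightarrow> 0" unfolding e_def by (rule LIMSEQ_inverse_real_of_nat)
  define f where "f = (\<lambda>n t. \<theta> t * \<kappa> (e n * t))"
  define f1 where "f1 = (\<lambda>n t. \<theta>1 t * \<kappa> (e n * t) + \<theta> t * (e n * \<kappa>1 (e n * t)))"
  define f2 where "f2 = (\<lambda>n t. \<theta>2 t * \<kappa> (e n * t) + 2 * (\<theta>1 t * (e n * \<kappa>1 (e n * t))) + \<theta> t * ((e n)\<^sup>2 * \<kappa>2 (e n * t)))"
  have de: "((\<lambda>t. e n * t) has_real_derivative e n) (at t)" for n t
    by (auto intro!: derivative_eq_intros)
  have df: "(f n has_real_derivative f1 n t) (at t)" for n t
    unfolding f_def f1_def using DERIV_mult[OF d(1)[of t] DERIV_chain2[OF dk(1) de[of n t]]] by (simp add: mult_ac)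
  have df1: "(f1 n has_real_derivative f2 n t) (at t)" for n t
  proof -
    note D = DERIV_add[OF DERIV_mult[OF d(2)[of t] DERIV_chain2[OF dk(1) de[of n t]]]
        DERIV_mult[OF d(1)[of t] DERIV_cmult[OF DERIV_chain2[OF dk(2) de[of n t]], of "e n"]]]
    show ?thesis unfolding f1_def
      by (rule DERIV_cong[OF D]) (simp add: f2_def power2_eq_square algebra_simps)
  qed
  \<comment> \<open>Where g (e t) does not vanish one has |e t| < 1, so the factor e absorbs the
    linear growth of \<theta>.\<close>
  have \<theta>e: "\<bar>\<theta> t\<bar> * (e n * \<bar>g (e n * t)\<bar>) \<le> (A + C1) * C"
    if "\<And>t. 1 \<le> \<bar>t\<bar> \<Longrightarrow> g t = 0" "\<And>t. \<bar>g t\<bar> \<le> C" for g :: "real \<Rightarrow> real" and n t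
  proof (cases "1 \<le> \<bar>e n * t\<bar>")
    case True
    thus ?thesis using that(1)[OF True] C C12 by (simp add: A_def)
  next
    case False
    have "\<bar>\<theta> t\<bar> * e n \<le> (A + C1 * \<bar>t\<bar>) * e n" using growth[of t] e0(1)[of n] by (intro mult_right_mono) auto
    also have "\<dots> = A * e n + C1 * \<bar>e n * t\<bar>" using e0(1)[of n] by (simp add: abs_mult algebra_simps)
    also have "\<dots> \<le> A * 1 + C1 * 1"
      using False e0[of n] C12 by (intro add_mono mult_left_mono) (auto simp: A_def)
    finally have "(\<bar>\<theta> t\<bar> * e n) * \<bar>g (e n * t)\<bar> \<le> (A + C1) * C"
      using that(2)[of "e n * t"] C12 by (intro mult_mono) (auto simp: A_def)
    thus ?thesis by (simp add: mult.assoc)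
  qed
  \<comment> \<open>The sum of the bounds for the three terms of \<open>f2\<close>; it also
    dominates \<open>f1\<close>.\<close>
  define L where "L = C2 * C + 2 * (C1 * C) + (A + C1) * C"
  have bf1: "\<bar>f1 n t\<bar> \<le> L" for n t
  proof -
    have "\<bar>f1 n t\<bar> \<le> \<bar>\<theta>1 t\<bar> * \<bar>\<kappa> (e n * t)\<bar> + \<bar>\<theta> t\<bar> * (e n * \<bar>\<kappa>1 (e n * t)\<bar>)"
      unfolding f1_def using e0(1)[of n] by (intro order_trans[OF abs_triangle_ineq]) (simp add: abs_mult)
    also have "\<dots> \<le> C1 * C + (A + C1) * C"
      using bk sk C12 by (intro add_mono mult_mono b \<theta>e) auto
    also have "\<dots> \<le> L" unfolding L_def using C C12 by simp
    finally show ?thesis .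
  qed
  have bf2: "\<bar>f2 n t\<bar> \<le> L" for n t
  proof -
    have "\<bar>f2 n t\<bar> \<le> \<bar>\<theta>2 t\<bar> * \<bar>\<kappa> (e n * t)\<bar> + 2 * (\<bar>\<theta>1 t\<bar> * (e n * \<bar>\<kappa>1 (e n * t)\<bar>)) + \<bar>\<theta> t\<bar> * (e n * (e n * \<bar>\<kappa>2 (e n * t)\<bar>))"
      unfolding f2_def using e0(1)[of n]
      by (intro order_trans[OF abs_triangle_ineq] add_mono) (simp_all add: abs_mult power2_eq_square mult.assoc)
    also have "\<dots> \<le> C2 * C + 2 * (C1 * (1 * C)) + (A + C1) * C"
    proof (intro add_mono)
      show "\<bar>\<theta>2 t\<bar> * \<bar>\<kappa> (e n * t)\<bar> \<le> C2 * C" using bk C12 by (intro mult_mono b) auto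
      show "2 * (\<bar>\<theta>1 t\<bar> * (e n * \<bar>\<kappa>1 (e n * t)\<bar>)) \<le> 2 * (C1 * (1 * C))"
        using bk C12 e0[of n] by (intro mult_left_mono mult_mono b) auto
      have "e n * (e n * \<bar>\<kappa>2 (e n * t)\<bar>) \<le> 1 * (e n * \<bar>\<kappa>2 (e n * t)\<bar>)"
        using e0[of n] by (intro mult_right_mono) auto
      hence "\<bar>\<theta> t\<bar> * (e n * (e n * \<bar>\<kappa>2 (e n * t)\<bar>)) \<le> \<bar>\<theta> t\<bar> * (e n * \<bar>\<kappa>2 (e n * t)\<bar>)"
        unfolding mult_1_left by (rule mult_left_mono) simp
      also have "\<dots> \<le> (A + C1) * C" using bk sk by (intro \<theta>e) auto
      finally show "\<bar>\<theta> t\<bar> * (e n * (e n * \<bar>\<kappa>2 (e n * t)\<bar>)) \<le> (A + C1) * C" .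
    qed
    finally show ?thesis unfolding L_def by simp
  qed
  have bf: "\<bar>f n t\<bar> \<le> (A + C1 * \<bar>t\<bar>) * C" for n t
    unfolding f_def abs_mult using growth bk C12 by (intro mult_mono) (auto simp: A_def)
  have L0: "0 \<le> L" using bf1[of 0 0] by simp
  \<comment> \<open>Here the bound may depend on n, since \<open>f n\<close> itself is not uniformly
    bounded; a uniform majorant is supplied only when n tends to infinity.\<close>
  have zeron: "(\<integral>w. p w * f n (Y w) + q w * f1 n (Y w) + r w * f2 n (Y w) \<partial>W) = 0" for n
  proof (rule fourier_ibp_compact[OF W Y p q r zero df df1, where K="real (Suc n)" and L="max L ((A + C1 * real (Suc n)) * C)"])
    show "continuous_on UNIV (f2 n)" unfolding f2_def
      by (intro continuous_intros c c0 c1 continuous_on_compose2[OF ck0] continuous_on_compose2[OF ck1] continuous_on_compose2[OF ck]) auto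
    have ge: "1 \<le> \<bar>e n * t\<bar>" if "real (Suc n) \<le> \<bar>t\<bar>" for t
      using that by (simp add: e_def abs_mult field_simps)
    show "f n t = 0 \<and> f1 n t = 0 \<and> f2 n t = 0" if "real (Suc n) \<le> \<bar>t\<bar>" for t
      using sk[OF ge[OF that]] by (simp add: f_def f1_def f2_def)
    show "\<bar>f n t\<bar> \<le> max L ((A + C1 * real (Suc n)) * C)" for t
    proof (cases "real (Suc n) \<le> \<bar>t\<bar>")
      case True thus ?thesis using sk[OF ge[OF True]] L0 by (simp add: f_def)
    next
      case False
      have "\<bar>f n t\<bar> \<le> (A + C1 * \<bar>t\<bar>) * C" by (rule bf)
      also have "\<dots> \<le> (A + C1 * real (Suc n)) * C"
        using False C C12 by (intro mult_right_mono add_mono mult_left_mono) auto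
      finally show ?thesis by simp
    qed
    show "\<bar>f1 n t\<bar> \<le> max L ((A + C1 * real (Suc n)) * C)" "\<bar>f2 n t\<bar> \<le> max L ((A + C1 * real (Suc n)) * C)" for t
      using bf1[of n t] bf2[of n t] by simp_all
  qed
  have "(\<lambda>n. \<integral>w. p w * f n (Y w) + q w * f1 n (Y w) + r w * f2 n (Y w) \<partial>W)
     \<longlonglongrightarrow> (\<integral>w. p w * \<theta> (Y w) + q w * \<theta>1 (Y w) + r w * \<theta>2 (Y w) \<partial>W)"
  proof (rule integral_dominated_convergence[where w="\<lambda>w. (A * \<bar>p w\<bar> + C1 * \<bar>p w * Y w\<bar>) * C + \<bar>q w\<bar> * L + \<bar>r w\<bar> * L"])
    show "integrable W (\<lambda>w. (A * \<bar>p w\<bar> + C1 * \<bar>p w * Y w\<bar>) * C + \<bar>q w\<bar> * L + \<bar>r w\<bar> * L)"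
      using p q r pY by simp
    show "(\<lambda>w. p w * f n (Y w) + q w * f1 n (Y w) + r w * f2 n (Y w)) \<in> borel_measurable W" for n
      unfolding f_def f1_def f2_def by measurable
    show "AE w in W. (\<lambda>n. p w * f n (Y w) + q w * f1 n (Y w) + r w * f2 n (Y w))
        \<longlonglongrightarrow> p w * \<theta> (Y w) + q w * \<theta>1 (Y w) + r w * \<theta>2 (Y w)"
    proof (rule AE_I2)
      fix w
      have et: "(\<lambda>n. e n * t) \<longlonglongrightarrow> 0" for t using tendsto_mult[OF elim tendsto_const[of t]] by simp
      have kt: "(\<lambda>n. g (e n * t)) \<longlonglongrightarrow> g 0" if "continuous_on UNIV g" for g :: "real \<Rightarrow> real" and t
        by (rule continuous_on_tendsto_compose[OF that et]) auto
      have "(\<lambda>n. p w * f n (Y w) + q w * f1 n (Y w) + r w * f2 n (Y w)) \<longlonglongrightarrow>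
        p w * (\<theta> (Y w) * \<kappa> 0) + q w * (\<theta>1 (Y w) * \<kappa> 0 + \<theta> (Y w) * (0 * \<kappa>1 0))
         + r w * (\<theta>2 (Y w) * \<kappa> 0 + 2 * (\<theta>1 (Y w) * (0 * \<kappa>1 0)) + \<theta> (Y w) * (0\<^sup>2 * \<kappa>2 0))"
        unfolding f_def f1_def f2_def
        by (intro tendsto_add tendsto_mult tendsto_const tendsto_power elim kt ck ck0 ck1)
      thus "(\<lambda>n. p w * f n (Y w) + q w * f1 n (Y w) + r w * f2 n (Y w))
        \<longlonglongrightarrow> p w * \<theta> (Y w) + q w * \<theta>1 (Y w) + r w * \<theta>2 (Y w)" by (simp add: k0)
    qed
    show "AE w in W. norm (p w * f n (Y w) + q w * f1 n (Y w) + r w * f2 n (Y w))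
       \<le> (A * \<bar>p w\<bar> + C1 * \<bar>p w * Y w\<bar>) * C + \<bar>q w\<bar> * L + \<bar>r w\<bar> * L" for n
    proof (rule AE_I2)
      fix w
      have "\<bar>p w\<bar> * \<bar>f n (Y w)\<bar> \<le> \<bar>p w\<bar> * ((A + C1 * \<bar>Y w\<bar>) * C)" by (intro mult_left_mono bf) auto
      also have "\<dots> = (A * \<bar>p w\<bar> + C1 * \<bar>p w * Y w\<bar>) * C" by (simp add: abs_mult algebra_simps)
      finally have 1: "\<bar>p w\<bar> * \<bar>f n (Y w)\<bar> \<le> (A * \<bar>p w\<bar> + C1 * \<bar>p w * Y w\<bar>) * C" .
      have 2: "\<bar>q w\<bar> * \<bar>f1 n (Y w)\<bar> \<le> \<bar>q w\<bar> * L" by (intro mult_left_mono bf1) auto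
      have 3: "\<bar>r w\<bar> * \<bar>f2 n (Y w)\<bar> \<le> \<bar>r w\<bar> * L" by (intro mult_left_mono bf2) auto
      have "\<bar>p w * f n (Y w) + q w * f1 n (Y w) + r w * f2 n (Y w)\<bar>
        \<le> \<bar>p w\<bar> * \<bar>f n (Y w)\<bar> + \<bar>q w\<bar> * \<bar>f1 n (Y w)\<bar> + \<bar>r w\<bar> * \<bar>f2 n (Y w)\<bar>"
        using abs_triangle_ineq[of "p w * f n (Y w) + q w * f1 n (Y w)" "r w * f2 n (Y w)"]
          abs_triangle_ineq[of "p w * f n (Y w)" "q w * f1 n (Y w)"] by (simp add: abs_mult)
      thus "norm (p w * f n (Y w) + q w * f1 n (Y w) + r w * f2 n (Y w))
       \<le> (A * \<bar>p w\<bar> + C1 * \<bar>p w * Y w\<bar>) * C + \<bar>q w\<bar> * L + \<bar>r w\<bar> * L"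
        using 1 2 3 by simp
    qed
  qed measurable
  hence "(\<lambda>n::nat. 0::real) \<longlonglongrightarrow> (\<integral>w. p w * \<theta> (Y w) + q w * \<theta>1 (Y w) + r w * \<theta>2 (Y w) \<partial>W)"
    unfolding zeron .
  thus ?thesis by (rule LIMSEQ_unique[OF _ tendsto_const])
qed

section \<open>Stein's identity for the standard normal law\<close>

text \<open>The identity variable under the standard normal law spans an isonormal process over the
  real line. General integration by parts then specialises to the expectation of y cis (t y), which
  is needed for the independent Gaussian variable.\<close>

lemma isonormal_std_normal: "isonormal std_normal_distribution (\<lambda>g y. g * y :: real)"
proof
  let ?G = std_normal_distribution
  interpret prob_space ?G by (rule prob_space_normal_density) simp
  have id: "distributed ?G lborel (\<lambda>y. y) std_normal_density"
    unfolding distributed_def by (auto simp: distr_id2)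
  have lin: "centered_gaussian ?G (\<lambda>y. c * y)" for c :: real
  proof (cases "c = 0")
    case True thus ?thesis by (simp add: centered_gaussian_def)
  next
    case False
    have "distributed ?G lborel (\<lambda>y. 0 + c * y) (normal_density (0 + c * 0) (\<bar>c\<bar> * 1))"
      by (rule normal_density_affine[OF id _ False]) simp
    thus ?thesis using False unfolding centered_gaussian_def by (intro conjI disjI2 exI[of _ "\<bar>c\<bar>"]) auto
  qed
  have 2: "(\<integral>y. y\<^sup>2 \<partial>?G) = 1" using std_normal_distribution_even_moments(1)[of 1] by simp
  have "(\<integral>y. g * y * (h * y) \<partial>?G) = g * h" for g h :: real
  proof -
    have "(\<lambda>y. g * y * (h * y)) = (\<lambda>y. (g * h) * y\<^sup>2)" by (simp add: power2_eq_square fun_eq_iff)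
    thus ?thesis using 2 by simp
  qed
  moreover have "centered_gaussian_family ?G (\<lambda>g y. g * y :: real)"
    unfolding centered_gaussian_family_def
  proof (intro allI impI)
    fix J and c :: "real \<Rightarrow> real"
    have "(\<lambda>y. \<Sum>i\<in>J. c i * (i * y)) = (\<lambda>y. (\<Sum>i\<in>J. c i * i) * y)"
      by (simp add: sum_distrib_right mult.assoc)
    thus "centered_gaussian ?G (\<lambda>y. \<Sum>i\<in>J. c i * (i * y))" using lin by simp
  qed
  ultimately show "isonormal_process ?G (\<lambda>g y. g * y :: real)"
    unfolding isonormal_process_def using prob_space_axioms by simp
qed

lemma integral_id_cis_std_normal:
  "(\<integral>y. complex_of_real y * cis (t * y) \<partial>std_normal_distribution) = \<i> * t * exp (- t\<^sup>2 / 2)"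
  using isonormal.integral_X_cis[OF isonormal_std_normal, of t 1] integral_cis_std_normal[of t]
  by (simp add: mult.commute)

section \<open>The interpolation\<close>

text \<open>\<open>\<Gamma>F\<close> and \<open>\<Gamma>B\<close> are versions of the derivatives of \<open>F\<close> and \<open>S\<^sup>2\<close>. On the product space the second
  coordinate plays the role of \<open>\<eta>\<close>, and \<open>Y (sin s) (cos s)\<close> is the interpolation at time \<open>s\<close>.\<close>

locale divergence_setting = isonormal M X
  for M :: "'w measure" and X :: "'h::{real_inner,banach,second_countable_topology} \<Rightarrow> 'w \<Rightarrow> real" +
  fixes F S :: "'w \<Rightarrow> real" and \<Gamma>F \<Gamma>B u :: "'w \<Rightarrow> 'h" and h :: 'h
  assumes u: "u \<in> D12_vec M X" "has_divergence M X u F"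
    and F: "has_malliavin_derivative M X F \<Gamma>F"
    and S[measurable]: "S \<in> borel_measurable M"
    and B: "has_malliavin_derivative M X (\<lambda>\<omega>. (S \<omega>)\<^sup>2) \<Gamma>B"
begin

abbreviation G where "G \<equiv> std_normal_distribution"
abbreviation W where "W \<equiv> M \<Otimes>\<^sub>M std_normal_distribution"

sublocale G: prob_space G by (rule prob_space_normal_density) simp
sublocale W: pair_prob_space M G ..

lemma meas[measurable]: "F \<in> borel_measurable M" "\<Gamma>F \<in> borel_measurable M" "\<Gamma>B \<in> borel_measurable M" "u \<in> borel_measurable M"
  using malliavin_derivative_L2(1,2)[OF F] malliavin_derivative_L2(2)[OF B] u(2)
  unfolding has_divergence_def by blast+

definition dF where "dF \<omega> = \<Gamma>F \<omega> \<bullet> u \<omega>"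
definition dB where "dB \<omega> = \<Gamma>B \<omega> \<bullet> u \<omega>"
definition dh where "dh \<omega> = h \<bullet> u \<omega>"
text \<open>A majorant of all interpolants and of their time derivatives, uniform in time. Its
  square integrability is behind every domination argument of this part.\<close>

definition T where "T w = \<bar>X h (fst w)\<bar> + \<bar>F (fst w)\<bar> + \<bar>S (fst w) * snd w\<bar>"
definition Y where "Y \<sigma> \<tau> w = X h (fst w) + \<sigma> * F (fst w) + \<tau> * (S (fst w) * snd w)"

lemma meas2[measurable]: "dF \<in> borel_measurable M" "dB \<in> borel_measurable M" "dh \<in> borel_measurable M"
  "T \<in> borel_measurable W" "Y \<sigma> \<tau> \<in> borel_measurable W"
  unfolding dF_def[abs_def] dB_def[abs_def] dh_def[abs_def] T_def[abs_def] Y_def[abs_def] by measurable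

lemma integrable_M: "integrable M F" "integrable M (\<lambda>\<omega>. (F \<omega>)\<^sup>2)" "integrable M (\<lambda>\<omega>. (S \<omega>)\<^sup>2)" "integrable M S"
  "integrable M dF" "integrable M dB" "integrable M dh"
proof -
  show F2: "integrable M (\<lambda>\<omega>. (F \<omega>)\<^sup>2)" using malliavin_derivative_L2(3)[OF F] by simp
  thus "integrable M F" by (rule square_integrable_imp_integrable[rotated]) measurable
  \<comment> \<open>The squared variable lies in the domain of D and hence in L2, so S has a fourth
    moment and all lower ones.\<close>
  have "integrable M (\<lambda>\<omega>. ((S \<omega>)\<^sup>2)\<^sup>2)" using malliavin_derivative_L2(3)[OF B] by simp
  thus S2: "integrable M (\<lambda>\<omega>. (S \<omega>)\<^sup>2)" by (rule square_integrable_imp_integrable[rotated]) measurable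
  thus "integrable M S" by (rule square_integrable_imp_integrable[rotated]) measurable
  have u2: "integrable M (\<lambda>\<omega>. (norm (u \<omega>))\<^sup>2)" using u(2) unfolding has_divergence_def by blast
  show "integrable M dF" unfolding dF_def[abs_def]
    by (intro integrable_inner_L2 malliavin_derivative_L2(4)[OF F] u2) measurable
  show "integrable M dB" unfolding dB_def[abs_def]
    by (intro integrable_inner_L2 malliavin_derivative_L2(4)[OF B] u2) measurable
  show "integrable M dh" unfolding dh_def[abs_def]
    by (intro integrable_inner_L2 u2) simp_all
qed

lemma integrable_fst_W: "integrable M f \<Longrightarrow> integrable W (\<lambda>w. f (fst w))" for f :: "'w \<Rightarrow> real"
  using W.integrable_product_mult[of f "\<lambda>_. 1"] by simp

lemma integral_fst_W:
  fixes f :: "'w \<Rightarrow> real"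
  assumes "integrable M f" shows "(\<integral>w. f (fst w) \<partial>W) = (\<integral>\<omega>. f \<omega> \<partial>M)"
proof -
  have "measure G UNIV = 1" using G.prob_space by simp
  thus ?thesis using W.integral_fst'[OF integrable_fst_W[OF assms]] by simp
qed

lemma integrable_T: "integrable W (\<lambda>w. (T w)\<^sup>2)" "integrable W T"
proof -
  have "integrable G (\<lambda>y. y\<^sup>2)" by (rule integrable_std_normal_distribution_moment)
  from W.integrable_product_mult[OF integrable_M(3) this]
  have 1: "integrable W (\<lambda>w. (S (fst w))\<^sup>2 * (snd w)\<^sup>2)" .
  have 2: "integrable W (\<lambda>w. 3 * ((X h (fst w))\<^sup>2 + (F (fst w))\<^sup>2 + (S (fst w))\<^sup>2 * (snd w)\<^sup>2))"
    by (intro Bochner_Integration.integrable_mult_right Bochner_Integration.integrable_add 1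
        integrable_fst_W[OF X_sq_integrable] integrable_fst_W[OF integrable_M(2)])
  show 3: "integrable W (\<lambda>w. (T w)\<^sup>2)"
  proof (rule Bochner_Integration.integrable_bound[OF 2])
    have sq: "(a + b + c)\<^sup>2 \<le> 3 * (a\<^sup>2 + b\<^sup>2 + c\<^sup>2)" for a b c :: real
      using sum_squares_bound[of a b] sum_squares_bound[of b c] sum_squares_bound[of a c]
      by (simp add: power2_eq_square algebra_simps)
    have "(T w)\<^sup>2 \<le> 3 * ((X h (fst w))\<^sup>2 + (F (fst w))\<^sup>2 + (S (fst w))\<^sup>2 * (snd w)\<^sup>2)" for w
      using sq[of "\<bar>X h (fst w)\<bar>" "\<bar>F (fst w)\<bar>" "\<bar>S (fst w) * snd w\<bar>"]
      unfolding T_def power2_abs power_mult_distrib .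
    thus "AE w in W. norm ((T w)\<^sup>2) \<le> norm (3 * ((X h (fst w))\<^sup>2 + (F (fst w))\<^sup>2 + (S (fst w))\<^sup>2 * (snd w)\<^sup>2))"
      by (intro AE_I2) (simp add: abs_of_nonneg)
  qed measurable
  show "integrable W T" by (rule W.square_integrable_imp_integrable[OF _ 3]) measurable
qed

text \<open>The real and imaginary parts are \<open>divergence_cos_identity\<close> with phase 0 and
  phase -pi/2, with all terms collected on one side.\<close>

lemma integral_weighted_cis:
  "(\<integral>\<omega>. (complex_of_real (F \<omega>) - \<i> * l * (dh \<omega> + \<sigma> * dF \<omega>) + \<mu> * dB \<omega>) * cis (l * (X h \<omega> + \<sigma> * F \<omega>)) * exp (- \<mu> * (S \<omega>)\<^sup>2) \<partial>M) = 0"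
  if \<mu>: "0 \<le> \<mu>"
proof -
  define x where "x = (\<lambda>\<omega>. l * (X h \<omega> + \<sigma> * F \<omega>))"
  define a where "a = (\<lambda>\<omega>. dh \<omega> + \<sigma> * dF \<omega>)"
  define E where "E = (\<lambda>\<omega>. exp (- \<mu> * (S \<omega>)\<^sup>2))"
  have [measurable]: "x \<in> borel_measurable M" "a \<in> borel_measurable M" "E \<in> borel_measurable M"
    unfolding x_def a_def E_def by measurable
  have E: "0 \<le> E \<omega>" "E \<omega> \<le> 1" for \<omega> using \<mu> by (simp_all add: E_def)
  have a: "integrable M a" unfolding a_def using integrable_M by simp
  have i: "integrable M (\<lambda>\<omega>. g \<omega> * E \<omega> * f \<omega>)"
    if "integrable M f" "g \<in> borel_measurable M" "\<And>\<omega>. \<bar>g \<omega>\<bar> \<le> 1" for f g :: "'w \<Rightarrow> real"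
  proof (rule Bochner_Integration.integrable_bound[OF that(1)])
    show "(\<lambda>\<omega>. g \<omega> * E \<omega> * f \<omega>) \<in> borel_measurable M" using that by measurable
    have "\<bar>g \<omega>\<bar> * \<bar>E \<omega>\<bar> \<le> 1 * 1" for \<omega> using that(3) E by (intro mult_mono) auto
    thus "AE \<omega> in M. norm (g \<omega> * E \<omega> * f \<omega>) \<le> norm (f \<omega>)"
      by (intro AE_I2) (simp add: abs_mult mult_left_le_one_le)
  qed
  note ib = i[OF integrable_M(1)] i[OF integrable_M(6)] i[OF a]
  have ah: "(h + \<sigma> *\<^sub>R \<Gamma>F \<omega>) \<bullet> u \<omega> = a \<omega>" for \<omega>
    by (simp add: a_def dh_def dF_def inner_add_left)
  have id: "(\<integral>\<omega>. cos (x \<omega> + c) * E \<omega> * F \<omega> \<partial>M)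
     = - l * (\<integral>\<omega>. sin (x \<omega> + c) * E \<omega> * a \<omega> \<partial>M) - \<mu> * (\<integral>\<omega>. cos (x \<omega> + c) * E \<omega> * dB \<omega> \<partial>M)" for c
  proof -
    have "(\<integral>\<omega>. cos (x \<omega> + c) * E \<omega> * F \<omega> \<partial>M) = (\<integral>\<omega>. (- l) * (sin (x \<omega> + c) * E \<omega> * a \<omega>) \<partial>M)
      + (\<integral>\<omega>. (- \<mu>) * (cos (x \<omega> + c) * E \<omega> * dB \<omega>) \<partial>M)"
      using divergence_cos_identity[OF u F B _ \<mu>, of l h \<sigma> c]
      unfolding ah dB_def[symmetric] x_def[symmetric] E_def[symmetric] by (simp add: x_def E_def mult_ac)
    thus ?thesis by simp
  qed
  define R where "R = (\<lambda>\<omega>. cos (x \<omega>) * E \<omega> * F \<omega> + l * (sin (x \<omega>) * E \<omega> * a \<omega>) + \<mu> * (cos (x \<omega>) * E \<omega> * dB \<omega>))"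
  define I where "I = (\<lambda>\<omega>. sin (x \<omega>) * E \<omega> * F \<omega> - l * (cos (x \<omega>) * E \<omega> * a \<omega>) + \<mu> * (sin (x \<omega>) * E \<omega> * dB \<omega>))"
  have cb: "\<And>\<omega>. \<bar>cos (x \<omega>)\<bar> \<le> 1" "\<And>\<omega>. \<bar>sin (x \<omega>)\<bar> \<le> 1"
    "(\<lambda>\<omega>. cos (x \<omega>)) \<in> borel_measurable M" "(\<lambda>\<omega>. sin (x \<omega>)) \<in> borel_measurable M" by simp_all
  note ic = ib[OF cb(3,1)] ib[OF cb(4,2)]
  have Ri: "integrable M R" "integrable M I" unfolding R_def I_def
    by (intro Bochner_Integration.integrable_add Bochner_Integration.integrable_diff
        Bochner_Integration.integrable_mult_right ic)+
  have R0: "(\<integral>\<omega>. R \<omega> \<partial>M) = 0"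
    unfolding R_def using id[of 0] ic by simp
  \<comment> \<open>The shift by -pi/2 turns the cosine of the identity into a sine and its sine
    into minus a cosine, giving the imaginary part.\<close>
  have sh: "cos (t - pi / 2) = sin t" "sin (t - pi / 2) = - cos t" for t :: real
    by (simp_all add: cos_diff sin_diff)
  have "(\<integral>\<omega>. sin (x \<omega>) * E \<omega> * F \<omega> \<partial>M)
     = - l * (\<integral>\<omega>. - cos (x \<omega>) * E \<omega> * a \<omega> \<partial>M) - \<mu> * (\<integral>\<omega>. sin (x \<omega>) * E \<omega> * dB \<omega> \<partial>M)"
    using id[of "- pi / 2"] by (simp add: sh)
  hence I0: "(\<integral>\<omega>. I \<omega> \<partial>M) = 0"
    unfolding I_def using ic by simp
  have "(complex_of_real (F \<omega>) - \<i> * l * (dh \<omega> + \<sigma> * dF \<omega>) + \<mu> * dB \<omega>) * cis (l * (X h \<omega> + \<sigma> * F \<omega>)) * exp (- \<mu> * (S \<omega>)\<^sup>2)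
     = complex_of_real (R \<omega>) + \<i> * complex_of_real (I \<omega>)" for \<omega>
    unfolding x_def[symmetric] E_def[symmetric] a_def[symmetric] R_def I_def
    by (simp add: complex_eq_iff algebra_simps a_def x_def E_def)
  hence "(\<integral>\<omega>. (complex_of_real (F \<omega>) - \<i> * l * (dh \<omega> + \<sigma> * dF \<omega>) + \<mu> * dB \<omega>) * cis (l * (X h \<omega> + \<sigma> * F \<omega>)) * exp (- \<mu> * (S \<omega>)\<^sup>2) \<partial>M)
    = (\<integral>\<omega>. complex_of_real (R \<omega>) + \<i> * complex_of_real (I \<omega>) \<partial>M)" by simp
  also have "\<dots> = complex_of_real (\<integral>\<omega>. R \<omega> \<partial>M) + \<i> * complex_of_real (\<integral>\<omega>. I \<omega> \<partial>M)"
    using Ri by simp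
  finally show ?thesis by (simp add: R0 I0)
qed

text \<open>Integrate the Gaussian coordinate first: its character averages to exp (-(l \<tau> S)^2
  / 2), which leaves \<open>integral_weighted_cis\<close> with \<mu> = l^2 \<tau>^2 / 2. This is how
  the derivative of S^2, rather than of S, enters.\<close>

lemma fourier_zero_F:
  "(\<integral>w. (complex_of_real (F (fst w)) - \<i> * l * (dh (fst w) + \<sigma> * dF (fst w)) + (l\<^sup>2 * \<tau>\<^sup>2 / 2) * dB (fst w)) * cis (l * Y \<sigma> \<tau> w) \<partial>W) = 0"
  "integrable W (\<lambda>w. (complex_of_real (F (fst w)) - \<i> * l * (dh (fst w) + \<sigma> * dF (fst w)) + (l\<^sup>2 * \<tau>\<^sup>2 / 2) * dB (fst w)) * cis (l * Y \<sigma> \<tau> w))"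
proof -
  define k where "k = (\<lambda>\<omega>. complex_of_real (F \<omega>) - \<i> * l * (dh \<omega> + \<sigma> * dF \<omega>) + (l\<^sup>2 * \<tau>\<^sup>2 / 2) * dB \<omega>)"
  have km[measurable]: "k \<in> borel_measurable M" unfolding k_def by measurable
  have ki: "integrable M k" unfolding k_def using integrable_M by simp
  have "integrable W (\<lambda>w. norm (k (fst w)))" using ki by (intro integrable_fst_W) simp
  hence i: "integrable W (\<lambda>w. k (fst w) * cis (l * Y \<sigma> \<tau> w))"
    by (rule Bochner_Integration.integrable_bound) (auto simp: norm_mult, simp add: cis_conv_exp)
  have "(\<integral>w. k (fst w) * cis (l * Y \<sigma> \<tau> w) \<partial>W) = (\<integral>\<omega>. (\<integral>y. k \<omega> * cis (l * Y \<sigma> \<tau> (\<omega>, y)) \<partial>G) \<partial>M)"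
    using W.integral_fst'[OF i] by simp
  also have "\<dots> = (\<integral>\<omega>. k \<omega> * cis (l * (X h \<omega> + \<sigma> * F \<omega>)) * exp (- (l\<^sup>2 * \<tau>\<^sup>2 / 2) * (S \<omega>)\<^sup>2) \<partial>M)"
  proof (intro Bochner_Integration.integral_cong refl)
    fix \<omega>
    have "cis (l * Y \<sigma> \<tau> (\<omega>, y)) = cis (l * (X h \<omega> + \<sigma> * F \<omega>)) * cis ((l * \<tau> * S \<omega>) * y)" for y
      by (simp add: Y_def cis_mult algebra_simps)
    hence "(\<integral>y. k \<omega> * cis (l * Y \<sigma> \<tau> (\<omega>, y)) \<partial>G)
      = k \<omega> * cis (l * (X h \<omega> + \<sigma> * F \<omega>)) * (\<integral>y. cis ((l * \<tau> * S \<omega>) * y) \<partial>G)"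
      by (simp add: mult.assoc)
    also have "\<dots> = k \<omega> * cis (l * (X h \<omega> + \<sigma> * F \<omega>)) * exp (- (l * \<tau> * S \<omega>)\<^sup>2 / 2)"
      unfolding integral_cis_std_normal ..
    also have "- (l * \<tau> * S \<omega>)\<^sup>2 / 2 = - (l\<^sup>2 * \<tau>\<^sup>2 / 2) * (S \<omega>)\<^sup>2" by (simp add: power_mult_distrib)
    finally show "(\<integral>y. k \<omega> * cis (l * Y \<sigma> \<tau> (\<omega>, y)) \<partial>G)
      = k \<omega> * cis (l * (X h \<omega> + \<sigma> * F \<omega>)) * exp (- (l\<^sup>2 * \<tau>\<^sup>2 / 2) * (S \<omega>)\<^sup>2)" .
  qed
  also have "\<dots> = 0"
    unfolding k_def by (rule integral_weighted_cis) simp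
  finally show "(\<integral>w. (complex_of_real (F (fst w)) - \<i> * l * (dh (fst w) + \<sigma> * dF (fst w)) + (l\<^sup>2 * \<tau>\<^sup>2 / 2) * dB (fst w)) * cis (l * Y \<sigma> \<tau> w) \<partial>W) = 0"
    unfolding k_def .
  show "integrable W (\<lambda>w. (complex_of_real (F (fst w)) - \<i> * l * (dh (fst w) + \<sigma> * dF (fst w)) + (l\<^sup>2 * \<tau>\<^sup>2 / 2) * dB (fst w)) * cis (l * Y \<sigma> \<tau> w))"
    using i unfolding k_def .
qed

text \<open>For each fixed \<omega> this is Gaussian integration by parts in the second coordinate
  alone, with frequency l \<tau> S(\<omega>); no derivative of S is involved.\<close>

lemma fourier_zero_S:
  "(\<integral>w. (complex_of_real (S (fst w) * snd w) - \<i> * l * (\<tau> * (S (fst w))\<^sup>2)) * cis (l * Y \<sigma> \<tau> w) \<partial>W) = 0"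
  "integrable W (\<lambda>w. (complex_of_real (S (fst w) * snd w) - \<i> * l * (\<tau> * (S (fst w))\<^sup>2)) * cis (l * Y \<sigma> \<tau> w))"
proof -
  have iy: "integrable G (\<lambda>y. y)" using integrable_std_normal_distribution_moment[of 1] by simp
  have Sy: "integrable W (\<lambda>w. S (fst w) * snd w)" by (rule W.integrable_product_mult[OF integrable_M(4) iy])
  have "integrable W (\<lambda>w. norm (complex_of_real (S (fst w) * snd w) - \<i> * l * (\<tau> * (S (fst w))\<^sup>2)))"
    by (intro Bochner_Integration.integrable_norm Bochner_Integration.integrable_diff integrable_of_real Sy
        Bochner_Integration.integrable_mult_right integrable_fst_W[OF integrable_M(3)])
  thus i: "integrable W (\<lambda>w. (complex_of_real (S (fst w) * snd w) - \<i> * l * (\<tau> * (S (fst w))\<^sup>2)) * cis (l * Y \<sigma> \<tau> w))"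
    by (rule Bochner_Integration.integrable_bound) (simp add: cis_conv_exp, simp add: norm_mult)
  have "(\<integral>y. (complex_of_real (S \<omega> * y) - \<i> * l * (\<tau> * (S \<omega>)\<^sup>2)) * cis (l * Y \<sigma> \<tau> (\<omega>, y)) \<partial>G) = 0" for \<omega>
  proof -
    let ?t = "l * \<tau> * S \<omega>"
    have ic: "integrable G (\<lambda>y. cis (?t * y))" "integrable G (\<lambda>y. complex_of_real y * cis (?t * y))"
      by (rule G.integrable_const_bound[of _ 1], simp, simp add: cis_conv_exp,
          rule Bochner_Integration.integrable_bound[OF iy], simp add: cis_conv_exp, simp add: norm_mult)
    have "(complex_of_real (S \<omega> * y) - \<i> * l * (\<tau> * (S \<omega>)\<^sup>2)) * cis (l * Y \<sigma> \<tau> (\<omega>, y)) =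
      cis (l * (X h \<omega> + \<sigma> * F \<omega>)) * (complex_of_real (S \<omega>) * (complex_of_real y * cis (?t * y)) - \<i> * l * (\<tau> * (S \<omega>)\<^sup>2) * cis (?t * y))" for y
    proof -
      have "cis (l * Y \<sigma> \<tau> (\<omega>, y)) = cis (l * (X h \<omega> + \<sigma> * F \<omega>)) * cis (?t * y)"
        by (simp add: Y_def cis_mult algebra_simps)
      thus ?thesis by (simp add: algebra_simps)
    qed
    hence "(\<integral>y. (complex_of_real (S \<omega> * y) - \<i> * l * (\<tau> * (S \<omega>)\<^sup>2)) * cis (l * Y \<sigma> \<tau> (\<omega>, y)) \<partial>G) =
      cis (l * (X h \<omega> + \<sigma> * F \<omega>)) * (complex_of_real (S \<omega>) * (\<integral>y. complex_of_real y * cis (?t * y) \<partial>G) - \<i> * l * (\<tau> * (S \<omega>)\<^sup>2) * (\<integral>y. cis (?t * y) \<partial>G))"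
      using ic by simp
    also have "\<dots> = 0"
      unfolding integral_id_cis_std_normal integral_cis_std_normal by (simp add: power2_eq_square mult_ac)
    finally show ?thesis .
  qed
  thus "(\<integral>w. (complex_of_real (S (fst w) * snd w) - \<i> * l * (\<tau> * (S (fst w))\<^sup>2)) * cis (l * Y \<sigma> \<tau> w) \<partial>W) = 0"
    using W.integral_fst'[OF i] by simp
qed

lemma abs_Y_le: "\<bar>\<sigma>\<bar> \<le> 1 \<Longrightarrow> \<bar>\<tau>\<bar> \<le> 1 \<Longrightarrow> \<bar>Y \<sigma> \<tau> w\<bar> \<le> T w"
proof -
  assume st: "\<bar>\<sigma>\<bar> \<le> 1" "\<bar>\<tau>\<bar> \<le> 1"
  have "\<bar>Y \<sigma> \<tau> w\<bar> \<le> \<bar>X h (fst w)\<bar> + \<bar>\<sigma> * F (fst w)\<bar> + \<bar>\<tau> * (S (fst w) * snd w)\<bar>"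
    unfolding Y_def by (intro order_trans[OF abs_triangle_ineq] add_mono) simp_all
  also have "\<dots> \<le> \<bar>X h (fst w)\<bar> + 1 * \<bar>F (fst w)\<bar> + 1 * \<bar>S (fst w) * snd w\<bar>"
    unfolding abs_mult[of \<sigma>] abs_mult[of \<tau>] using st by (intro add_mono mult_right_mono) auto
  finally show ?thesis unfolding T_def by simp
qed

text \<open>With \<sigma> = sin s and \<tau> = cos s the left side is the time derivative of the
  expectation. The combination \<tau> times \<open>fourier_zero_F\<close> minus \<sigma> times
  \<open>fourier_zero_S\<close> has the shape required by \<open>fourier_ibp\<close>, which converts
  the term with \<phi>1 into terms with \<phi>2 and \<phi>3.\<close>

lemma interpolation_ibp:
  fixes \<phi>1 \<phi>2 \<phi>3 :: "real \<Rightarrow> real"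
  assumes d: "\<And>t. (\<phi>1 has_real_derivative \<phi>2 t) (at t)" "\<And>t. (\<phi>2 has_real_derivative \<phi>3 t) (at t)"
    and c: "continuous_on UNIV \<phi>3" and b: "\<And>t. \<bar>\<phi>2 t\<bar> \<le> C2" "\<And>t. \<bar>\<phi>3 t\<bar> \<le> C3"
    and st: "0 \<le> \<sigma>" "\<sigma> \<le> 1" "0 \<le> \<tau>" "\<tau> \<le> 1"
  shows "\<bar>\<integral>w. (\<tau> * F (fst w) - \<sigma> * (S (fst w) * snd w)) * \<phi>1 (Y \<sigma> \<tau> w) \<partial>W\<bar>
    \<le> C2 * (\<tau> * (\<integral>\<omega>. \<bar>dh \<omega>\<bar> \<partial>M) + \<sigma> * \<tau> * (\<integral>\<omega>. \<bar>dF \<omega> - (S \<omega>)\<^sup>2\<bar> \<partial>M)) + C3 * (\<tau> ^ 3 / 2 * (\<integral>\<omega>. \<bar>dB \<omega>\<bar> \<partial>M))"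
proof -
  define p where "p = (\<lambda>w. \<tau> * F (fst w) - \<sigma> * (S (fst w) * snd w))"
  \<comment> \<open>The signs of \<open>q\<close> and \<open>r\<close> are fixed by p + i l q - l^2
    r: the relation contains -i l q0 and + l^2 \<tau>^3 / 2 dB, so both come out negative. One
    factor \<tau> in \<tau>^3 is the prefactor of F, the other two come from the Gaussian
    average.\<close>
  define q0 where "q0 = (\<lambda>\<omega>. \<tau> * dh \<omega> + \<sigma> * \<tau> * (dF \<omega> - (S \<omega>)\<^sup>2))"
  define q where "q = (\<lambda>w::'w \<times> real. - q0 (fst w))"
  define r where "r = (\<lambda>w::'w \<times> real. - (\<tau> ^ 3 / 2) * dB (fst w))"
  have q0: "integrable M q0" unfolding q0_def using integrable_M by simp
  have pm[measurable]: "p \<in> borel_measurable W" unfolding p_def by measurable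
  have \<phi>m[measurable]: "\<phi>1 \<in> borel_measurable borel" "\<phi>2 \<in> borel_measurable borel" "\<phi>3 \<in> borel_measurable borel"
    by (intro borel_measurable_continuous_onI c continuous_at_imp_continuous_on ballI DERIV_isCont[OF d(1)] DERIV_isCont[OF d(2)])+
  have pT: "\<bar>p w\<bar> \<le> T w" for w
  proof -
    have "\<bar>p w\<bar> \<le> \<tau> * \<bar>F (fst w)\<bar> + \<sigma> * \<bar>S (fst w) * snd w\<bar>"
      unfolding p_def using st by (intro order_trans[OF abs_triangle_ineq4]) (simp add: abs_mult)
    also have "\<dots> \<le> 1 * \<bar>F (fst w)\<bar> + 1 * \<bar>S (fst w) * snd w\<bar>"
      using st by (intro add_mono mult_right_mono) auto
    finally show ?thesis unfolding T_def by simp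
  qed
  have YT: "\<bar>Y \<sigma> \<tau> w\<bar> \<le> T w" for w using st by (intro abs_Y_le) auto
  have T0: "0 \<le> T w" for w unfolding T_def by simp
  have pi: "integrable W p"
    by (rule Bochner_Integration.integrable_bound[OF integrable_T(2)]) (use pT T0 in auto)
  have pYi: "integrable W (\<lambda>w. p w * Y \<sigma> \<tau> w)"
  proof (rule Bochner_Integration.integrable_bound[OF integrable_T(1)])
    show "AE w in W. norm (p w * Y \<sigma> \<tau> w) \<le> norm ((T w)\<^sup>2)"
      unfolding power2_eq_square real_norm_def abs_mult using pT YT T0 by (intro AE_I2 mult_mono) auto
  qed measurable
  have qi: "integrable W q" unfolding q_def using integrable_fst_W[OF q0] by simp
  have ri: "integrable W r" unfolding r_def using integrable_fst_W[OF integrable_M(6)] by simp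
  have zero: "(\<integral>w. (complex_of_real (p w) + \<i> * l * q w - (complex_of_real l)\<^sup>2 * r w) * cis (l * Y \<sigma> \<tau> w) \<partial>W) = 0" for l :: real
  proof -
    let ?A = "\<lambda>w. (complex_of_real (F (fst w)) - \<i> * l * (dh (fst w) + \<sigma> * dF (fst w)) + (l\<^sup>2 * \<tau>\<^sup>2 / 2) * dB (fst w)) * cis (l * Y \<sigma> \<tau> w)"
    let ?B = "\<lambda>w. (complex_of_real (S (fst w) * snd w) - \<i> * l * (\<tau> * (S (fst w))\<^sup>2)) * cis (l * Y \<sigma> \<tau> w)"
    have "(\<lambda>w. (complex_of_real (p w) + \<i> * l * q w - (complex_of_real l)\<^sup>2 * r w) * cis (l * Y \<sigma> \<tau> w))
      = (\<lambda>w. complex_of_real \<tau> * ?A w - complex_of_real \<sigma> * ?B w)"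
      unfolding p_def q_def q0_def r_def by (rule ext) (simp add: algebra_simps power2_eq_square power3_eq_cube)
    moreover have "(\<integral>w. complex_of_real \<tau> * ?A w - complex_of_real \<sigma> * ?B w \<partial>W) = 0"
      using fourier_zero_F(1)[of l \<sigma> \<tau>] fourier_zero_S(1)[of l \<tau> \<sigma>]
      by (subst Bochner_Integration.integral_diff)
        (intro Bochner_Integration.integrable_mult_right fourier_zero_F(2), intro Bochner_Integration.integrable_mult_right fourier_zero_S(2), simp)
    ultimately show ?thesis by simp
  qed
  have main: "(\<integral>w. p w * \<phi>1 (Y \<sigma> \<tau> w) + q w * \<phi>2 (Y \<sigma> \<tau> w) + r w * \<phi>3 (Y \<sigma> \<tau> w) \<partial>W) = 0"
    by (rule fourier_ibp[OF W.prob_space_axioms _ pi qi ri pYi zero d c b]) measurable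
  have C: "0 \<le> C2" "0 \<le> C3" using b(1)[of 0] b(2)[of 0] by simp_all
  have bi: "integrable W (\<lambda>w. f w * g (Y \<sigma> \<tau> w))" if "integrable W f" "g \<in> borel_measurable borel" "\<And>t. \<bar>g t\<bar> \<le> K"
    for f :: "'w \<times> real \<Rightarrow> real" and g :: "real \<Rightarrow> real" and K
  proof (rule Bochner_Integration.integrable_bound[where f="\<lambda>w. K * f w"])
    show "integrable W (\<lambda>w. K * f w)" using that(1) by simp
    show "(\<lambda>w. f w * g (Y \<sigma> \<tau> w)) \<in> borel_measurable W" using that(1,2) by measurable
    show "AE w in W. norm (f w * g (Y \<sigma> \<tau> w)) \<le> norm (K * f w)"
    proof (rule AE_I2)
      fix w
      have "\<bar>g (Y \<sigma> \<tau> w)\<bar> * \<bar>f w\<bar> \<le> \<bar>K\<bar> * \<bar>f w\<bar>"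
        using that(3)[of "Y \<sigma> \<tau> w"] by (intro mult_right_mono) auto
      thus "norm (f w * g (Y \<sigma> \<tau> w)) \<le> norm (K * f w)" by (simp add: abs_mult mult.commute)
    qed
  qed
  have i2: "integrable W (\<lambda>w. q w * \<phi>2 (Y \<sigma> \<tau> w))" "integrable W (\<lambda>w. r w * \<phi>3 (Y \<sigma> \<tau> w))"
    by (rule bi[OF qi \<phi>m(2) b(1)], rule bi[OF ri \<phi>m(3) b(2)])
  have growth: "\<bar>\<phi>1 t\<bar> \<le> \<bar>\<phi>1 0\<bar> + C2 * \<bar>t\<bar>" for t
  proof -
    have "norm (\<phi>1 t - \<phi>1 0) \<le> C2 * norm (t - 0)"
      by (rule field_differentiable_bound[where S=UNIV and f'=\<phi>2]) (use d(1) b(1) in auto)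
    thus ?thesis by simp
  qed
  have i1: "integrable W (\<lambda>w. p w * \<phi>1 (Y \<sigma> \<tau> w))"
  proof (rule Bochner_Integration.integrable_bound[where f="\<lambda>w. \<bar>\<phi>1 0\<bar> * \<bar>p w\<bar> + C2 * \<bar>p w * Y \<sigma> \<tau> w\<bar>"])
    show "integrable W (\<lambda>w. \<bar>\<phi>1 0\<bar> * \<bar>p w\<bar> + C2 * \<bar>p w * Y \<sigma> \<tau> w\<bar>)" using pi pYi by simp
    show "AE w in W. norm (p w * \<phi>1 (Y \<sigma> \<tau> w)) \<le> norm (\<bar>\<phi>1 0\<bar> * \<bar>p w\<bar> + C2 * \<bar>p w * Y \<sigma> \<tau> w\<bar>)"
    proof (rule AE_I2)
      fix w
      have "\<bar>p w\<bar> * \<bar>\<phi>1 (Y \<sigma> \<tau> w)\<bar> \<le> \<bar>p w\<bar> * (\<bar>\<phi>1 0\<bar> + C2 * \<bar>Y \<sigma> \<tau> w\<bar>)"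
        by (intro mult_left_mono growth) auto
      also have "\<dots> = \<bar>\<phi>1 0\<bar> * \<bar>p w\<bar> + C2 * \<bar>p w * Y \<sigma> \<tau> w\<bar>" by (simp add: abs_mult algebra_simps)
      finally have le: "\<bar>p w\<bar> * \<bar>\<phi>1 (Y \<sigma> \<tau> w)\<bar> \<le> \<bar>\<phi>1 0\<bar> * \<bar>p w\<bar> + C2 * \<bar>p w * Y \<sigma> \<tau> w\<bar>" .
      show "norm (p w * \<phi>1 (Y \<sigma> \<tau> w)) \<le> norm (\<bar>\<phi>1 0\<bar> * \<bar>p w\<bar> + C2 * \<bar>p w * Y \<sigma> \<tau> w\<bar>)"
        unfolding real_norm_def abs_mult[of "p w" "\<phi>1 _"] by (rule order_trans[OF le abs_ge_self])
    qed
  qed measurable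
  have "(\<integral>w. p w * \<phi>1 (Y \<sigma> \<tau> w) \<partial>W) = - ((\<integral>w. q w * \<phi>2 (Y \<sigma> \<tau> w) \<partial>W) + (\<integral>w. r w * \<phi>3 (Y \<sigma> \<tau> w) \<partial>W))"
    using main i1 i2 by simp
  hence "\<bar>\<integral>w. p w * \<phi>1 (Y \<sigma> \<tau> w) \<partial>W\<bar> \<le> \<bar>\<integral>w. q w * \<phi>2 (Y \<sigma> \<tau> w) \<partial>W\<bar> + \<bar>\<integral>w. r w * \<phi>3 (Y \<sigma> \<tau> w) \<partial>W\<bar>" by linarith
  also have "\<dots> \<le> (\<integral>w. C2 * \<bar>q w\<bar> \<partial>W) + (\<integral>w. C3 * \<bar>r w\<bar> \<partial>W)"
  proof (intro add_mono)
    have "norm (\<integral>w. q w * \<phi>2 (Y \<sigma> \<tau> w) \<partial>W) \<le> (\<integral>w. C2 * \<bar>q w\<bar> \<partial>W)"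
    proof (rule order_trans[OF integral_norm_bound integral_mono])
      show "integrable W (\<lambda>w. norm (q w * \<phi>2 (Y \<sigma> \<tau> w)))" by (rule Bochner_Integration.integrable_norm[OF i2(1)])
      show "integrable W (\<lambda>w. C2 * \<bar>q w\<bar>)" using qi by simp
      show "norm (q w * \<phi>2 (Y \<sigma> \<tau> w)) \<le> C2 * \<bar>q w\<bar>" for w
        unfolding real_norm_def abs_mult mult.commute[of "\<bar>q w\<bar>"] by (rule mult_right_mono[OF b(1)]) simp
    qed
    thus "\<bar>\<integral>w. q w * \<phi>2 (Y \<sigma> \<tau> w) \<partial>W\<bar> \<le> (\<integral>w. C2 * \<bar>q w\<bar> \<partial>W)" by simp
    have "norm (\<integral>w. r w * \<phi>3 (Y \<sigma> \<tau> w) \<partial>W) \<le> (\<integral>w. C3 * \<bar>r w\<bar> \<partial>W)"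
    proof (rule order_trans[OF integral_norm_bound integral_mono])
      show "integrable W (\<lambda>w. norm (r w * \<phi>3 (Y \<sigma> \<tau> w)))" by (rule Bochner_Integration.integrable_norm[OF i2(2)])
      show "integrable W (\<lambda>w. C3 * \<bar>r w\<bar>)" using ri by simp
      show "norm (r w * \<phi>3 (Y \<sigma> \<tau> w)) \<le> C3 * \<bar>r w\<bar>" for w
        unfolding real_norm_def abs_mult mult.commute[of "\<bar>r w\<bar>"] by (rule mult_right_mono[OF b(2)]) simp
    qed
    thus "\<bar>\<integral>w. r w * \<phi>3 (Y \<sigma> \<tau> w) \<partial>W\<bar> \<le> (\<integral>w. C3 * \<bar>r w\<bar> \<partial>W)" by simp
  qed
  also have "(\<integral>w. C2 * \<bar>q w\<bar> \<partial>W) = C2 * (\<integral>\<omega>. \<bar>q0 \<omega>\<bar> \<partial>M)"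
    using integral_fst_W[OF integrable_abs[OF q0]] by (simp add: q_def)
  also have "(\<integral>w. C3 * \<bar>r w\<bar> \<partial>W) = C3 * (\<tau> ^ 3 / 2 * (\<integral>\<omega>. \<bar>dB \<omega>\<bar> \<partial>M))"
    using integral_fst_W[OF integrable_abs[OF integrable_M(6)]] st by (simp add: r_def abs_mult)
  also have "(\<integral>\<omega>. \<bar>q0 \<omega>\<bar> \<partial>M) \<le> (\<integral>\<omega>. \<tau> * \<bar>dh \<omega>\<bar> + \<sigma> * \<tau> * \<bar>dF \<omega> - (S \<omega>)\<^sup>2\<bar> \<partial>M)"
  proof (rule integral_mono)
    show "integrable M (\<lambda>\<omega>. \<bar>q0 \<omega>\<bar>)" using q0 by simp
    show "integrable M (\<lambda>\<omega>. \<tau> * \<bar>dh \<omega>\<bar> + \<sigma> * \<tau> * \<bar>dF \<omega> - (S \<omega>)\<^sup>2\<bar>)" using integrable_M by simp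
    show "\<bar>q0 \<omega>\<bar> \<le> \<tau> * \<bar>dh \<omega>\<bar> + \<sigma> * \<tau> * \<bar>dF \<omega> - (S \<omega>)\<^sup>2\<bar>" for \<omega>
      unfolding q0_def using st by (intro order_trans[OF abs_triangle_ineq]) (simp add: abs_mult)
  qed
  also have "\<dots> = \<tau> * (\<integral>\<omega>. \<bar>dh \<omega>\<bar> \<partial>M) + \<sigma> * \<tau> * (\<integral>\<omega>. \<bar>dF \<omega> - (S \<omega>)\<^sup>2\<bar> \<partial>M)"
    using integrable_M by simp
  finally show ?thesis using C unfolding p_def by (simp add: mult_left_mono)
qed

text \<open>A bounded second derivative gives linear growth of \<phi>1 and quadratic growth of
  \<phi>, and the square of the majorant \<open>T\<close> is integrable.\<close>

lemma integrable_C2_growth: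
  fixes \<phi> \<phi>1 \<phi>2 :: "real \<Rightarrow> real"
  assumes d: "\<And>t. (\<phi> has_real_derivative \<phi>1 t) (at t)" "\<And>t. (\<phi>1 has_real_derivative \<phi>2 t) (at t)"
    and b: "\<And>t. \<bar>\<phi>2 t\<bar> \<le> C2" and st: "\<bar>\<sigma>\<bar> \<le> 1" "\<bar>\<tau>\<bar> \<le> 1"
  shows "\<bar>\<phi>1 t\<bar> \<le> \<bar>\<phi>1 0\<bar> + C2 * \<bar>t\<bar>" "integrable W (\<lambda>w. \<phi> (Y \<sigma> \<tau> w))"
proof -
  have C: "0 \<le> C2" using b[of 0] by simp
  have growth: "\<bar>\<phi>1 t\<bar> \<le> \<bar>\<phi>1 0\<bar> + C2 * \<bar>t\<bar>" for t
  proof -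
    have "norm (\<phi>1 t - \<phi>1 0) \<le> C2 * norm (t - 0)"
      by (rule field_differentiable_bound[where S=UNIV and f'=\<phi>2]) (use d(2) b in auto)
    thus ?thesis by simp
  qed
  thus "\<bar>\<phi>1 t\<bar> \<le> \<bar>\<phi>1 0\<bar> + C2 * \<bar>t\<bar>" .
  have growth2: "\<bar>\<phi> t\<bar> \<le> \<bar>\<phi> 0\<bar> + (\<bar>\<phi>1 0\<bar> * \<bar>t\<bar> + C2 * \<bar>t\<bar>\<^sup>2)" for t
  proof -
    have "norm (\<phi> t - \<phi> 0) \<le> (\<bar>\<phi>1 0\<bar> + C2 * \<bar>t\<bar>) * norm (t - 0)"
    proof (rule field_differentiable_bound[where S="{-\<bar>t\<bar>..\<bar>t\<bar>}" and f'=\<phi>1])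
      show "(\<phi> has_real_derivative \<phi>1 z) (at z within {-\<bar>t\<bar>..\<bar>t\<bar>})" for z
        by (rule has_field_derivative_at_within[OF d(1)])
      show "norm (\<phi>1 z) \<le> \<bar>\<phi>1 0\<bar> + C2 * \<bar>t\<bar>" if "z \<in> {-\<bar>t\<bar>..\<bar>t\<bar>}" for z
      proof -
        have "C2 * \<bar>z\<bar> \<le> C2 * \<bar>t\<bar>" using that by (intro mult_left_mono C) auto
        thus ?thesis using growth[of z] by simp
      qed
    qed (auto simp: abs_le_iff)
    thus ?thesis by (simp add: algebra_simps power2_eq_square)
  qed
  have [measurable]: "\<phi> \<in> borel_measurable borel"
    by (intro borel_measurable_continuous_onI continuous_at_imp_continuous_on ballI DERIV_isCont[OF d(1)])
  show "integrable W (\<lambda>w. \<phi> (Y \<sigma> \<tau> w))"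
  proof (rule Bochner_Integration.integrable_bound)
    show "integrable W (\<lambda>w. \<bar>\<phi> 0\<bar> + (\<bar>\<phi>1 0\<bar> * T w + C2 * (T w)\<^sup>2))"
      using integrable_T by simp
    show "AE w in W. norm (\<phi> (Y \<sigma> \<tau> w)) \<le> norm (\<bar>\<phi> 0\<bar> + (\<bar>\<phi>1 0\<bar> * T w + C2 * (T w)\<^sup>2))"
    proof (rule AE_I2)
      fix w
      have "\<bar>\<phi> (Y \<sigma> \<tau> w)\<bar> \<le> \<bar>\<phi> 0\<bar> + (\<bar>\<phi>1 0\<bar> * \<bar>Y \<sigma> \<tau> w\<bar> + C2 * \<bar>Y \<sigma> \<tau> w\<bar>\<^sup>2)" by (rule growth2)
      also have "\<dots> \<le> \<bar>\<phi> 0\<bar> + (\<bar>\<phi>1 0\<bar> * T w + C2 * (T w)\<^sup>2)"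
        using abs_Y_le[OF st, of w] C by (intro add_mono order_refl mult_left_mono power_mono) auto
      finally have le: "\<bar>\<phi> (Y \<sigma> \<tau> w)\<bar> \<le> \<bar>\<phi> 0\<bar> + (\<bar>\<phi>1 0\<bar> * T w + C2 * (T w)\<^sup>2)" .
      show "norm (\<phi> (Y \<sigma> \<tau> w)) \<le> norm (\<bar>\<phi> 0\<bar> + (\<bar>\<phi>1 0\<bar> * T w + C2 * (T w)\<^sup>2))"
        unfolding real_norm_def by (rule order_trans[OF le abs_ge_self])
    qed
  qed measurable
qed

text \<open>The derivative is taken along each trajectory and integrated in time by the fundamental
  theorem of calculus; Fubini then moves the expectation inside the time integral, where
  \<open>interpolation_ibp\<close> bounds it pointwise. No differentiation under the expectation
  occurs.\<close>

lemma interpolation_bound: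
  fixes \<phi> \<phi>1 \<phi>2 \<phi>3 :: "real \<Rightarrow> real"
  assumes d: "\<And>t. (\<phi> has_real_derivative \<phi>1 t) (at t)" "\<And>t. (\<phi>1 has_real_derivative \<phi>2 t) (at t)"
      "\<And>t. (\<phi>2 has_real_derivative \<phi>3 t) (at t)"
    and c: "continuous_on UNIV \<phi>3" and b: "\<And>t. \<bar>\<phi>2 t\<bar> \<le> C2" "\<And>t. \<bar>\<phi>3 t\<bar> \<le> C3"
  shows "\<bar>(\<integral>\<omega>. \<phi> (F \<omega> + X h \<omega>) \<partial>M) - (\<integral>w. \<phi> (S (fst w) * snd w + X h (fst w)) \<partial>W)\<bar>
    \<le> C2 * ((\<integral>\<omega>. \<bar>dh \<omega>\<bar> \<partial>M) + 1 / 2 * (\<integral>\<omega>. \<bar>dF \<omega> - (S \<omega>)\<^sup>2\<bar> \<partial>M)) + 1 / 3 * C3 * (\<integral>\<omega>. \<bar>dB \<omega>\<bar> \<partial>M)"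
proof -
  let ?I = "{0..pi / 2}"
  define e1 where "e1 = (\<integral>\<omega>. \<bar>dh \<omega>\<bar> \<partial>M)"
  define e2 where "e2 = (\<integral>\<omega>. \<bar>dF \<omega> - (S \<omega>)\<^sup>2\<bar> \<partial>M)"
  define e3 where "e3 = (\<integral>\<omega>. \<bar>dB \<omega>\<bar> \<partial>M)"
  define Z where "Z = (\<lambda>s w. cos s * F (fst w) - sin s * (S (fst w) * snd w))"
  define D where "D = (\<lambda>s w. Z s w * \<phi>1 (Y (sin s) (cos s) w))"
  interpret P: pair_sigma_finite lborel W ..
  have \<phi>1c: "isCont \<phi>1 t" for t by (rule DERIV_isCont[OF d(2)])
  have [measurable]: "\<phi>1 \<in> borel_measurable borel"
    by (intro borel_measurable_continuous_onI continuous_at_imp_continuous_on ballI \<phi>1c)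
  have Dm[measurable]: "(\<lambda>(s, w). D s w) \<in> borel_measurable (lborel \<Otimes>\<^sub>M W)"
    unfolding D_def Z_def Y_def by measurable
  have T0: "0 \<le> T w" for w unfolding T_def by simp
  have sc: "\<bar>sin s\<bar> \<le> 1" "\<bar>cos s\<bar> \<le> 1" for s :: real by simp_all
  have C: "0 \<le> C2" using b(1)[of 0] by simp
  \<comment> \<open>A majorant of the time derivative at every s: \<open>T\<close> bounds the speed,
    and linear growth of \<phi>1 bounds the other factor.\<close>
  define K where "K = (\<lambda>w. T w * (\<bar>\<phi>1 0\<bar> + C2 * T w))"
  have Ki: "integrable W K"
  proof -
    have "K = (\<lambda>w. \<bar>\<phi>1 0\<bar> * T w + C2 * (T w)\<^sup>2)" unfolding K_def by (simp add: fun_eq_iff power2_eq_square algebra_simps)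
    thus ?thesis using integrable_T by simp
  qed
  have DK: "\<bar>D s w\<bar> \<le> K w" for s w
  proof -
    have "\<bar>Z s w\<bar> \<le> \<bar>cos s\<bar> * \<bar>F (fst w)\<bar> + \<bar>sin s\<bar> * \<bar>S (fst w) * snd w\<bar>"
      unfolding Z_def by (intro order_trans[OF abs_triangle_ineq4]) (simp add: abs_mult)
    also have "\<dots> \<le> 1 * \<bar>F (fst w)\<bar> + 1 * \<bar>S (fst w) * snd w\<bar>"
      by (intro add_mono mult_right_mono sc) auto
    finally have 1: "\<bar>Z s w\<bar> \<le> T w" unfolding T_def by simp
    have "\<bar>\<phi>1 (Y (sin s) (cos s) w)\<bar> \<le> \<bar>\<phi>1 0\<bar> + C2 * \<bar>Y (sin s) (cos s) w\<bar>"
      by (rule integrable_C2_growth(1)[OF d(1,2) b(1) sc])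
    also have "\<dots> \<le> \<bar>\<phi>1 0\<bar> + C2 * T w" by (intro add_mono order_refl mult_left_mono abs_Y_le sc C)
    finally have 2: "\<bar>\<phi>1 (Y (sin s) (cos s) w)\<bar> \<le> \<bar>\<phi>1 0\<bar> + C2 * T w" .
    show ?thesis unfolding D_def K_def abs_mult by (intro mult_mono 1 2 T0) auto
  qed
  have int: "integrable (lborel \<Otimes>\<^sub>M W) (\<lambda>(s, w). indicator ?I s * D s w)"
  proof (rule Bochner_Integration.integrable_bound)
    show "integrable (lborel \<Otimes>\<^sub>M W) (\<lambda>p. indicator ?I (fst p) * K (snd p))"
      by (intro P.integrable_product_mult Ki integrable_real_indicator) simp_all
    show "(\<lambda>(s, w). indicator ?I s * D s w) \<in> borel_measurable (lborel \<Otimes>\<^sub>M W)" by measurable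
    show "AE p in lborel \<Otimes>\<^sub>M W. norm (case p of (s, w) \<Rightarrow> indicator ?I s * D s w) \<le> norm (indicator ?I (fst p) * K (snd p))"
      using DK order_trans[OF DK abs_ge_self] by (intro AE_I2) (auto simp: indicator_def)
  qed
  have ftc: "(\<integral>s. indicator ?I s * D s w \<partial>lborel) = \<phi> (Y 1 0 w) - \<phi> (Y 0 1 w)" for w
  proof -
    have Yd: "((\<lambda>s. Y (sin s) (cos s) w) has_real_derivative Z s w) (at s)" for s
      unfolding Y_def Z_def by (auto intro!: derivative_eq_intros)
    have "((\<lambda>s. \<phi> (Y (sin s) (cos s) w)) has_real_derivative D s w) (at s)" for s
      unfolding D_def mult.commute[of "Z s w"] by (rule DERIV_chain2[OF d(1) Yd])
    hence dv: "((\<lambda>s. \<phi> (Y (sin s) (cos s) w)) has_vector_derivative D s w) (at s within ?I)" for s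
      unfolding has_real_derivative_iff_has_vector_derivative by (rule has_vector_derivative_at_within)
    have "continuous_on ?I (\<lambda>s. D s w)" unfolding D_def
    proof (intro continuous_on_mult)
      show "continuous_on ?I (\<lambda>s. Z s w)" unfolding Z_def by (intro continuous_intros)
      show "continuous_on ?I (\<lambda>s. \<phi>1 (Y (sin s) (cos s) w))"
        by (intro continuous_at_imp_continuous_on ballI isCont_o2[OF DERIV_isCont[OF Yd] \<phi>1c])
    qed
    from integral_FTC_Icc[OF _ dv this] show ?thesis by simp
  qed
  have fub: "(\<integral>w. (\<integral>s. indicator ?I s * D s w \<partial>lborel) \<partial>W) = (\<integral>s. indicator ?I s * (\<integral>w. D s w \<partial>W) \<partial>lborel)"
    using P.Fubini_integral[OF int] by simp
  define g where "g = (\<lambda>s. C2 * (cos s * e1 + sin s * cos s * e2) + C3 * (cos s ^ 3 / 2 * e3))"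
  have gD: "\<bar>\<integral>w. D s w \<partial>W\<bar> \<le> g s" if "s \<in> ?I" for s
  proof -
    have "0 \<le> sin s" "0 \<le> cos s" using that by (auto intro!: sin_ge_zero cos_ge_zero)
    from interpolation_ibp[OF d(2,3) c b this(1) sin_le_one this(2) cos_le_one]
    show ?thesis unfolding D_def Z_def g_def e1_def e2_def e3_def .
  qed
  \<comment> \<open>The primitive of the bound \<open>g\<close>; its increments over the quarter
    period are the constants 1, 1/2 and (1 - 1/3)/2 = 1/3.\<close>
  define \<Gamma> where "\<Gamma> = (\<lambda>s. C2 * (sin s * e1 + (sin s)\<^sup>2 / 2 * e2) + C3 * ((sin s - sin s ^ 3 / 3) / 2 * e3))"
  have \<Gamma>d: "(\<Gamma> has_real_derivative g s) (at s)" for s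
  proof -
    have "(\<Gamma> has_real_derivative C2 * (cos s * e1 + sin s * cos s * e2) + C3 * ((cos s - (sin s)\<^sup>2 * cos s) / 2 * e3)) (at s)"
      unfolding \<Gamma>_def by ((auto intro!: derivative_eq_intros)[1], simp add: field_simps)
    moreover have "cos s - (sin s)\<^sup>2 * cos s = cos s ^ 3"
      unfolding sin_squared_eq by (simp add: power2_eq_square power3_eq_cube algebra_simps)
    ultimately show ?thesis unfolding g_def by simp
  qed
  have gc: "continuous_on ?I g" unfolding g_def by (intro continuous_intros) simp_all
  have \<Gamma>v: "(\<Gamma> has_vector_derivative g s) (at s within ?I)" for s
    by (rule has_vector_derivative_at_within[OF \<Gamma>d[unfolded has_real_derivative_iff_has_vector_derivative]])
  have gint: "(\<integral>s. indicator ?I s *\<^sub>R g s \<partial>lborel) = \<Gamma> (pi / 2) - \<Gamma> 0"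
    by (rule integral_FTC_Icc[OF _ \<Gamma>v gc]) simp
  have gi: "integrable lborel (\<lambda>s. indicator ?I s *\<^sub>R g s)"
    by (rule borel_integrable_compact[OF compact_Icc gc])
  have Ji: "integrable lborel (\<lambda>s. indicator ?I s * (\<integral>w. D s w \<partial>W))"
    using P.integrable_fst'[OF int] by simp
  have "norm (\<integral>s. indicator ?I s * (\<integral>w. D s w \<partial>W) \<partial>lborel) \<le> (\<integral>s. indicator ?I s *\<^sub>R g s \<partial>lborel)"
  proof (rule order_trans[OF integral_norm_bound integral_mono])
    show "integrable lborel (\<lambda>s. norm (indicator ?I s * (\<integral>w. D s w \<partial>W)))" by (rule Bochner_Integration.integrable_norm[OF Ji])
    show "integrable lborel (\<lambda>s. indicator ?I s *\<^sub>R g s)" by (rule gi)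
    show "norm (indicator ?I s * (\<integral>w. D s w \<partial>W)) \<le> indicator ?I s *\<^sub>R g s" for s
      using gD[of s] by (cases "s \<in> ?I") simp_all
  qed
  hence bound: "\<bar>\<integral>w. \<phi> (Y 1 0 w) - \<phi> (Y 0 1 w) \<partial>W\<bar> \<le> \<Gamma> (pi / 2) - \<Gamma> 0"
    unfolding gint fub[symmetric] ftc by simp
  have i1: "integrable W (\<lambda>w. \<phi> (Y 1 0 w))" "integrable W (\<lambda>w. \<phi> (Y 0 1 w))"
    by (rule integrable_C2_growth(2)[OF d(1,2) b(1)]; simp)+
  have "(\<integral>w. \<phi> (Y 1 0 w) \<partial>W) = (\<integral>\<omega>. \<phi> (F \<omega> + X h \<omega>) \<partial>M)"
  proof -
    have "measure G UNIV = 1" using G.prob_space by simp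
    thus ?thesis using W.integral_fst'[OF i1(1)] by (simp add: Y_def add.commute)
  qed
  moreover have "(\<integral>w. \<phi> (Y 0 1 w) \<partial>W) = (\<integral>w. \<phi> (S (fst w) * snd w + X h (fst w)) \<partial>W)"
    by (simp add: Y_def add.commute)
  moreover have "\<Gamma> (pi / 2) - \<Gamma> 0 = C2 * (e1 + 1 / 2 * e2) + 1 / 3 * C3 * e3"
    unfolding \<Gamma>_def by simp
  ultimately show ?thesis
    using bound i1 unfolding e1_def e2_def e3_def by simp
qed

end

section \<open>From the extension to the product space\<close>

text \<open>Only the joint law of \<eta>, S and X h enters. It is a product law once S is replaced
  by a version measurable for the sigma-algebra generated by X, since independence is assumed for
  that sigma-algebra and not for its completion.\<close>

lemma integral_extension_eq_product:
  fixes X :: "'h \<Rightarrow> 'w \<Rightarrow> real" and S :: "'w \<Rightarrow> real" and \<phi> :: "real \<Rightarrow> real"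
  assumes M: "prob_space M" and Xm[measurable]: "\<And>g. X g \<in> borel_measurable M"
    and gen: "completion_of_generated M X"
    and N: "prob_space N" and \<pi>[measurable]: "\<pi> \<in> measurable N M" and law: "distr N M \<pi> = M"
    and S[measurable]: "S \<in> borel_measurable M"
    and \<eta>: "distributed N lborel \<eta> std_normal_density"
    and indep: "prob_space.indep_set N (sets (vimage_algebra (space N) \<eta> borel))
                  (sets (generated_algebra N (\<lambda>g \<omega>. X g (\<pi> \<omega>))))"
    and \<phi>[measurable]: "\<phi> \<in> borel_measurable borel"
  shows "(\<integral>\<omega>. \<phi> (S (\<pi> \<omega>) * \<eta> \<omega> + X h (\<pi> \<omega>)) \<partial>N)
    = (\<integral>w. \<phi> (S (fst w) * snd w + X h (fst w)) \<partial>(M \<Otimes>\<^sub>M std_normal_distribution))"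
proof -
  let ?G = std_normal_distribution
  interpret M: prob_space M by (rule M)
  interpret N: prob_space N by (rule N)
  interpret G: prob_space ?G by (rule prob_space_normal_density) simp
  interpret GM: pair_prob_space ?G M ..
  let ?A = "generated_algebra M X" and ?AN = "generated_algebra N (\<lambda>g \<omega>. X g (\<pi> \<omega>))"
  have \<eta>m[measurable]: "\<eta> \<in> borel_measurable N" using distributed_measurable[OF \<eta>] by simp
  have XP: "process_map X \<in> measurable M (\<Pi>\<^sub>M i\<in>UNIV. borel)"
    unfolding process_map_def[abs_def] by (rule measurable_abs_UNIV) simp
  have sub: "subalgebra M ?A"
    unfolding subalgebra_def generated_algebra_def using sets_image_in_sets[OF refl XP] by simp
  have XPA: "process_map X \<in> measurable ?A (\<Pi>\<^sub>M i\<in>UNIV. borel)"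
    unfolding generated_algebra_def by (rule measurable_vimage_algebra1) (auto simp: space_PiM)
  have XA: "X h \<in> borel_measurable ?A"
    using measurable_compose[OF XPA measurable_component_singleton[of h UNIV]]
    by (simp add: process_map_def)
  \<comment> \<open>A function measurable for a completion agrees almost everywhere with one
    measurable for the original sigma-algebra; the exceptional set is null for the restricted
    measure, hence also for \<open>M\<close>.\<close>
  have "S \<in> borel_measurable (completion (restr_to_subalg M ?A))"
    using S gen unfolding completion_of_generated_def by (simp cong: measurable_cong_sets)
  then obtain S' where S': "S' \<in> borel_measurable (restr_to_subalg M ?A)" "AE x in restr_to_subalg M ?A. S x = S' x"
    using completion_ex_borel_measurable_real by blast
  have SA: "S' \<in> borel_measurable ?A"
    using S'(1) sets_restr_to_subalg[OF sub] by (simp cong: measurable_cong_sets)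
  have ae: "AE x in M. S x = S' x" by (rule AE_restr_to_subalg[OF sub S'(2)])
  define V where "V = (\<lambda>\<omega>. (S' \<omega>, X h \<omega>))"
  let ?B = "borel \<Otimes>\<^sub>M borel :: (real \<times> real) measure"
  have VA: "V \<in> measurable ?A ?B" unfolding V_def using SA XA by simp
  have VM[measurable]: "V \<in> measurable M ?B" using measurable_from_subalg[OF sub VA] .
  have \<pi>A: "\<pi> \<in> measurable ?AN ?A"
    unfolding generated_algebra_def[of M X]
  proof (rule measurable_vimage_algebra2)
    show "\<pi> \<in> space ?AN \<rightarrow> space M" using measurable_space[OF \<pi>] by (auto simp: generated_algebra_def)
    have "process_map (\<lambda>g \<omega>. X g (\<pi> \<omega>)) \<in> measurable ?AN (\<Pi>\<^sub>M i\<in>UNIV. borel)"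
      unfolding generated_algebra_def by (rule measurable_vimage_algebra1) (auto simp: space_PiM)
    thus "(\<lambda>x. process_map X (\<pi> x)) \<in> measurable ?AN (\<Pi>\<^sub>M i\<in>UNIV. borel)" by (simp add: process_map_def[abs_def])
  qed
  have V\<pi>: "(\<lambda>\<omega>. V (\<pi> \<omega>)) \<in> measurable ?AN ?B" by (rule measurable_compose[OF \<pi>A VA])
  let ?E = "\<lambda>y::real. (y, 0::real)"
  have E\<eta>: "(\<lambda>\<omega>. ?E (\<eta> \<omega>)) \<in> measurable (vimage_algebra (space N) \<eta> borel) ?B"
    by (rule measurable_compose[OF measurable_vimage_algebra1]) simp_all
  \<comment> \<open>\<open>indep_var\<close> takes two random variables of one type, so \<open>\<eta>\<close> is paired with \<open>0\<close>.\<close>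
  have "N.indep_var ?B (\<lambda>\<omega>. ?E (\<eta> \<omega>)) ?B (\<lambda>\<omega>. V (\<pi> \<omega>))"
    unfolding N.indep_var_eq
  proof (intro conjI)
    show "N.random_variable ?B (\<lambda>\<omega>. ?E (\<eta> \<omega>))" "N.random_variable ?B (\<lambda>\<omega>. V (\<pi> \<omega>))" by measurable
    have "sigma_sets (space N) {(\<lambda>\<omega>. V (\<pi> \<omega>)) -` A \<inter> space N |A. A \<in> sets ?B} \<subseteq> sets ?AN"
      unfolding sets_vimage_algebra[symmetric]
      by (rule sets_image_in_sets[OF _ V\<pi>]) (simp add: generated_algebra_def)
    moreover have "sigma_sets (space N) {(\<lambda>\<omega>. ?E (\<eta> \<omega>)) -` A \<inter> space N |A. A \<in> sets ?B} \<subseteq> sets (vimage_algebra (space N) \<eta> borel)"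
      unfolding sets_vimage_algebra[of _ "\<lambda>\<omega>. ?E (\<eta> \<omega>)", symmetric]
      by (rule sets_image_in_sets[OF _ E\<eta>]) simp
    ultimately show "N.indep_set (sigma_sets (space N) {(\<lambda>\<omega>. ?E (\<eta> \<omega>)) -` A \<inter> space N |A. A \<in> sets ?B})
        (sigma_sets (space N) {(\<lambda>\<omega>. V (\<pi> \<omega>)) -` A \<inter> space N |A. A \<in> sets ?B})"
      using indep unfolding N.indep_set_def
      by (elim N.indep_sets_mono_sets) (auto split: bool.split)
  qed
  hence pair: "distr N ?B (\<lambda>\<omega>. ?E (\<eta> \<omega>)) \<Otimes>\<^sub>M distr N ?B (\<lambda>\<omega>. V (\<pi> \<omega>))
      = distr N (?B \<Otimes>\<^sub>M ?B) (\<lambda>\<omega>. (?E (\<eta> \<omega>), V (\<pi> \<omega>)))"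
    by (simp add: N.indep_var_distribution_eq)
  have \<eta>l: "\<eta> \<in> measurable N lborel" by simp
  have El: "?E \<in> measurable lborel ?B" by simp
  have "distr N ?B (\<lambda>\<omega>. ?E (\<eta> \<omega>)) = distr (distr N lborel \<eta>) ?B ?E"
    using distr_distr[OF El \<eta>l] by (simp add: o_def)
  hence d\<eta>: "distr N ?B (\<lambda>\<omega>. ?E (\<eta> \<omega>)) = distr ?G ?B ?E"
    unfolding distributed_distr_eq_density[OF \<eta>] .
  have "distr N ?B (\<lambda>\<omega>. V (\<pi> \<omega>)) = distr (distr N M \<pi>) ?B V"
    using distr_distr[OF VM \<pi>] by (simp add: o_def)
  hence dV: "distr N ?B (\<lambda>\<omega>. V (\<pi> \<omega>)) = distr M ?B V" by (simp add: law)
  have prod: "distr N (?B \<Otimes>\<^sub>M ?B) (\<lambda>\<omega>. (?E (\<eta> \<omega>), V (\<pi> \<omega>))) = distr (?G \<Otimes>\<^sub>M M) (?B \<Otimes>\<^sub>M ?B) (\<lambda>(y, \<omega>). (?E y, V \<omega>))"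
    unfolding pair[symmetric] d\<eta> dV
  proof (rule pair_measure_distr)
    show "sigma_finite_measure (distr M ?B V)"
      using prob_space.prob_space_distr[OF M VM] by (simp add: prob_space_imp_sigma_finite)
  qed simp_all
  define f where "f = (\<lambda>p :: (real \<times> real) \<times> (real \<times> real). \<phi> (fst (snd p) * fst (fst p) + snd (snd p)))"
  have f[measurable]: "f \<in> borel_measurable (?B \<Otimes>\<^sub>M ?B)" unfolding f_def by measurable
  \<comment> \<open>The exceptional set pulls back to a null set of the extension because \<pi>
    transports the law of \<open>N\<close> to \<open>M\<close>.\<close>
  have ae\<pi>: "AE \<omega> in N. S (\<pi> \<omega>) = S' (\<pi> \<omega>)"
  proof -
    have "AE x in distr N M \<pi>. S x = S' x" unfolding law by (rule ae)
    thus ?thesis by (rule AE_distrD[OF \<pi>])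
  qed
  have S'M[measurable]: "S' \<in> borel_measurable M" using measurable_from_subalg[OF sub SA] .
  have "(\<integral>\<omega>. \<phi> (S (\<pi> \<omega>) * \<eta> \<omega> + X h (\<pi> \<omega>)) \<partial>N) = (\<integral>\<omega>. f (?E (\<eta> \<omega>), V (\<pi> \<omega>)) \<partial>N)"
  proof (rule integral_cong_AE)
    show "AE \<omega> in N. \<phi> (S (\<pi> \<omega>) * \<eta> \<omega> + X h (\<pi> \<omega>)) = f (?E (\<eta> \<omega>), V (\<pi> \<omega>))"
      using ae\<pi> by eventually_elim (simp add: f_def V_def)
  qed measurable
  also have "\<dots> = (\<integral>p. f p \<partial>distr N (?B \<Otimes>\<^sub>M ?B) (\<lambda>\<omega>. (?E (\<eta> \<omega>), V (\<pi> \<omega>))))"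
    by (rule integral_distr[symmetric]) measurable
  also have "\<dots> = (\<integral>p. f ((\<lambda>(y, \<omega>). (?E y, V \<omega>)) p) \<partial>(?G \<Otimes>\<^sub>M M))"
    unfolding prod by (rule integral_distr) measurable
  also have "\<dots> = (\<integral>(y, \<omega>). \<phi> (S' \<omega> * y + X h \<omega>) \<partial>(?G \<Otimes>\<^sub>M M))"
    by (intro Bochner_Integration.integral_cong) (auto simp: f_def V_def)
  also have "\<dots> = (\<integral>w. \<phi> (S' (fst w) * snd w + X h (fst w)) \<partial>(M \<Otimes>\<^sub>M ?G))"
  proof -
    \<comment> \<open>The joint law was computed with the Gaussian coordinate first; the
      interpolation uses the opposite order.\<close>
    interpret MG: pair_sigma_finite M ?G ..
    show ?thesis
      using MG.integral_product_swap[of "\<lambda>w. \<phi> (S' (fst w) * snd w + X h (fst w))"] by simp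
  qed
  also have "\<dots> = (\<integral>w. \<phi> (S (fst w) * snd w + X h (fst w)) \<partial>(M \<Otimes>\<^sub>M ?G))"
  proof (rule integral_cong_AE)
    have "AE w in M \<Otimes>\<^sub>M ?G. S (fst w) = S' (fst w)"
    proof (rule AE_distrD[where f=fst and M'=M])
      have "distr (M \<Otimes>\<^sub>M ?G) M fst = M" by (rule G.distr_pair_fst)
      thus "AE x in distr (M \<Otimes>\<^sub>M ?G) M fst. S x = S' x" using ae by (simp only:)
    qed simp
    thus "AE w in M \<Otimes>\<^sub>M ?G. \<phi> (S' (fst w) * snd w + X h (fst w)) = \<phi> (S (fst w) * snd w + X h (fst w))"
      by eventually_elim simp
  qed measurable
  finally show ?thesis .
qed

theorem proposition3p1:
  fixes M :: "'w measure"
    and X :: "'h::{real_inner,banach,second_countable_topology} \<Rightarrow> 'w \<Rightarrow> real"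
    and N :: "'w2 measure" and \<pi> :: "'w2 \<Rightarrow> 'w"
    and F S :: "'w \<Rightarrow> real" and u :: "'w \<Rightarrow> 'h" and \<eta> :: "'w2 \<Rightarrow> real"
    and h :: 'h and \<phi> :: "real \<Rightarrow> real"
  assumes infinite_dim: "\<not> (\<exists>B::'h set. finite B \<and> span B = UNIV)"
    and isonormal: "isonormal_process M X"
    and generated: "completion_of_generated M X"
    and extension: "prob_space N" "\<pi> \<in> measurable N M" "distr N M \<pi> = M"
    and F: "F \<in> D12 M X" "(\<integral>\<omega>. F \<omega> \<partial>M) = 0"
    and u: "u \<in> D12_vec M X" "has_divergence M X u F"
    and S: "S \<in> borel_measurable M" "AE \<omega> in M. 0 \<le> S \<omega>" "(\<lambda>\<omega>. (S \<omega>)\<^sup>2) \<in> D12 M X"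
    and \<eta>: "distributed N lborel \<eta> std_normal_density"
    and indep: "prob_space.indep_set N (sets (vimage_algebra (space N) \<eta> borel))
                  (sets (generated_algebra N (\<lambda>g \<omega>. X g (\<pi> \<omega>))))"
    and \<phi>: "class_C 3 \<phi>" "bounded (range ((deriv ^^ 2) \<phi>))" "bounded (range ((deriv ^^ 3) \<phi>))"
  shows "\<bar>(\<integral>\<omega>. \<phi> (F \<omega> + X h \<omega>) \<partial>M) - (\<integral>\<omega>. \<phi> (S (\<pi> \<omega>) * \<eta> \<omega> + X h (\<pi> \<omega>)) \<partial>N)\<bar>
     \<le> 1/2 * (SUP x. \<bar>(deriv ^^ 2) \<phi> x\<bar>) *
          (\<integral>\<omega>. 2 * \<bar>u \<omega> \<bullet> h\<bar> + \<bar>u \<omega> \<bullet> malliavin_deriv M X F \<omega> - (S \<omega>)\<^sup>2\<bar> \<partial>M)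
       + 1/3 * (SUP x. \<bar>(deriv ^^ 3) \<phi> x\<bar>) *
          (\<integral>\<omega>. \<bar>u \<omega> \<bullet> malliavin_deriv M X (\<lambda>\<omega>. (S \<omega>)\<^sup>2) \<omega>\<bar> \<partial>M)"
proof -
  interpret isonormal M X by (rule isonormal.intro[OF isonormal])
  define \<Gamma>F where "\<Gamma>F = malliavin_deriv M X F"
  define \<Gamma>B where "\<Gamma>B = malliavin_deriv M X (\<lambda>\<omega>. (S \<omega>)\<^sup>2)"
  have dF: "has_malliavin_derivative M X F \<Gamma>F"
  proof -
    have "\<exists>\<Gamma>. has_malliavin_derivative M X F \<Gamma>" using F(1) unfolding D12_def by blast
    thus ?thesis unfolding \<Gamma>F_def malliavin_deriv_def by (rule someI_ex)
  qed
  have dB: "has_malliavin_derivative M X (\<lambda>\<omega>. (S \<omega>)\<^sup>2) \<Gamma>B"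
  proof -
    have "\<exists>\<Gamma>. has_malliavin_derivative M X (\<lambda>\<omega>. (S \<omega>)\<^sup>2) \<Gamma>" using S(3) unfolding D12_def by blast
    thus ?thesis unfolding \<Gamma>B_def malliavin_deriv_def by (rule someI_ex)
  qed
  interpret D: divergence_setting M X F S \<Gamma>F \<Gamma>B u h
    by unfold_locales (fact u dF dB S)+
  define d where "d = (\<lambda>j. (deriv ^^ j) \<phi>)"
  have der: "(d j has_real_derivative d (Suc j) t) (at t)" if "j < 3" for j t
    using \<phi>(1) that unfolding class_C_def d_def by (simp add: DERIV_deriv_iff_field_differentiable)
  have c: "continuous_on UNIV (d 3)" using \<phi>(1) unfolding class_C_def d_def by simp
  define C2 where "C2 = (SUP x. \<bar>d 2 x\<bar>)"
  define C3 where "C3 = (SUP x. \<bar>d 3 x\<bar>)"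
  \<comment> \<open>Over the reals the supremum is an upper bound only for bounded sets, and here
    the boundedness assumptions on the derivatives enter.\<close>
  have sup: "\<bar>f t\<bar> \<le> (SUP x. \<bar>f x\<bar>)" if "bounded (range f)" for f :: "real \<Rightarrow> real" and t
  proof (rule cSUP_upper)
    show "bdd_above (range (\<lambda>x. \<bar>f x\<bar>))" using that unfolding bounded_iff by (auto intro: bdd_aboveI)
  qed simp
  have b: "\<bar>d 2 t\<bar> \<le> C2" "\<bar>d 3 t\<bar> \<le> C3" for t
    unfolding C2_def C3_def using \<phi>(2,3) by (auto intro!: sup simp: d_def)
  have "d 0 = \<phi>" by (simp add: d_def)
  with der[of 0] have d0: "\<And>t. (\<phi> has_real_derivative d 1 t) (at t)" by simp
  have d1: "\<And>t. (d 1 has_real_derivative d 2 t) (at t)" using der[of 1] by (simp add: numeral_2_eq_2)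
  have d2: "\<And>t. (d 2 has_real_derivative d 3 t) (at t)" using der[of 2] by (simp add: eval_nat_numeral)
  have \<phi>m: "\<phi> \<in> borel_measurable borel"
    by (intro borel_measurable_continuous_onI continuous_at_imp_continuous_on ballI DERIV_isCont[OF d0])
  have "(\<integral>\<omega>. \<phi> (S (\<pi> \<omega>) * \<eta> \<omega> + X h (\<pi> \<omega>)) \<partial>N)
    = (\<integral>w. \<phi> (S (fst w) * snd w + X h (fst w)) \<partial>(M \<Otimes>\<^sub>M std_normal_distribution))"
    by (rule integral_extension_eq_product[OF prob_space_axioms X_measurable generated extension S(1) \<eta> indep \<phi>m])
  hence main: "\<bar>(\<integral>\<omega>. \<phi> (F \<omega> + X h \<omega>) \<partial>M) - (\<integral>\<omega>. \<phi> (S (\<pi> \<omega>) * \<eta> \<omega> + X h (\<pi> \<omega>)) \<partial>N)\<bar>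
    \<le> C2 * ((\<integral>\<omega>. \<bar>D.dh \<omega>\<bar> \<partial>M) + 1 / 2 * (\<integral>\<omega>. \<bar>D.dF \<omega> - (S \<omega>)\<^sup>2\<bar> \<partial>M)) + 1 / 3 * C3 * (\<integral>\<omega>. \<bar>D.dB \<omega>\<bar> \<partial>M)"
    using D.interpolation_bound[OF d0 d1 d2 c b] by simp
  have "(\<integral>\<omega>. 2 * \<bar>u \<omega> \<bullet> h\<bar> + \<bar>u \<omega> \<bullet> malliavin_deriv M X F \<omega> - (S \<omega>)\<^sup>2\<bar> \<partial>M)
     = (\<integral>\<omega>. 2 * \<bar>D.dh \<omega>\<bar> + \<bar>D.dF \<omega> - (S \<omega>)\<^sup>2\<bar> \<partial>M)"
    by (simp add: D.dh_def D.dF_def \<Gamma>F_def[symmetric] inner_commute)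
  \<comment> \<open>Splitting the expectation uses integrability of each part; the prefactor 1/2 of
    the claim then turns the 2 into the constant 1 obtained from the integral of cos.\<close>
  also have "\<dots> = 2 * (\<integral>\<omega>. \<bar>D.dh \<omega>\<bar> \<partial>M) + (\<integral>\<omega>. \<bar>D.dF \<omega> - (S \<omega>)\<^sup>2\<bar> \<partial>M)"
    using D.integrable_M by simp
  finally have e: "(\<integral>\<omega>. 2 * \<bar>u \<omega> \<bullet> h\<bar> + \<bar>u \<omega> \<bullet> malliavin_deriv M X F \<omega> - (S \<omega>)\<^sup>2\<bar> \<partial>M)
     = 2 * (\<integral>\<omega>. \<bar>D.dh \<omega>\<bar> \<partial>M) + (\<integral>\<omega>. \<bar>D.dF \<omega> - (S \<omega>)\<^sup>2\<bar> \<partial>M)" .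
  have e': "(\<integral>\<omega>. \<bar>u \<omega> \<bullet> malliavin_deriv M X (\<lambda>\<omega>. (S \<omega>)\<^sup>2) \<omega>\<bar> \<partial>M) = (\<integral>\<omega>. \<bar>D.dB \<omega>\<bar> \<partial>M)"
    by (simp add: D.dB_def \<Gamma>B_def[symmetric] inner_commute)
  show ?thesis
    unfolding e e' C2_def[symmetric, unfolded d_def] C3_def[symmetric, unfolded d_def]
    using main by (simp add: C2_def C3_def d_def algebra_simps)
qed

end
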